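(* Let $d\ge 1$ and let $B$ be an $n$-vertex combinatorial $d$-ball. If $n\ge d+2$, then $B$ is a subcomplex of an $n$-vertex combinatorial $d$-sphere (so the two complexes have the same vertex set) in each of the following cases. (a) $B$ has a vertex of degree $d$. (b) $d=2$.
   Context: Simplicial complexes are finite and abstract; isomorphic complexes are identified. An $n$-vertex complex is one with exactly $n$ vertices. For a simplicial complex $X$, $|X|$ denotes its geometric carrier with the induced PL structure. A simplicial complex $X$ is a combinatorial $d$-ball if $|X|$ is PL homeomorphic to a $d$-simplex, and a combinatorial $d$-sphere if $|X|$ is PL homeomorphic to the boundary of a $(d+1)$-simplex. The degree of a vertex $v$ in $X$ is the number of edges of $X$ containing $v$. *)

theory Defs
  imports "HOL-Analysis.Analysis"
begin

text \<open>Abstract complexes on vertices taken from \<^typ>\<open>'v\<close>; the elements of \<^typ>\<open>'v\<close> outside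
  \<open>vertices X\<close> are not vertices of the complex. As usual, the empty face belongs to every
  nonempty complex.\<close>

definition abstract_complex :: "'v set set \<Rightarrow> bool" where
  "abstract_complex X \<longleftrightarrow>
     finite X \<and> (\<forall>\<sigma>\<in>X. finite \<sigma>) \<and> (\<forall>\<sigma>\<in>X. \<forall>\<tau>. \<tau> \<subseteq> \<sigma> \<longrightarrow> \<tau> \<in> X)"

definition vertices :: "'v set set \<Rightarrow> 'v set" where
  "vertices X = \<Union>X"

definition vertex_degree :: "'v set set \<Rightarrow> 'v \<Rightarrow> nat" where
  "vertex_degree X v = card {e \<in> X. card e = 2 \<and> v \<in> e}"

definition geometric_carrier :: "'v::finite set set \<Rightarrow> (real ^ 'v) set" where
  "geometric_carrier X = (\<Union>\<sigma>\<in>X. convex hull ((\<lambda>v. axis v 1) ` \<sigma>))"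

text \<open>\<open>S\<close> is triangulated by a finite (geometric) simplicial complex, and \<open>f\<close> is affine on each of
  its simplices. No continuity has to be required, since the simplices are finitely many and
  closed.\<close>

definition pl_map_on :: "'a::euclidean_space set \<Rightarrow> ('a \<Rightarrow> 'b::euclidean_space) \<Rightarrow> bool" where
  "pl_map_on S f \<longleftrightarrow>
     (\<exists>K. simplicial_complex K \<and> \<Union>K = S \<and>
          (\<forall>C\<in>K. \<exists>h c. linear h \<and> (\<forall>x\<in>C. f x = h x + c)))"

definition pl_homeomorphic ::
    "'a::euclidean_space set \<Rightarrow> 'b::euclidean_space set \<Rightarrow> bool" where
  "pl_homeomorphic S T \<longleftrightarrow>
     (\<exists>f g. homeomorphism S T f g \<and> pl_map_on S f \<and> pl_map_on T g)"

text \<open>The model simplex is any simplex of the right dimension in the ambient space \<open>real ^ 'v\<close> of the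
  carrier; any two are affinely isomorphic. The ambient space always has room for it: a
  \<open>d\<close>-ball has at least \<open>d + 1\<close> vertices, a \<open>d\<close>-sphere at least \<open>d + 2\<close>, and \<open>real ^ 'v\<close> contains
  simplices of every dimension up to \<open>CARD('v)\<close>. For a simplex, \<^const>\<open>rel_frontier\<close> is the union of
  the proper faces.\<close>

definition combinatorial_ball :: "nat \<Rightarrow> 'v::finite set set \<Rightarrow> bool" where
  "combinatorial_ball d X \<longleftrightarrow> abstract_complex X \<and>
     (\<exists>T :: (real ^ 'v) set. int d simplex T \<and> pl_homeomorphic (geometric_carrier X) T)"

definition combinatorial_sphere :: "nat \<Rightarrow> 'v::finite set set \<Rightarrow> bool" where
  "combinatorial_sphere d X \<longleftrightarrow> abstract_complex X \<and>
     (\<exists>T :: (real ^ 'v) set. int (d + 1) simplex T \<and>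
        pl_homeomorphic (geometric_carrier X) (rel_frontier T))"

end

theory Submission
  imports Defs
begin

text \<open>Let \<open>B\<close> be a ball. If \<open>D\<close> is another ball with \<open>B \<inter> D = \<partial>B = \<partial>D\<close>, then \<open>B \<union> D\<close> is a sphere: cone the
  boundary homeomorphism over to the complementary faces of a simplex one dimension up. So it
  suffices to find \<open>D\<close> without new vertices.

  In case (a) the vertex \<open>v\<close> of degree \<open>d\<close> lies in a single facet, and pushing this facet into its
  neighbour shows that deleting \<open>v\<close> leaves a ball \<open>B'\<close>. The union of \<open>B'\<close> and the cone over \<open>\<partial>B'\<close> with
  apex \<open>v\<close> is the required sphere.

  In case (b) the interior edges that join boundary vertices are noncrossing chords of a disc, so some
  boundary vertex \<open>v\<close> is on none of them (look at an innermost chord). Then \<open>D\<close> is the fan of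
  triangles from \<open>v\<close> over the boundary edges that avoid \<open>v\<close>.

  That the combinatorial boundary of a ball corresponds to the boundary of the model simplex, and
  that a ridge is in at most two facets, follows from invariance of domain.\<close>

section \<open>Piecewise affine maps\<close>

text \<open>A PL map is defined through a simplicial complex, and composing or inverting such maps
  directly would call for common subdivisions. The proof works with finite families of polytopes
  that may overlap, and returns to simplicial complexes once, by cutting a box along all hyperplanes
  involved. Nothing relates a chart of \<open>B\<close> to a chart of \<open>D\<close> on the common
  boundary. This is why \<open>D\<close> is charted onto a cone: every PL homeomorphism between the
  bases extends radially, which absorbs the mismatch. The condition that \<open>B\<close> and
  \<open>D\<close> share exactly the boundary selects \<open>D\<close>. A cone from a new apex would
  satisfy it but cost a vertex; in case (a) the deleted \<open>v\<close> is free to be the apex, and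
  the star of \<open>v\<close> returns because \<open>\<tau>\<close> is a boundary ridge once its
  facet at \<open>v\<close> is gone. In case (b) a spoke of the fan that is an interior edge of
  \<open>B\<close> would violate it, hence the search for a vertex without chords. The bound
  \<open>n \<ge> d + 2\<close> excludes a single simplex, whose facet has no neighbour; for
  \<open>d = 2\<close> the fan would then be \<open>B\<close> itself.\<close>

definition affine_map_on :: "'a::real_vector set \<Rightarrow> ('a \<Rightarrow> 'b::real_vector) \<Rightarrow> bool" where
  "affine_map_on P f \<longleftrightarrow> (\<exists>h c. linear h \<and> (\<forall>x\<in>P. f x = h x + c))"

definition pw_affine :: "'a::euclidean_space set \<Rightarrow> ('a \<Rightarrow> 'b::euclidean_space) \<Rightarrow> bool" where
  "pw_affine S f \<longleftrightarrow>
     (\<exists>\<P>. finite \<P> \<and> \<Union>\<P> = S \<and> (\<forall>P\<in>\<P>. polytope P \<and> affine_map_on P f))"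

definition pl_bij :: "'a::euclidean_space set \<Rightarrow> 'b::euclidean_space set \<Rightarrow> ('a \<Rightarrow> 'b) \<Rightarrow> bool" where
  "pl_bij S T f \<longleftrightarrow> pw_affine S f \<and> bij_betw f S T"

lemma affine_map_onI: "linear h \<Longrightarrow> (\<And>x. x \<in> P \<Longrightarrow> f x = h x + c) \<Longrightarrow> affine_map_on P f"
  unfolding affine_map_on_def by blast

lemma affine_map_on_subset: "affine_map_on P f \<Longrightarrow> Q \<subseteq> P \<Longrightarrow> affine_map_on Q f"
  unfolding affine_map_on_def by blast

lemma affine_map_on_cong: "affine_map_on P f \<Longrightarrow> (\<And>x. x \<in> P \<Longrightarrow> f x = g x) \<Longrightarrow> affine_map_on P g"
  unfolding affine_map_on_def by metis

lemma affine_map_on_compose: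
  assumes "affine_map_on P f" "affine_map_on Q g" "f ` P \<subseteq> Q"
  shows "affine_map_on P (g \<circ> f)"
proof -
  obtain h c where h: "linear h" "\<And>x. x \<in> P \<Longrightarrow> f x = h x + c"
    using assms(1) unfolding affine_map_on_def by blast
  obtain k e where k: "linear k" "\<And>x. x \<in> Q \<Longrightarrow> g x = k x + e"
    using assms(2) unfolding affine_map_on_def by blast
  have "(g \<circ> f) x = (k \<circ> h) x + (k c + e)" if "x \<in> P" for x
    using that h k assms(3) by (simp add: image_subset_iff linear_add[OF k(1)])
  then show ?thesis
    using linear_compose[OF h(1) k(1)] by (rule affine_map_onI[rotated])
qed

lemma affine_map_on_continuous:
  fixes f :: "'a::euclidean_space \<Rightarrow> 'b::euclidean_space"
  assumes "affine_map_on P f"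
  shows "continuous_on P f"
proof -
  obtain h c where h: "linear h" "\<And>x. x \<in> P \<Longrightarrow> f x = h x + c"
    using assms unfolding affine_map_on_def by blast
  have "continuous_on P (\<lambda>x. h x + c)"
    using h(1) by (intro continuous_intros linear_continuous_on) (simp add: linear_conv_bounded_linear)
  then show ?thesis
    using h(2) continuous_on_cong by fastforce
qed

lemma affine_map_on_image_polytope:
  assumes "affine_map_on P f" "polytope P"
  shows "polytope (f ` P)"
proof -
  obtain h c where h: "linear h" "\<And>x. x \<in> P \<Longrightarrow> f x = h x + c"
    using assms(1) unfolding affine_map_on_def by blast
  have "f ` P = (+) c ` h ` P"
    using h(2) by (force simp: add.commute image_iff)
  then show ?thesis
    using polytope_linear_image[OF h(1) assms(2)] by (simp add: polytope_translation_eq)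
qed

text \<open>The linear part of \<open>f\<close> may have a kernel, but not in the direction space of
  \<open>P\<close>: a short step in a kernel direction from a relative interior point stays in
  \<open>P\<close> and leaves \<open>f\<close> unchanged. So there is a left inverse on that
  space.\<close>

lemma affine_map_on_inverse:
  fixes f :: "'a::euclidean_space \<Rightarrow> 'b::euclidean_space"
  assumes f: "affine_map_on P f" and inj: "inj_on f P" and "convex P"
    and g: "\<And>x. x \<in> P \<Longrightarrow> g (f x) = x"
  shows "affine_map_on (f ` P) g"
proof (cases "P = {}")
  case True
  then show ?thesis
    by (auto simp: affine_map_on_def intro: exI[of _ "\<lambda>x. 0"] linear_zero)
next
  case False
  obtain h c where h: "linear h" "\<And>x. x \<in> P \<Longrightarrow> f x = h x + c"
    using f unfolding affine_map_on_def by blast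
  obtain p where p: "p \<in> rel_interior P"
    using False \<open>convex P\<close> rel_interior_eq_empty by blast
  have pP: "p \<in> P"
    using p rel_interior_subset by blast
  define V where "V = (\<lambda>x. x - p) ` P"
  have injV: "inj_on h (span V)"
  proof -
    have "z = 0" if z: "z \<in> span V" "h z = 0" for z
    proof -
      have aff: "p + t *\<^sub>R z \<in> affine hull P" for t
      proof -
        have "affine hull P = (+) p ` span ((\<lambda>x. - p + x) ` P)"
          using hull_inc[OF pP] by (rule affine_hull_span_gen)
        moreover have "(\<lambda>x. - p + x) ` P = V"
          unfolding V_def by (intro image_cong) auto
        ultimately show ?thesis
          using z(1) by (simp add: span_scale)
      qed
      obtain e where e: "e > 0" "cball p e \<inter> affine hull P \<subseteq> P"
        using p unfolding mem_rel_interior_cball by blast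
      \<comment> \<open>The summand 1 keeps the quotient defined at \<open>z = 0\<close>, and the
        step is no longer than \<open>e\<close>.\<close>
      define t where "t = e / (norm z + 1)"
      have t: "t > 0"
        using e by (simp add: t_def add_nonneg_pos)
      have "norm (t *\<^sub>R z) = e * (norm z / (norm z + 1))"
        using e by (simp add: t_def)
      also have "\<dots> \<le> e * 1"
        using e by (intro mult_left_mono) (auto simp: divide_le_eq add_nonneg_pos)
      finally have "norm (t *\<^sub>R z) \<le> e"
        by simp
      then have q: "p + t *\<^sub>R z \<in> P"
        using e aff[of t] by (auto simp: dist_norm)
      have "f (p + t *\<^sub>R z) = f p"
        using h q pP z by (simp add: linear_add linear_scale)
      then have "t *\<^sub>R z = 0"
        using inj q pP by (auto dest: inj_onD)
      then show ?thesis
        using t by simp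
    qed
    then show ?thesis
      using linear_injective_on_subspace_0[OF h(1) subspace_span] by blast
  qed
  obtain k where k: "linear k" "\<And>x. x \<in> span V \<Longrightarrow> k (h x) = x"
    using linear_exists_left_inverse_on[OF h(1) subspace_span injV] by (auto simp: inj_on_def)
  have "g y = k y + (p - k (f p))" if "y \<in> f ` P" for y
  proof -
    obtain x where x: "x \<in> P" "y = f x"
      using \<open>y \<in> f ` P\<close> by blast
    have "k (h (x - p)) = x - p"
      using x by (intro k span_base) (auto simp: V_def)
    moreover have "h (x - p) = f x - f p"
      using h x pP by (simp add: linear_diff)
    ultimately have "x = k (f x) + (p - k (f p))"
      by (simp add: linear_diff[OF k(1)] algebra_simps)
    then show ?thesis
      using g x by simp
  qed
  then show ?thesis
    using k(1) by (rule affine_map_onI[rotated])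
qed

text \<open>The preimage of a half-space under an affine map is again given by one linear
  inequality, with the adjoint applied to the normal vector.\<close>

lemma affine_map_on_vimage_polytope:
  fixes f :: "'a::euclidean_space \<Rightarrow> 'b::euclidean_space"
  assumes "affine_map_on P f" "polytope P" "polyhedron Q"
  shows "polytope (P \<inter> f -` Q)"
proof -
  obtain h c where h: "linear h" "\<And>x. x \<in> P \<Longrightarrow> f x = h x + c"
    using assms(1) unfolding affine_map_on_def by blast
  obtain F where F: "finite F" "Q = \<Inter>F"
    "\<And>H. H \<in> F \<Longrightarrow> \<exists>a b. a \<noteq> 0 \<and> H = {x. a \<bullet> x \<le> b}"
    using assms(3) unfolding polyhedron_def by blast
  have "polyhedron {x. h x + c \<in> H}" if "H \<in> F" for H
  proof -
    obtain a b where "H = {x. a \<bullet> x \<le> b}"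
      using F(3) \<open>H \<in> F\<close> by blast
    then have "{x. h x + c \<in> H} = {x. adjoint h a \<bullet> x \<le> b - a \<bullet> c}"
      using adjoint_works[OF h(1)] by (auto simp: inner_add_right inner_commute algebra_simps)
    then show ?thesis
      by (simp add: polyhedron_halfspace_le)
  qed
  then have "polyhedron (\<Inter>H\<in>F. {x. h x + c \<in> H})"
    using F(1) by (intro polyhedron_Inter) auto
  then have "polytope (P \<inter> (\<Inter>H\<in>F. {x. h x + c \<in> H}))"
    using assms(2) by (rule polytope_Int_polyhedron[rotated])
  moreover have "P \<inter> (\<Inter>H\<in>F. {x. h x + c \<in> H}) = P \<inter> f -` Q"
    using h(2) F(2) by auto
  ultimately show ?thesis
    by simp
qed

text \<open>A large box is cut along the bounding hyperplanes of all the polytopes, and the cells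
  are triangulated. No simplex is crossed by one of the hyperplanes, so the simplices that lie in
  some polytope cover the union.\<close>

lemma triangulation_of_polytopes:
  fixes \<P> :: "'a::euclidean_space set set"
  assumes fin: "finite \<P>" and poly: "\<And>P. P \<in> \<P> \<Longrightarrow> polytope P"
  obtains K where "simplicial_complex K" "\<Union>K = \<Union>\<P>" "\<And>C. C \<in> K \<Longrightarrow> \<exists>P\<in>\<P>. C \<subseteq> P"
proof -
  have "\<forall>P\<in>\<P>. \<exists>F. finite F \<and> P = \<Inter>F \<and> (\<forall>H\<in>F. \<exists>a b. a \<noteq> 0 \<and> H = {x. a \<bullet> x \<le> b})"
    using poly polytope_imp_polyhedron unfolding polyhedron_def by blast
  then obtain F where F: "\<And>P. P \<in> \<P> \<Longrightarrow> finite (F P)" "\<And>P. P \<in> \<P> \<Longrightarrow> P = \<Inter>(F P)"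
    "\<And>P H. P \<in> \<P> \<Longrightarrow> H \<in> F P \<Longrightarrow> \<exists>a b. H = {x. a \<bullet> x \<le> b}"
    by metis
  define \<H> where "\<H> = (\<Union>P\<in>\<P>. F P)"
  have "\<forall>H\<in>\<H>. \<exists>p. H = {x. fst p \<bullet> x \<le> snd p}"
    using F(3) by (fastforce simp: \<H>_def)
  then obtain ab where ab: "\<And>H. H \<in> \<H> \<Longrightarrow> H = {x. fst (ab H) \<bullet> x \<le> snd (ab H)}"
    by metis
  have "finite (ab ` \<H>)"
    using fin F(1) by (simp add: \<H>_def)
  have "bounded (\<Union>\<P>)"
    using fin poly polytope_imp_bounded by (intro bounded_Union) auto
  then obtain a where a: "\<Union>\<P> \<subseteq> cbox (-a) a"
    using bounded_subset_cbox_symmetric by metis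
  let ?M = "{cbox (-a) a}"
  have "\<exists>\<G>. \<Union>\<G> = \<Union>?M \<and> finite \<G> \<and>
           (\<forall>C \<in> \<G>. \<exists>D. D \<in> ?M \<and> C \<subseteq> D) \<and>
           (\<forall>C \<in> ?M. \<forall>x \<in> C. \<exists>D. D \<in> \<G> \<and> x \<in> D \<and> D \<subseteq> C) \<and>
           (\<forall>X \<in> \<G>. polytope X) \<and>
           (\<forall>X \<in> \<G>. aff_dim X \<le> int DIM('a)) \<and>
           (\<forall>X \<in> \<G>. \<forall>Y \<in> \<G>. X \<inter> Y face_of X) \<and>
           (\<forall>X \<in> \<G>. \<forall>x \<in> X. \<forall>y \<in> X. \<forall>a b.
              (a,b) \<in> ab ` \<H> \<longrightarrow> a \<bullet> x \<le> b \<and> a \<bullet> y \<le> b \<or> a \<bullet> x \<ge> b \<and> a \<bullet> y \<ge> b)"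
    by (rule cell_subdivision_lemma)
       (use \<open>finite (ab ` \<H>)\<close> in \<open>auto simp: polytope_interval aff_dim_le_DIM face_of_refl\<close>)
  then obtain \<G> where G: "\<Union>\<G> = cbox (-a) a" "finite \<G>" "\<forall>X \<in> \<G>. polytope X"
    "\<forall>X \<in> \<G>. \<forall>Y \<in> \<G>. X \<inter> Y face_of X" and
    sides: "\<forall>X \<in> \<G>. \<forall>x \<in> X. \<forall>y \<in> X. \<forall>a b.
              (a,b) \<in> ab ` \<H> \<longrightarrow> a \<bullet> x \<le> b \<and> a \<bullet> y \<le> b \<or> a \<bullet> x \<ge> b \<and> a \<bullet> y \<ge> b"
    by (elim exE conjE) (rule that; simp)
  have G5: "fst (ab H) \<bullet> x \<le> snd (ab H) \<and> fst (ab H) \<bullet> y \<le> snd (ab H) \<or>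
        fst (ab H) \<bullet> x \<ge> snd (ab H) \<and> fst (ab H) \<bullet> y \<ge> snd (ab H)"
    if "X \<in> \<G>" "x \<in> X" "y \<in> X" "H \<in> \<H>" for X x y H
    using sides[rule_format, OF that(1-3), of "fst (ab H)" "snd (ab H)"] that(4) by simp
  obtain T where T: "simplicial_complex T" "\<Union>T = \<Union>\<G>" "\<And>K. K \<in> T \<Longrightarrow> \<exists>C. C \<in> \<G> \<and> K \<subseteq> C"
  proof (rule simplicial_subdivision_of_cell_complex[of \<G>])
    show "finite \<G>" "\<And>C. C \<in> \<G> \<Longrightarrow> polytope C" "\<And>C D. C \<in> \<G> \<Longrightarrow> D \<in> \<G> \<Longrightarrow> C \<inter> D face_of C"
      using G by auto
  qed (use that in blast)
  define K where "K = {C \<in> T. \<exists>P\<in>\<P>. C \<subseteq> P}"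
  have "simplicial_complex K"
    unfolding simplicial_complex_def
  proof (intro conjI allI impI ballI)
    show "finite K"
      using T(1) by (simp add: simplicial_complex_def K_def)
    show "\<exists>n. n simplex S" if "S \<in> K" for S
      using T(1) that by (simp add: simplicial_complex_def K_def)
    show "F \<in> K" if "S \<in> K \<and> F face_of S" for F S
      using T(1) that face_of_imp_subset[of F S] unfolding simplicial_complex_def K_def by blast
    show "S \<inter> S' face_of S" if "S \<in> K \<and> S' \<in> K" for S S'
      using T(1) that by (simp add: simplicial_complex_def K_def)
  qed
  moreover have "\<Union>\<P> \<subseteq> \<Union>K"
  proof
    fix x assume "x \<in> \<Union>\<P>"
    then obtain P where P: "P \<in> \<P>" "x \<in> P" by blast
    then obtain C where C: "C \<in> T" "x \<in> C"
      using a T(2) G(1) by blast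
    \<comment> \<open>A simplex of least dimension containing \<open>x\<close> has \<open>x\<close>
      in its relative interior, since otherwise one of its facets would contain
      \<open>x\<close>.\<close>
    then obtain E where ET: "E \<in> T" and xE: "x \<in> E"
      and min: "\<And>E'. E' \<in> T \<Longrightarrow> x \<in> E' \<Longrightarrow> nat (aff_dim E + 1) \<le> nat (aff_dim E' + 1)"
      using ex_has_least_nat[of "\<lambda>E. E \<in> T \<and> x \<in> E" C "\<lambda>E. nat (aff_dim E + 1)"] by auto
    have polyE: "polytope E"
      using T(1) ET simplex_imp_polytope unfolding simplicial_complex_def by blast
    have E: "x \<in> rel_interior E"
    proof (rule ccontr)
      assume "x \<notin> rel_interior E"
      then have "x \<in> rel_frontier E"
        using xE closure_subset[of E] by (auto simp: rel_frontier_def)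
      then obtain F where F: "F facet_of E" "x \<in> F"
        using rel_frontier_of_polyhedron[OF polytope_imp_polyhedron[OF polyE]] by blast
      then have "F \<in> T"
        using T(1) ET facet_of_imp_face_of unfolding simplicial_complex_def by blast
      moreover have "aff_dim F = aff_dim E - 1" "0 \<le> aff_dim F"
        using F aff_dim_negative_iff[of F] by (auto simp: facet_of_def)
      ultimately show False
        using min[of F] F(2) by simp
    qed
    have "y \<in> H" if "y \<in> E" "H \<in> F P" for y H
    proof -
      have H: "H \<in> \<H>"
        using that P by (auto simp: \<H>_def)
      define a b where "a = fst (ab H)" and "b = snd (ab H)"
      have Hab: "H = {x. a \<bullet> x \<le> b}"
        using ab[OF H] by (simp add: a_def b_def)
      have side: "a \<bullet> u \<le> b \<and> a \<bullet> w \<le> b \<or> a \<bullet> u \<ge> b \<and> a \<bullet> w \<ge> b" if "u \<in> E" "w \<in> E" for u w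
      proof -
        obtain X where "X \<in> \<G>" "E \<subseteq> X"
          using T(3)[OF ET] by blast
        then show ?thesis
          using G5[of X u w H] that H by (auto simp: a_def b_def)
      qed
      have "x \<in> H"
        using P F(2) that(2) by blast
      then have xb: "a \<bullet> x \<le> b"
        using Hab by simp
      show ?thesis
      proof (rule ccontr)
        assume "y \<notin> H"
        then have yb: "a \<bullet> y > b"
          using Hab by simp
        have xeq: "a \<bullet> x = b"
          using side[OF xE \<open>y \<in> E\<close>] xb yb by linarith
        have "convex E"
          using polyE polytope_imp_convex by blast
        \<comment> \<open>Here \<open>x\<close> is on the hyperplane and \<open>y\<close> strictly
          beyond it. Prolonging the segment from \<open>y\<close> past \<open>x\<close> inside
          \<open>E\<close> reaches the other side, so the hyperplane would cross
          \<open>E\<close>.\<close>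
        then obtain e where e: "e > 1" "(1 - e) *\<^sub>R y + e *\<^sub>R x \<in> E"
          using convex_rel_interior_iff[of E x] E \<open>y \<in> E\<close> by blast
        have "a \<bullet> ((1 - e) *\<^sub>R y + e *\<^sub>R x) = (1 - e) * (a \<bullet> y) + e * b"
          by (simp only: inner_add_right inner_scaleR_right xeq)
        moreover have "(e - 1) * (a \<bullet> y - b) > 0"
          using e yb by simp
        moreover have "(1 - e) * (a \<bullet> y) + e * b = b - (e - 1) * (a \<bullet> y - b)"
          by (simp add: algebra_simps)
        ultimately have "a \<bullet> ((1 - e) *\<^sub>R y + e *\<^sub>R x) < b"
          by linarith
        then show False
          using side[OF e(2) \<open>y \<in> E\<close>] yb by linarith
      qed
    qed
    then have "E \<subseteq> P"
      using F(2)[OF P(1)] by blast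
    then show "x \<in> \<Union>K"
      using ET P xE unfolding K_def by blast
  qed
  ultimately show ?thesis
  proof (intro that[of K])
    show "\<Union>K = \<Union>\<P>"
      using \<open>\<Union>\<P> \<subseteq> \<Union>K\<close> unfolding K_def by blast
    show "\<exists>P\<in>\<P>. C \<subseteq> P" if "C \<in> K" for C
      using that unfolding K_def by blast
  qed
qed

text \<open>From right to left, the overlapping polytopes are replaced by a simplicial complex each
  of whose simplices lies in one of them.\<close>

lemma pl_map_on_iff_pw_affine: "pl_map_on S f \<longleftrightarrow> pw_affine S f"
proof
  assume "pl_map_on S f"
  then show "pw_affine S f"
    unfolding pl_map_on_def pw_affine_def affine_map_on_def simplicial_complex_def
    by (metis simplex_imp_polytope)
next
  assume "pw_affine S f"
  then obtain \<P> where P: "finite \<P>" "\<Union>\<P> = S" "\<And>P. P \<in> \<P> \<Longrightarrow> polytope P"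
    "\<And>P. P \<in> \<P> \<Longrightarrow> affine_map_on P f"
    unfolding pw_affine_def by blast
  obtain K where K: "simplicial_complex K" "\<Union>K = \<Union>\<P>" "\<And>C. C \<in> K \<Longrightarrow> \<exists>P\<in>\<P>. C \<subseteq> P"
    using triangulation_of_polytopes[OF P(1,3)] by metis
  have "affine_map_on C f" if "C \<in> K" for C
    using K(3)[OF that] P(4) affine_map_on_subset by blast
  then show "pl_map_on S f"
    using K P(2) unfolding pl_map_on_def affine_map_on_def by metis
qed


section \<open>Composition, restriction and inversion of piecewise affine maps\<close>

lemma pw_affineI:
  "finite \<P> \<Longrightarrow> \<Union>\<P> = S \<Longrightarrow> (\<And>P. P \<in> \<P> \<Longrightarrow> polytope P) \<Longrightarrow>
    (\<And>P. P \<in> \<P> \<Longrightarrow> affine_map_on P f) \<Longrightarrow> pw_affine S f"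
  unfolding pw_affine_def by blast

lemma pw_affineE:
  assumes "pw_affine S f"
  obtains \<P> where "finite \<P>" "\<Union>\<P> = S" "\<And>P. P \<in> \<P> \<Longrightarrow> polytope P"
    "\<And>P. P \<in> \<P> \<Longrightarrow> affine_map_on P f"
  using assms unfolding pw_affine_def by blast

lemma affine_map_on_id: "affine_map_on P (\<lambda>x. x)"
  by (rule affine_map_onI[of "\<lambda>x. x" _ _ 0]) (auto simp: linear_iff)

lemma pw_affine_continuous: "pw_affine S f \<Longrightarrow> continuous_on S f"
  unfolding pw_affine_def
  using continuous_on_closed_Union[of _ "\<lambda>P. P" f] affine_map_on_continuous polytope_imp_closed
  by fastforce

lemma pw_affine_cong: "pw_affine S f \<Longrightarrow> (\<And>x. x \<in> S \<Longrightarrow> f x = g x) \<Longrightarrow> pw_affine S g"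
  unfolding pw_affine_def by (metis UnionI affine_map_on_cong)

lemma pw_affine_Un:
  assumes "pw_affine S f" "pw_affine T f"
  shows "pw_affine (S \<union> T) f"
proof -
  obtain \<P> \<Q> where "finite \<P>" "\<Union>\<P> = S" "\<forall>P\<in>\<P>. polytope P \<and> affine_map_on P f"
     "finite \<Q>" "\<Union>\<Q> = T" "\<forall>P\<in>\<Q>. polytope P \<and> affine_map_on P f"
    using assms unfolding pw_affine_def by blast
  then show ?thesis
    unfolding pw_affine_def by (intro exI[of _ "\<P> \<union> \<Q>"]) auto
qed

text \<open>The pieces of the composite are the parts of the pieces of \<open>S\<close> that
  \<open>f\<close> sends into a single piece of \<open>T\<close>.\<close>

lemma pw_affine_compose:
  assumes "pw_affine S f" "pw_affine T g" "f ` S \<subseteq> T"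
  shows "pw_affine S (g \<circ> f)"
proof -
  obtain \<P> where P: "finite \<P>" "\<Union>\<P> = S" "\<And>P. P \<in> \<P> \<Longrightarrow> polytope P"
    "\<And>P. P \<in> \<P> \<Longrightarrow> affine_map_on P f"
    using pw_affineE[OF assms(1)] by metis
  obtain \<Q> where Q: "finite \<Q>" "\<Union>\<Q> = T" "\<And>P. P \<in> \<Q> \<Longrightarrow> polytope P"
    "\<And>P. P \<in> \<Q> \<Longrightarrow> affine_map_on P g"
    using pw_affineE[OF assms(2)] by metis
  let ?R = "(\<lambda>(P, Q). P \<inter> f -` Q) ` (\<P> \<times> \<Q>)"
  show ?thesis
  proof (rule pw_affineI[of ?R])
    show "finite ?R" using P(1) Q(1) by simp
    show "\<Union>?R = S"
    proof (intro equalityI subsetI)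
      fix x assume "x \<in> S"
      then obtain P where "P \<in> \<P>" "x \<in> P" using P(2) by blast
      moreover obtain Q where "Q \<in> \<Q>" "f x \<in> Q"
        using \<open>x \<in> S\<close> assms(3) Q(2) by blast
      ultimately show "x \<in> \<Union>?R" by blast
    qed (use P(2) in auto)
    fix R assume "R \<in> ?R"
    then obtain P Q where R: "P \<in> \<P>" "Q \<in> \<Q>" "R = P \<inter> f -` Q" by auto
    show "polytope R"
      unfolding R(3)
      using affine_map_on_vimage_polytope[OF P(4,3)] Q(3) R polytope_imp_polyhedron by metis
    show "affine_map_on R (g \<circ> f)"
      using R P(4) Q(4) by (intro affine_map_on_compose[of R f Q g]) (auto intro: affine_map_on_subset)
  qed
qed

text \<open>The identity is piecewise affine on a set exactly if the set is a finite union of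
  polytopes; this is how polyhedral sets are expressed throughout.\<close>

lemma pw_affine_subset:
  assumes "pw_affine S f" "pw_affine T (\<lambda>x. x)" "T \<subseteq> S"
  shows "pw_affine T f"
  using pw_affine_compose[OF assms(2,1)] assms(3) by (simp add: o_def)

lemma pw_affine_Union_polytopes:
  "finite \<P> \<Longrightarrow> (\<And>P. P \<in> \<P> \<Longrightarrow> polytope P) \<Longrightarrow> pw_affine (\<Union>\<P>) (\<lambda>x. x)"
  by (rule pw_affineI) (auto simp: affine_map_on_id)

lemma pl_bij_inverse:
  assumes "pl_bij S T f"
  shows "pl_bij T S (inv_into S f)"
proof -
  have bij: "bij_betw f S T" and "pw_affine S f"
    using assms by (auto simp: pl_bij_def)
  then obtain \<P> where P: "finite \<P>" "\<Union>\<P> = S" "\<And>P. P \<in> \<P> \<Longrightarrow> polytope P"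
    "\<And>P. P \<in> \<P> \<Longrightarrow> affine_map_on P f"
    using pw_affineE by metis
  have inj: "inj_on f S" and img: "f ` S = T"
    using bij by (auto simp: bij_betw_def)
  have "pw_affine T (inv_into S f)"
  proof (rule pw_affineI[of "(`) f ` \<P>"])
    show "\<Union>((`) f ` \<P>) = T"
      using P(2) img by auto
    fix Q assume "Q \<in> (`) f ` \<P>"
    then obtain P where Q: "P \<in> \<P>" "Q = f ` P" by blast
    then have "P \<subseteq> S" using P(2) by blast
    show "polytope Q"
      using Q P affine_map_on_image_polytope by blast
    show "affine_map_on Q (inv_into S f)"
      unfolding Q(2)
    proof (rule affine_map_on_inverse)
      show "inj_on f P" using inj \<open>P \<subseteq> S\<close> inj_on_subset by blast
      show "inv_into S f (f x) = x" if "x \<in> P" for x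
        using inj \<open>P \<subseteq> S\<close> that by (auto intro: inv_into_f_f)
    qed (use P Q polytope_imp_convex in auto)
  qed (use P in auto)
  then show ?thesis
    using bij_betw_inv_into[OF bij] by (simp add: pl_bij_def)
qed

lemma pl_bij_compose: "pl_bij S T f \<Longrightarrow> pl_bij T U g \<Longrightarrow> pl_bij S U (g \<circ> f)"
  unfolding pl_bij_def by (metis bij_betw_imp_surj_on bij_betw_trans order_refl pw_affine_compose)

lemma pl_bij_restrict:
  assumes "pl_bij S T f" "pw_affine E (\<lambda>x. x)" "E \<subseteq> S"
  shows "pl_bij E (f ` E) f"
  using assms unfolding pl_bij_def
  by (auto intro: pw_affine_subset inj_on_imp_bij_betw inj_on_subset simp: bij_betw_def)

lemma pl_bij_continuous: "pl_bij S T f \<Longrightarrow> continuous_on S f"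
  by (simp add: pl_bij_def pw_affine_continuous)

lemma pl_homeomorphic_iff_pl_bij: "pl_homeomorphic S T \<longleftrightarrow> (\<exists>f. pl_bij S T f)"
proof
  assume "pl_homeomorphic S T"
  then show "\<exists>f. pl_bij S T f"
    unfolding pl_homeomorphic_def pl_map_on_iff_pw_affine pl_bij_def homeomorphism_def
    by (metis bij_betw_def inj_on_inverseI)
next
  assume "\<exists>f. pl_bij S T f"
  then obtain f where f: "pl_bij S T f" by blast
  then have b: "bij_betw f S T" by (simp add: pl_bij_def)
  let ?g = "inv_into S f"
  have g: "pl_bij T S ?g" by (rule pl_bij_inverse[OF f])
  have "homeomorphism S T f ?g"
    unfolding homeomorphism_def
    using pl_bij_continuous[OF f] pl_bij_continuous[OF g] b bij_betw_inv_into[OF b]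
    by (auto simp: bij_betw_inv_into_left bij_betw_inv_into_right bij_betw_def)
  then show "pl_homeomorphic S T"
    using f g unfolding pl_homeomorphic_def pl_map_on_iff_pw_affine pl_bij_def by blast
qed

section \<open>Cones and the radial extension of piecewise affine maps\<close>

definition cone_over :: "'a::real_vector \<Rightarrow> 'a set \<Rightarrow> 'a set" where
  "cone_over c E = {(1 - t) *\<^sub>R c + t *\<^sub>R y | t y. 0 \<le> t \<and> t \<le> 1 \<and> y \<in> E}"

text \<open>A ray from \<open>c\<close> that meets \<open>E\<close> does so only once. Away from the
  apex, the coordinates \<open>t\<close> and \<open>y\<close> of a point of the cone are therefore
  unique.\<close>

definition visible_from :: "'a::real_vector \<Rightarrow> 'a set \<Rightarrow> bool" where
  "visible_from c E \<longleftrightarrow> c \<notin> E \<and> (\<forall>y\<in>E. \<forall>r>0. c + r *\<^sub>R (y - c) \<in> E \<longrightarrow> r = 1)"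

lemma cone_overI: "0 \<le> t \<Longrightarrow> t \<le> 1 \<Longrightarrow> y \<in> E \<Longrightarrow> (1 - t) *\<^sub>R c + t *\<^sub>R y \<in> cone_over c E"
  unfolding cone_over_def by blast

lemma cone_overE:
  assumes "x \<in> cone_over c E"
  obtains t y where "0 \<le> t" "t \<le> 1" "y \<in> E" "x = (1 - t) *\<^sub>R c + t *\<^sub>R y"
  using assms unfolding cone_over_def by blast

lemma cone_over_Union: "cone_over c (\<Union>\<P>) = \<Union>(cone_over c ` \<P>)"
  unfolding cone_over_def by blast

lemma cone_over_empty [simp]: "cone_over c {} = {}"
  unfolding cone_over_def by blast

lemma convex_hull_insert_eq_cone_over:
  assumes "convex P" "P \<noteq> {}"
  shows "convex hull (insert c P) = cone_over c P"
  using assms hull_same[of convex P] unfolding convex_hull_insert_alt cone_over_def by auto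

lemma polytope_cone_over:
  assumes "polytope P"
  shows "polytope (cone_over c P)"
proof (cases "P = {}")
  case False
  obtain V where V: "finite V" "P = convex hull V"
    using assms unfolding polytope_def by blast
  have "cone_over c P = convex hull (insert c (convex hull V))"
    using convex_hull_insert_eq_cone_over[of P c] False V by simp
  also have "\<dots> = convex hull (insert c V)"
    by (metis hull_insert)
  finally show ?thesis
    using V(1) unfolding polytope_def by blast
qed (auto simp: polytope_empty)

lemma visible_from_subset: "visible_from c E \<Longrightarrow> F \<subseteq> E \<Longrightarrow> visible_from c F"
  unfolding visible_from_def by blast

lemma cone_coordinates_unique:
  assumes "visible_from c E" "y \<in> E" "y' \<in> E" "0 \<le> s" "0 \<le> t"
    and eq: "(1 - s) *\<^sub>R c + s *\<^sub>R y = (1 - t) *\<^sub>R c + t *\<^sub>R y'"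
  shows "s = t \<and> (s = 0 \<or> y = y')"
proof -
  have eq': "s *\<^sub>R (y - c) = t *\<^sub>R (y' - c)"
    using eq by (simp add: algebra_simps)
  have ne: "y \<noteq> c" "y' \<noteq> c"
    using assms unfolding visible_from_def by auto
  show ?thesis
  proof (cases "s = 0 \<or> t = 0")
    case True
    then show ?thesis using eq' ne by auto
  next
    case False
    then have st: "s > 0" "t > 0" using assms by auto
    have "y' - c = (s / t) *\<^sub>R (y - c)"
      using arg_cong[OF eq', of "\<lambda>z. (1/t) *\<^sub>R z"] st by simp
    then have y': "y' = c + (s / t) *\<^sub>R (y - c)"
      by (metis add.commute diff_add_cancel)
    then have "s / t = 1"
      using assms st unfolding visible_from_def by (metis divide_pos_pos)
    then show ?thesis
      using y' st by auto
  qed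
qed

text \<open>If \<open>c\<close> were in the affine hull, so would be the line from \<open>c\<close>
  through a relative interior point \<open>p\<close> of \<open>P\<close>, and a short step beyond
  \<open>p\<close> would hit \<open>P\<close> a second time.\<close>

lemma visible_from_imp_notin_affine_hull:
  fixes P :: "'a::euclidean_space set"
  assumes "visible_from c P" "convex P"
  shows "c \<notin> affine hull P"
proof
  assume c: "c \<in> affine hull P"
  then have "P \<noteq> {}" by auto
  then obtain p where p: "p \<in> rel_interior P"
    using \<open>convex P\<close> rel_interior_eq_empty by blast
  then have pP: "p \<in> P" using rel_interior_subset by blast
  obtain e where e: "e > 0" "cball p e \<inter> affine hull P \<subseteq> P"
    using p unfolding mem_rel_interior_cball by blast
  define r where "r = e / (norm (p - c) + 1)"
  have r: "r > 0"
    using e by (simp add: r_def add_nonneg_pos)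
  have "norm (r *\<^sub>R (p - c)) = e * (norm (p - c) / (norm (p - c) + 1))"
    using e by (simp add: r_def)
  also have "\<dots> \<le> e * 1"
    using e by (intro mult_left_mono) (auto simp: divide_le_eq add_nonneg_pos)
  finally have r2: "norm (r *\<^sub>R (p - c)) \<le> e"
    by simp
  have eq: "c + (1 + r) *\<^sub>R (p - c) = (1 - (1 + r)) *\<^sub>R c + (1 + r) *\<^sub>R p"
    by (simp add: algebra_simps)
  have "c + (1 + r) *\<^sub>R (p - c) \<in> affine hull P"
    unfolding eq using c hull_inc[OF pP, of affine]
    by (intro mem_affine) auto
  moreover have "c + (1 + r) *\<^sub>R (p - c) = p + r *\<^sub>R (p - c)"
    by (simp add: algebra_simps)
  ultimately have "c + (1 + r) *\<^sub>R (p - c) \<in> P"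
    using e r2 by (auto simp: dist_norm)
  then have "1 + r = 1"
    using assms(1) pP r(1) unfolding visible_from_def by (metis add_pos_pos zero_less_one)
  then show False using r by simp
qed

text \<open>The functional is given by the component of \<open>c - p\<close> orthogonal to the
  direction space of \<open>P\<close>, scaled to take the value 1 at \<open>c\<close>.\<close>

lemma affine_functional_separating_point:
  fixes P :: "'a::euclidean_space set"
  assumes "c \<notin> affine hull P"
  obtains w b where "w \<bullet> c + b = 1" "\<And>x. x \<in> P \<Longrightarrow> w \<bullet> x + b = 0"
proof (cases "P = {}")
  case True
  then show ?thesis using that[of 0 1] by simp
next
  case False
  then obtain p where p: "p \<in> P" by blast
  let ?V = "(\<lambda>x. - p + x) ` P"
  obtain u w where uw: "u \<in> span ?V" "\<And>z. z \<in> span ?V \<Longrightarrow> orthogonal w z" "c - p = u + w"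
    using orthogonal_subspace_decomp_exists[of ?V "c - p"] by blast
  have "w \<noteq> 0"
  proof
    assume "w = 0"
    then have "c = p + u" using uw(3) by (simp add: algebra_simps)
    then show False
      using assms uw(1) affine_hull_span_gen[OF hull_inc[OF p]] by auto
  qed
  then have ww: "w \<bullet> w > 0" by simp
  have "w \<bullet> (c - p) = w \<bullet> w"
    using uw(2)[OF uw(1)] uw(3) by (simp add: inner_add_right orthogonal_def)
  moreover have "w \<bullet> (x - p) = 0" if "x \<in> P" for x
    using uw(2)[of "- p + x"] that by (auto simp: orthogonal_def intro: span_base)
  ultimately show ?thesis
    using ww that[of "(1 / (w \<bullet> w)) *\<^sub>R w" "- (w \<bullet> p) / (w \<bullet> w)"]
    by (auto simp: inner_diff_right field_simps)
qed

text \<open>This is the radial extension used in the Alexander trick: segments from \<open>c\<close>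
  to \<open>y\<close> go affinely to segments from \<open>c'\<close> to \<open>\<phi> y\<close>. It
  is affine on the cone over a piece because \<open>c\<close> is off the affine hull of the
  piece.\<close>

lemma pl_bij_cone:
  fixes E :: "'a::euclidean_space set" and E' :: "'b::euclidean_space set"
  assumes phi: "pl_bij E E' \<phi>" and vis: "visible_from c E" "visible_from c' E'"
  obtains \<psi> where "pl_bij (cone_over c E) (cone_over c' E') \<psi>" "\<And>y. y \<in> E \<Longrightarrow> \<psi> y = \<phi> y"
proof -
  define \<psi> where "\<psi> x = (SOME z. \<exists>t y. 0 \<le> t \<and> t \<le> 1 \<and> y \<in> E \<and>
      x = (1 - t) *\<^sub>R c + t *\<^sub>R y \<and> z = (1 - t) *\<^sub>R c' + t *\<^sub>R \<phi> y)" for x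
  have bij: "bij_betw \<phi> E E'" and "pw_affine E \<phi>"
    using phi by (auto simp: pl_bij_def)
  then obtain \<P> where P: "finite \<P>" "\<Union>\<P> = E" "\<And>P. P \<in> \<P> \<Longrightarrow> polytope P"
    "\<And>P. P \<in> \<P> \<Longrightarrow> affine_map_on P \<phi>"
    using pw_affineE by metis
  \<comment> \<open>The chosen value depends on the point alone: cone coordinates are unique except
    at the apex, where every \<open>y\<close> yields \<open>c'\<close>.\<close>
  have psi: "\<psi> ((1 - t) *\<^sub>R c + t *\<^sub>R y) = (1 - t) *\<^sub>R c' + t *\<^sub>R \<phi> y"
    if "0 \<le> t" "t \<le> 1" "y \<in> E" for t y
    unfolding \<psi>_def
  proof (rule some_equality)
    fix z assume "\<exists>s x. 0 \<le> s \<and> s \<le> 1 \<and> x \<in> E \<and>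
      (1 - t) *\<^sub>R c + t *\<^sub>R y = (1 - s) *\<^sub>R c + s *\<^sub>R x \<and> z = (1 - s) *\<^sub>R c' + s *\<^sub>R \<phi> x"
    then obtain s x where sx: "0 \<le> s" "s \<le> 1" "x \<in> E"
      "(1 - t) *\<^sub>R c + t *\<^sub>R y = (1 - s) *\<^sub>R c + s *\<^sub>R x" "z = (1 - s) *\<^sub>R c' + s *\<^sub>R \<phi> x"
      by blast
    then have "t = s \<and> (t = 0 \<or> y = x)"
      using cone_coordinates_unique[OF vis(1)] that by blast
    then show "z = (1 - t) *\<^sub>R c' + t *\<^sub>R \<phi> y"
      using sx(5) by auto
  qed (use that in blast)
  have "bij_betw \<psi> (cone_over c E) (cone_over c' E')"
    unfolding bij_betw_def
  proof
    show "inj_on \<psi> (cone_over c E)"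
    proof (rule inj_onI)
      fix x x' assume "x \<in> cone_over c E" "x' \<in> cone_over c E" and eq: "\<psi> x = \<psi> x'"
      then obtain t y t' y' where *: "0 \<le> t" "t \<le> 1" "y \<in> E" "x = (1 - t) *\<^sub>R c + t *\<^sub>R y"
        "0 \<le> t'" "t' \<le> 1" "y' \<in> E" "x' = (1 - t') *\<^sub>R c + t' *\<^sub>R y'"
        by (metis cone_overE)
      then have "(1 - t) *\<^sub>R c' + t *\<^sub>R \<phi> y = (1 - t') *\<^sub>R c' + t' *\<^sub>R \<phi> y'"
        using eq psi by simp
      then have "t = t' \<and> (t = 0 \<or> \<phi> y = \<phi> y')"
        using cone_coordinates_unique[OF vis(2)] * bij by (meson bij_betwE)
      then show "x = x'"
        using * bij by (auto simp: bij_betw_def dest: inj_onD)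
    qed
    show "\<psi> ` cone_over c E = cone_over c' E'"
    proof (intro equalityI subsetI)
      fix z assume "z \<in> \<psi> ` cone_over c E"
      then obtain t y where "0 \<le> t" "t \<le> 1" "y \<in> E" "z = \<psi> ((1 - t) *\<^sub>R c + t *\<^sub>R y)"
        by (auto elim: cone_overE)
      then show "z \<in> cone_over c' E'"
        using psi bij by (auto intro!: cone_overI dest: bij_betwE)
    next
      fix z assume "z \<in> cone_over c' E'"
      then obtain t y where *: "0 \<le> t" "t \<le> 1" "y \<in> E'" "z = (1 - t) *\<^sub>R c' + t *\<^sub>R y"
        by (rule cone_overE)
      then obtain x where "x \<in> E" "y = \<phi> x"
        using bij by (auto simp: bij_betw_def)
      then show "z \<in> \<psi> ` cone_over c E"
        using psi[of t x] * by (auto intro!: image_eqI[of _ _ "(1 - t) *\<^sub>R c + t *\<^sub>R x"] cone_overI)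
    qed
  qed
  moreover have "pw_affine (cone_over c E) \<psi>"
  proof (rule pw_affineI[of "cone_over c ` \<P>"])
    show "\<Union>(cone_over c ` \<P>) = cone_over c E"
      using cone_over_Union[of c \<P>] P(2) by simp
    fix Q assume "Q \<in> cone_over c ` \<P>"
    then obtain P where Q: "P \<in> \<P>" "Q = cone_over c P" by blast
    show "polytope Q"
      using Q P(3) polytope_cone_over by blast
    have PE: "P \<subseteq> E" using Q P(2) by blast
    have "c \<notin> affine hull P"
      using visible_from_imp_notin_affine_hull visible_from_subset[OF vis(1) PE] P(3) Q(1) polytope_imp_convex
      by blast
    then obtain w b where w: "w \<bullet> c + b = 1" "\<And>x. x \<in> P \<Longrightarrow> w \<bullet> x + b = 0"
      using affine_functional_separating_point by metis
    obtain h k where h: "linear h" "\<And>x. x \<in> P \<Longrightarrow> \<phi> x = h x + k"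
      using P(4)[OF Q(1)] unfolding affine_map_on_def by blast
    \<comment> \<open>The affine map that agrees with \<open>\<phi>\<close> on \<open>P\<close>
      sends \<open>c\<close> to \<open>h c + k\<close>; \<open>v\<close> is the error at the apex.
      It is added with weight \<open>1 - t\<close>, which is what \<open>w\<close> and
      \<open>b\<close> measure.\<close>
    define v where "v = c' - h c - k"
    show "affine_map_on Q \<psi>"
    proof (rule affine_map_onI[of "\<lambda>x. h x + (w \<bullet> x) *\<^sub>R v" Q \<psi> "b *\<^sub>R v + k"])
      show "linear (\<lambda>x. h x + (w \<bullet> x) *\<^sub>R v)"
        by (intro linear_compose_add h(1)) (auto simp: linear_iff inner_add_right algebra_simps)
      fix x assume "x \<in> Q"
      then obtain t y where *: "0 \<le> t" "t \<le> 1" "y \<in> P" "x = (1 - t) *\<^sub>R c + t *\<^sub>R y"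
        using Q by (auto elim: cone_overE)
      have "w \<bullet> x + b = (1 - t) * (w \<bullet> c + b) + t * (w \<bullet> y + b)"
        unfolding * by (simp add: inner_add_right algebra_simps)
      then have wx: "w \<bullet> x + b = 1 - t"
        using w *(3) by simp
      have hx: "h x = (1 - t) *\<^sub>R h c + t *\<^sub>R h y"
        unfolding * using h(1) by (simp add: linear_add linear_scale)
      have "\<psi> x = (1 - t) *\<^sub>R c' + t *\<^sub>R (h y + k)"
        using * psi PE h(2) by auto
      also have "\<dots> = h x + (1 - t) *\<^sub>R v + k"
        unfolding hx v_def by (simp add: algebra_simps)
      also have "\<dots> = h x + (w \<bullet> x) *\<^sub>R v + (b *\<^sub>R v + k)"
        unfolding wx[symmetric] by (simp add: algebra_simps)
      finally show "\<psi> x = h x + (w \<bullet> x) *\<^sub>R v + (b *\<^sub>R v + k)" .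
    qed
  qed (use P(1) in simp)
  ultimately show ?thesis
    using that[of \<psi>] psi[of 1] by (simp add: pl_bij_def)
qed

section \<open>Carriers, and spheres as unions of a ball and a cone\<close>

text \<open>The relatively open faces of a carrier are the level sets of this map:
  \<open>support x\<close> is the unique face that has \<open>x\<close> in its relative
  interior.\<close>

definition support :: "real ^ 'v \<Rightarrow> 'v set" where
  "support x = {v. x $ v \<noteq> 0}"

abbreviation face_simplex :: "'v::finite set \<Rightarrow> (real ^ 'v) set" where
  "face_simplex \<sigma> \<equiv> convex hull ((\<lambda>v. axis v 1) ` \<sigma>)"

lemma sum_support_subset:
  fixes x :: "real ^ 'v::finite"
  assumes "support x \<subseteq> \<sigma>"
  shows "(\<Sum>v\<in>\<sigma>. x $ v) = (\<Sum>v\<in>UNIV. x $ v)"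
  using assms by (intro sum.mono_neutral_left) (auto simp: support_def)

lemma sum_axis_nth:
  fixes u :: "'v::finite \<Rightarrow> real"
  shows "(\<Sum>v\<in>\<sigma>. u v *\<^sub>R axis v 1) $ w = (if w \<in> \<sigma> then u w else 0)"
proof -
  have "(\<Sum>v\<in>\<sigma>. u v *\<^sub>R axis v 1) $ w = (\<Sum>v\<in>\<sigma>. if v = w then u w else 0)"
    unfolding sum_component by (intro sum.cong) (auto simp: axis_def)
  then show ?thesis
    by simp
qed

lemma sum_axis_eq_self:
  fixes x :: "real ^ 'v::finite"
  assumes "support x \<subseteq> \<sigma>"
  shows "(\<Sum>v\<in>\<sigma>. (x $ v) *\<^sub>R axis v 1) = x"
proof (rule vec_eq_iff[THEN iffD2], rule allI)
  fix w
  show "(\<Sum>v\<in>\<sigma>. (x $ v) *\<^sub>R axis v 1) $ w = x $ w"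
    using assms unfolding sum_axis_nth by (auto simp: support_def)
qed

lemma inj_axis: "inj_on (\<lambda>v. axis v (1::real)) \<sigma>"
  by (auto simp: inj_on_def axis_eq_axis)

lemma sum_axis_image:
  fixes g :: "(real ^ 'v::finite) \<Rightarrow> 'c::comm_monoid_add"
  shows "sum g ((\<lambda>v. axis v 1) ` \<sigma>) = (\<Sum>v\<in>\<sigma>. g (axis v 1))"
  by (simp add: sum.reindex[OF inj_axis] o_def)

lemma affine_independent_axes: "\<not> affine_dependent ((\<lambda>v::'v::finite. axis v (1::real)) ` \<sigma>)"
proof -
  have "independent ((\<lambda>v::'v. axis v (1::real)) ` \<sigma>)"
    by (rule independent_mono[OF independent_Basis]) (auto simp: axis_in_Basis_iff)
  then show ?thesis
    using affine_dependent_imp_dependent by blast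
qed

text \<open>Coordinates of \<open>x\<close> are its barycentric coordinates with respect to the unit
  vectors. Taking \<open>R\<close> to be nonnegativity, no condition, or positivity yields the
  convex hull, the affine hull and the relative interior of a face.\<close>

lemma barycentric_combination_iff:
  fixes x :: "real ^ 'v::finite"
  shows "(\<exists>u. (\<forall>v\<in>\<sigma>. R (u (axis v (1::real)))) \<and> (\<Sum>v\<in>\<sigma>. u (axis v (1::real))) = 1 \<and>
      (\<Sum>v\<in>\<sigma>. u (axis v (1::real)) *\<^sub>R axis v 1) = x) \<longleftrightarrow>
    (\<forall>v\<in>\<sigma>. R (x $ v)) \<and> (\<Sum>v\<in>UNIV. x $ v) = 1 \<and> support x \<subseteq> \<sigma>" (is "?L \<longleftrightarrow> ?R")
proof
  assume ?L
  then obtain u where u: "\<And>v. v \<in> \<sigma> \<Longrightarrow> R (u (axis v (1::real)))" "(\<Sum>v\<in>\<sigma>. u (axis v (1::real))) = 1"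
    "(\<Sum>v\<in>\<sigma>. u (axis v (1::real)) *\<^sub>R axis v 1) = x"
    by blast
  have x: "x $ w = (if w \<in> \<sigma> then u (axis w (1::real)) else 0)" for w
    using sum_axis_nth[of "\<lambda>v. u (axis v (1::real))" \<sigma> w] u(3) by simp
  then have s: "support x \<subseteq> \<sigma>"
    by (auto simp: support_def)
  then show ?R
    using sum_support_subset[OF s] u x by auto
next
  assume ?R
  then show ?L
    using sum_axis_eq_self[of x \<sigma>] sum_support_subset[of x \<sigma>]
    by (intro exI[of _ "\<lambda>y. x \<bullet> y"]) (auto simp: inner_axis)
qed

lemma mem_face_simplex:
  fixes x :: "real ^ 'v::finite"
  shows "x \<in> face_simplex \<sigma> \<longleftrightarrow> (\<forall>v. 0 \<le> x $ v) \<and> (\<Sum>v\<in>UNIV. x $ v) = 1 \<and> support x \<subseteq> \<sigma>"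
proof -
  have "x \<in> face_simplex \<sigma> \<longleftrightarrow> (\<forall>v\<in>\<sigma>. 0 \<le> x $ v) \<and> (\<Sum>v\<in>UNIV. x $ v) = 1 \<and> support x \<subseteq> \<sigma>"
    using barycentric_combination_iff[of \<sigma> "\<lambda>r. 0 \<le> r" x] by (simp add: convex_hull_finite sum_axis_image)
  moreover have "(\<forall>v\<in>\<sigma>. 0 \<le> x $ v) \<and> support x \<subseteq> \<sigma> \<longleftrightarrow> (\<forall>v. 0 \<le> x $ v) \<and> support x \<subseteq> \<sigma>"
    unfolding support_def subset_iff mem_Collect_eq by (metis order_refl)
  ultimately show ?thesis by blast
qed

lemma mem_affine_hull_face_simplex:
  fixes x :: "real ^ 'v::finite"
  shows "x \<in> affine hull (face_simplex \<sigma>) \<longleftrightarrow> (\<Sum>v\<in>UNIV. x $ v) = 1 \<and> support x \<subseteq> \<sigma>"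
  using barycentric_combination_iff[of \<sigma> "\<lambda>r. True" x]
  by (simp add: affine_hull_convex_hull affine_hull_finite sum_axis_image)

lemma mem_rel_interior_face_simplex:
  fixes x :: "real ^ 'v::finite"
  shows "x \<in> rel_interior (face_simplex \<sigma>) \<longleftrightarrow>
    (\<forall>v. 0 \<le> x $ v) \<and> (\<Sum>v\<in>UNIV. x $ v) = 1 \<and> support x = \<sigma>"
proof -
  have "x \<in> rel_interior (face_simplex \<sigma>) \<longleftrightarrow>
      (\<forall>v\<in>\<sigma>. 0 < x $ v) \<and> (\<Sum>v\<in>UNIV. x $ v) = 1 \<and> support x \<subseteq> \<sigma>"
    using barycentric_combination_iff[of \<sigma> "\<lambda>r. 0 < r" x]
    by (simp add: rel_interior_convex_hull_explicit[OF affine_independent_axes] sum_axis_image)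
  moreover have "(\<forall>v\<in>\<sigma>. 0 < x $ v) \<and> support x \<subseteq> \<sigma> \<longleftrightarrow> (\<forall>v. 0 \<le> x $ v) \<and> support x = \<sigma>"
    unfolding support_def less_le set_eq_iff subset_iff mem_Collect_eq by (metis order_refl)
  ultimately show ?thesis by blast
qed

lemma aff_dim_face_simplex: "aff_dim (face_simplex (\<sigma> :: 'v::finite set)) = int (card \<sigma>) - 1"
  using aff_dim_affine_independent[OF affine_independent_axes, of \<sigma>]
  by (simp add: aff_dim_convex_hull card_image[OF inj_axis])

lemma polytope_face_simplex: "polytope (face_simplex (\<sigma> :: 'v::finite set))"
  by (simp add: polytope_convex_hull)

lemma support_nonempty:
  assumes "(\<Sum>v\<in>UNIV. x $ v) = (1::real)"
  shows "support x \<noteq> {}"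
proof
  assume "support x = {}"
  then have "x $ v = 0" for v
    by (auto simp: support_def)
  then show False
    using assms by simp
qed

lemma mem_geometric_carrier:
  assumes "abstract_complex X"
  shows "x \<in> geometric_carrier X \<longleftrightarrow> (\<forall>v. 0 \<le> x $ v) \<and> (\<Sum>v\<in>UNIV. x $ v) = 1 \<and> support x \<in> X"
proof
  assume "x \<in> geometric_carrier X"
  then obtain \<sigma> where "\<sigma> \<in> X" "x \<in> face_simplex \<sigma>"
    unfolding geometric_carrier_def by blast
  then show "(\<forall>v. 0 \<le> x $ v) \<and> (\<Sum>v\<in>UNIV. x $ v) = 1 \<and> support x \<in> X"
    using assms mem_face_simplex[of x \<sigma>] unfolding abstract_complex_def by metis
next
  assume "(\<forall>v. 0 \<le> x $ v) \<and> (\<Sum>v\<in>UNIV. x $ v) = 1 \<and> support x \<in> X"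
  then have "x \<in> face_simplex (support x)" "support x \<in> X"
    using mem_face_simplex[of x "support x"] by auto
  then show "x \<in> geometric_carrier X"
    unfolding geometric_carrier_def by blast
qed

lemma polytopal_geometric_carrier: "pw_affine (geometric_carrier (X :: 'v::finite set set)) (\<lambda>x. x)"
  unfolding geometric_carrier_def
  by (rule pw_affine_Union_polytopes) (auto simp: polytope_face_simplex)

lemma compact_geometric_carrier: "compact (geometric_carrier (X :: 'v::finite set set))"
  unfolding geometric_carrier_def
  by (intro compact_UN) (auto simp: polytope_imp_compact polytope_face_simplex)

lemma geometric_carrier_Un: "geometric_carrier (X \<union> Y) = geometric_carrier X \<union> geometric_carrier Y"
  unfolding geometric_carrier_def by blast

lemma geometric_carrier_Int:
  assumes "abstract_complex X" "abstract_complex Y"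
  shows "geometric_carrier X \<inter> geometric_carrier Y = geometric_carrier (X \<inter> Y)"
proof -
  have "abstract_complex (X \<inter> Y)"
    unfolding abstract_complex_def
  proof (intro conjI ballI allI impI)
    show "finite (X \<inter> Y)" "\<And>\<sigma>. \<sigma> \<in> X \<inter> Y \<Longrightarrow> finite \<sigma>"
      using assms by (auto simp: abstract_complex_def)
    show "\<tau> \<in> X \<inter> Y" if "\<sigma> \<in> X \<inter> Y" "\<tau> \<subseteq> \<sigma>" for \<sigma> \<tau>
      using assms that unfolding abstract_complex_def by (metis IntE IntI)
  qed
  then show ?thesis
    using assms by (auto simp: mem_geometric_carrier)
qed

lemma abstract_complex_Un: "abstract_complex X \<Longrightarrow> abstract_complex Y \<Longrightarrow> abstract_complex (X \<union> Y)"
  by (auto simp: abstract_complex_def)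

lemma apex_in_affine_hull:
  assumes "(1 - t) *\<^sub>R w + t *\<^sub>R y = z" "t \<noteq> 1" "y \<in> affine hull T" "z \<in> affine hull T"
  shows "w \<in> affine hull T"
proof -
  have "(1 - t) *\<^sub>R w = z - t *\<^sub>R y"
    using assms(1) by (simp add: algebra_simps)
  then have "(1 / (1 - t)) *\<^sub>R ((1 - t) *\<^sub>R w) = (1 / (1 - t)) *\<^sub>R (z - t *\<^sub>R y)"
    by simp
  moreover have "(1 / (1 - t)) *\<^sub>R ((1 - t) *\<^sub>R w) = w"
    using assms(2) by simp
  moreover have "(1 / (1 - t)) *\<^sub>R (z - t *\<^sub>R y) = (1 / (1 - t)) *\<^sub>R z + (- t / (1 - t)) *\<^sub>R y"
    by (simp add: scaleR_diff_right)
  ultimately have "w = (1 / (1 - t)) *\<^sub>R z + (- t / (1 - t)) *\<^sub>R y"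
    by metis
  moreover have "1 / (1 - t) + - t / (1 - t) = 1"
    using assms(2) by (simp add: diff_divide_distrib[symmetric])
  ultimately show ?thesis
    using mem_affine[OF affine_affine_hull assms(4,3)] by metis
qed

lemma visible_from_outside_affine_hull:
  assumes "w \<notin> affine hull T" "E \<subseteq> T"
  shows "visible_from w E"
  unfolding visible_from_def
proof (intro conjI ballI allI impI)
  have E: "y \<in> affine hull T" if "y \<in> E" for y
    using that assms(2) hull_inc[of y T affine] by blast
  then show "w \<notin> E" using assms by blast
  fix y r assume "y \<in> E" "0 < r" "w + r *\<^sub>R (y - w) \<in> E"
  moreover have "(1 - r) *\<^sub>R w + r *\<^sub>R y = w + r *\<^sub>R (y - w)"
    by (simp add: algebra_simps)
  ultimately show "r = 1"
    using assms apex_in_affine_hull[of r w y _ T] E by metis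
qed

text \<open>The facet opposite \<open>w\<close> is the old simplex; the one opposite a vertex of
  \<open>C\<close> is the cone over a facet of the old simplex. Two vertices in \<open>C\<close>
  keep that facet nonempty, as \<open>cone_over\<close> of the empty set omits the apex.\<close>

lemma rel_frontier_cone_over_simplex:
  fixes C :: "'a::euclidean_space set"
  assumes "\<not> affine_dependent C" "w \<notin> affine hull C" "2 \<le> card C"
  shows "rel_frontier (convex hull (insert w C)) =
    convex hull C \<union> cone_over w (rel_frontier (convex hull C))"
proof -
  have ind: "\<not> affine_dependent (insert w C)"
    using affine_dependent_choose[OF assms(1), of w] assms(2) by blast
  have wC: "w \<notin> C" using assms(2) hull_inc[of w C affine] by blast
  have cone: "convex hull (insert w C - {x}) = cone_over w (convex hull (C - {x}))" if "x \<in> C" for x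
  proof -
    have "C - {x} \<noteq> {}"
    proof
      assume "C - {x} = {}"
      then have "C \<subseteq> {x}" by blast
      then have "card C \<le> 1" using card_mono[of "{x}" C] by simp
      then show False using assms(3) by simp
    qed
    moreover have "insert w C - {x} = insert w (C - {x})"
      using that wC by blast
    ultimately show ?thesis
      using convex_hull_insert_eq_cone_over[of "convex hull (C - {x})" w] by (simp add: hull_insert[symmetric])
  qed
  have "rel_frontier (convex hull (insert w C)) = \<Union>{convex hull (insert w C - {x}) |x. x \<in> insert w C}"
    by (rule rel_frontier_convex_hull_cases[OF ind])
  also have "\<dots> = convex hull C \<union> (\<Union>x\<in>C. convex hull (insert w C - {x}))"
  proof -
    have "insert w C - {w} = C" using wC by blast
    then show ?thesis by auto
  qed
  also have "(\<Union>x\<in>C. convex hull (insert w C - {x})) = (\<Union>x\<in>C. cone_over w (convex hull (C - {x})))"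
    using cone by (intro SUP_cong) auto
  also have "\<dots> = cone_over w (\<Union>{convex hull (C - {x}) |x. x \<in> C})"
    unfolding cone_over_def by blast
  also have "\<Union>{convex hull (C - {x}) |x. x \<in> C} = rel_frontier (convex hull C)"
    by (rule rel_frontier_convex_hull_cases[OF assms(1), symmetric])
  finally show ?thesis .
qed

text \<open>The model sphere is the boundary of a simplex with base \<open>T\<close> and a new apex
  \<open>w\<close>. \<open>B\<close> goes to the base by \<open>f\<close>, and \<open>D\<close> has
  to go to the cone over the frontier of \<open>T\<close>. Extending the change of boundary charts
  radially corrects \<open>\<psi>\<close> so that it agrees with \<open>f\<close> on the
  intersection.\<close>

lemma combinatorial_sphere_Un_cone:
  fixes B D :: "'v::finite set set" and c :: "'b::euclidean_space"
  assumes B: "abstract_complex B" and D: "abstract_complex D"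
    and "1 \<le> d" "d < CARD('v)"
    and T: "int d simplex (T :: (real ^ 'v) set)"
    and f: "pl_bij (geometric_carrier B) T f"
    and fE: "f ` geometric_carrier (B \<inter> D) = rel_frontier T"
    and psi: "pl_bij (geometric_carrier D) (cone_over c E) \<psi>"
    and vis: "visible_from c E"
    and psiE: "\<psi> ` geometric_carrier (B \<inter> D) = E"
  shows "combinatorial_sphere d (B \<union> D)"
proof -
  let ?E = "geometric_carrier (B \<inter> D)"
  obtain C where C: "finite C" "\<not> affine_dependent C" "card C = d + 1" "T = convex hull C"
    using T unfolding simplex by auto
  \<comment> \<open>This makes room for \<open>w\<close>: the affine hull of \<open>T\<close> is not
    the whole ambient space.\<close>
  have "aff_dim T < DIM(real ^ 'v)"
    using aff_dim_affine_independent[OF C(2)] C \<open>d < CARD('v)\<close> by (simp add: aff_dim_convex_hull)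
  then have "affine hull T \<noteq> UNIV"
    using aff_dim_eq_full by force
  then obtain w where w: "w \<notin> affine hull T" by blast
  then have wC: "w \<notin> affine hull C"
    using C(4) affine_hull_convex_hull by metis
  let ?\<Delta> = "convex hull (insert w C)"
  have "w \<notin> C"
    using wC hull_inc[of w C affine] by blast
  then have \<Delta>: "int (d + 1) simplex ?\<Delta>"
    using C affine_dependent_choose[OF C(2), of w] wC unfolding simplex by (intro exI[of _ "insert w C"]) auto
  have front: "rel_frontier ?\<Delta> = T \<union> cone_over w (rel_frontier T)"
    using rel_frontier_cone_over_simplex[OF C(2) wC] C \<open>1 \<le> d\<close> by simp
  have frontT: "rel_frontier T \<subseteq> T"
    using closed_simplex[OF T] by (simp add: rel_frontier_def)
  have E: "?E \<subseteq> geometric_carrier B" "?E \<subseteq> geometric_carrier D"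
    unfolding geometric_carrier_def by auto
  have fE': "pl_bij ?E (rel_frontier T) f"
    using pl_bij_restrict[OF f polytopal_geometric_carrier E(1)] fE by simp
  have "pl_bij ?E E \<psi>"
    using pl_bij_restrict[OF psi polytopal_geometric_carrier E(2)] psiE by simp
  then have inv: "pl_bij E ?E (inv_into ?E \<psi>)" and injE: "inj_on \<psi> ?E"
    using pl_bij_inverse unfolding pl_bij_def bij_betw_def by blast+
  obtain \<omega> where chi: "pl_bij (cone_over c E) (cone_over w (rel_frontier T)) \<omega>"
    "\<And>y. y \<in> E \<Longrightarrow> \<omega> y = (f \<circ> inv_into ?E \<psi>) y"
    using pl_bij_cone[OF pl_bij_compose[OF inv fE'] vis visible_from_outside_affine_hull[OF w frontT]] by blast
  have chi_psi: "pl_bij (geometric_carrier D) (cone_over w (rel_frontier T)) (\<omega> \<circ> \<psi>)"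
    using pl_bij_compose[OF psi chi(1)] .
  define F where "F x = (if x \<in> geometric_carrier B then f x else (\<omega> \<circ> \<psi>) x)" for x
  have FB: "F x = f x" if "x \<in> geometric_carrier B" for x
    using that by (simp add: F_def)
  have FD: "F x = (\<omega> \<circ> \<psi>) x" if "x \<in> geometric_carrier D" for x
  proof (cases "x \<in> geometric_carrier B")
    case True
    then have x: "x \<in> ?E"
      using that geometric_carrier_Int[OF B D] by blast
    then have "\<psi> x \<in> E" using psiE by blast
    then show ?thesis
      using chi(2) inv_into_f_f[OF injE x] True by (simp add: F_def)
  qed (simp add: F_def)
  have pB: "pl_bij (geometric_carrier B) T F"
    using f FB unfolding pl_bij_def by (metis pw_affine_cong bij_betw_cong)
  have pD: "pl_bij (geometric_carrier D) (cone_over w (rel_frontier T)) F"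
    using chi_psi FD unfolding pl_bij_def by (metis pw_affine_cong bij_betw_cong)
  \<comment> \<open>Injectivity across the two parts: base and cone meet only in the frontier of
    \<open>T\<close>, and points of the frontier come only from the common boundary.\<close>
  have cross: "x = y" if x: "x \<in> geometric_carrier B" and y: "y \<in> geometric_carrier D" and eq: "F x = F y" for x y
  proof -
    have "F x \<in> T"
      using pB x by (auto simp: pl_bij_def dest: bij_betwE)
    have "F y \<in> cone_over w (rel_frontier T)"
      using pD y by (auto simp: pl_bij_def dest: bij_betwE)
    then obtain t z where tz: "z \<in> rel_frontier T" "F y = (1 - t) *\<^sub>R w + t *\<^sub>R z"
      by (auto elim: cone_overE)
    then have "t = 1"
      using apex_in_affine_hull[of t w z "F y" T] \<open>F x \<in> T\<close> eq frontT w hull_inc by (metis subsetD)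
    then have "F x \<in> f ` ?E"
      using tz fE eq by simp
    then obtain e where "e \<in> ?E" "F x = F e"
      using FB E(1) by (metis imageE subsetD)
    then have "x \<in> geometric_carrier D"
      using pB x E by (metis bij_betw_def inj_onD pl_bij_def subsetD)
    then show ?thesis
      using pD y eq by (metis bij_betw_def inj_onD pl_bij_def)
  qed
  have "pl_bij (geometric_carrier (B \<union> D)) (rel_frontier ?\<Delta>) F"
    unfolding geometric_carrier_Un front pl_bij_def
  proof
    show "pw_affine (geometric_carrier B \<union> geometric_carrier D) F"
      using pB pD by (intro pw_affine_Un) (auto simp: pl_bij_def)
    show "bij_betw F (geometric_carrier B \<union> geometric_carrier D) (T \<union> cone_over w (rel_frontier T))"
      using pB pD cross unfolding pl_bij_def bij_betw_def inj_on_def by (metis Un_iff image_Un)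
  qed
  then show ?thesis
    unfolding combinatorial_sphere_def pl_homeomorphic_iff_pl_bij
    using abstract_complex_Un[OF B D] \<Delta> by blast
qed

section \<open>The topology of combinatorial balls\<close>

text \<open>The relative interior of a convex set is dense in it, so open sets of \<open>T\<close>
  can be cut down to open sets of the affine hull, where invariance of domain applies.\<close>

lemma openin_Int_rel_interior:
  fixes T :: "'a::euclidean_space set"
  assumes "convex T" "openin (top_of_set T) W" "W \<noteq> {}"
  shows "W \<inter> rel_interior T \<noteq> {}" "openin (top_of_set (affine hull T)) (W \<inter> rel_interior T)"
proof -
  obtain U where U: "open U" "W = T \<inter> U"
    using assms(2) by (auto simp: openin_open)
  then obtain x where x: "x \<in> T" "x \<in> U" using assms(3) by blast
  then have "x \<in> closure (rel_interior T)"
    using convex_closure_rel_interior[OF assms(1)] closure_subset by blast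
  then obtain z where "z \<in> U" "z \<in> rel_interior T"
    using U(1) x(2) open_Int_closure_eq_empty[of U "rel_interior T"] by blast
  then show "W \<inter> rel_interior T \<noteq> {}"
    using U rel_interior_subset by blast
  have "W \<inter> rel_interior T = rel_interior T \<inter> U"
    using U rel_interior_subset by blast
  moreover have "openin (top_of_set (affine hull T)) (rel_interior T \<inter> U)"
    using openin_rel_interior[of T] U(1) by (rule openin_Int_open)
  ultimately show "openin (top_of_set (affine hull T)) (W \<inter> rel_interior T)"
    by simp
qed

text \<open>Taking all subsets of the free ridges makes this a complex. For a ball,
  \<open>boundary_image\<close> identifies its carrier with the topological boundary.\<close>

definition boundary_complex :: "nat \<Rightarrow> 'v set set \<Rightarrow> 'v set set" where
  "boundary_complex d B =
     {s. \<exists>\<tau>\<in>B. s \<subseteq> \<tau> \<and> card \<tau> = d \<and> (\<exists>!\<sigma>. \<sigma> \<in> B \<and> card \<sigma> = d + 1 \<and> \<tau> \<subseteq> \<sigma>)}"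

lemma boundary_complex_subset: "abstract_complex B \<Longrightarrow> boundary_complex d B \<subseteq> B"
  unfolding boundary_complex_def abstract_complex_def by auto

lemma abstract_complex_boundary:
  assumes "abstract_complex B"
  shows "abstract_complex (boundary_complex d B)"
  unfolding abstract_complex_def
proof (intro conjI ballI allI impI)
  show "finite (boundary_complex d B)"
    using boundary_complex_subset[OF assms] assms finite_subset by (metis abstract_complex_def)
  show "finite \<sigma>" if "\<sigma> \<in> boundary_complex d B" for \<sigma>
    using that boundary_complex_subset[OF assms] assms by (metis abstract_complex_def subsetD)
  show "\<tau> \<in> boundary_complex d B" if "\<sigma> \<in> boundary_complex d B" "\<tau> \<subseteq> \<sigma>" for \<sigma> \<tau>
    using that unfolding boundary_complex_def mem_Collect_eq by (meson order_trans)
qed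

text \<open>A positive coordinate stays positive nearby, so the support can only grow near a
  point.\<close>

lemma openin_support_superset:
  fixes h :: "'a::topological_space \<Rightarrow> real ^ 'v::finite"
  assumes "continuous_on Q h" "\<And>z v. z \<in> Q \<Longrightarrow> 0 \<le> h z $ v"
  shows "openin (top_of_set Q) {z \<in> Q. \<omega> \<subseteq> support (h z)}"
proof -
  have "{z \<in> Q. \<omega> \<subseteq> support (h z)} = Q \<inter> h -` (\<Inter>v\<in>\<omega>. {x. x $ v > 0})"
    using assms(2) by (fastforce simp: support_def less_le subset_iff)
  moreover have "open (\<Inter>v\<in>\<omega>. {x :: real ^ 'v. x $ v > 0})"
    by (intro open_INT ballI open_halfspace_component_gt_cart) simp
  ultimately show ?thesis
    using continuous_openin_preimage_gen[OF assms(1)] by simp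
qed

section \<open>Charts of balls: dimension of the faces, neighbourhoods of ridges, and the
  boundary\<close>

locale ball_chart =
  fixes B :: "'v::finite set set" and d :: nat and T :: "(real ^ 'v) set"
    and f :: "real ^ 'v \<Rightarrow> real ^ 'v"
  assumes complex: "abstract_complex B" and simplex: "int d simplex T"
    and chart: "pl_bij (geometric_carrier B) T f" and dim: "1 \<le> d"
begin

definition g :: "real ^ 'v \<Rightarrow> real ^ 'v" where
  "g = inv_into (geometric_carrier B) f"

lemma bij: "bij_betw f (geometric_carrier B) T"
  using chart by (simp add: pl_bij_def)

lemma f_in: "x \<in> geometric_carrier B \<Longrightarrow> f x \<in> T"
  using bij by (auto dest: bij_betwE)

lemma g_in: "y \<in> T \<Longrightarrow> g y \<in> geometric_carrier B"
  using bij_betw_inv_into[OF bij] by (auto simp: g_def dest: bij_betwE)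

lemma f_g: "y \<in> T \<Longrightarrow> f (g y) = y"
  using bij by (simp add: g_def bij_betw_inv_into_right)

lemma g_f: "x \<in> geometric_carrier B \<Longrightarrow> g (f x) = x"
  using bij by (simp add: g_def bij_betw_inv_into_left)

lemma inj_f: "inj_on f (geometric_carrier B)"
  using bij by (simp add: bij_betw_def)

lemma inj_g: "inj_on g T"
  by (rule inj_on_inverseI[of _ f]) (rule f_g)

lemma cont_f: "continuous_on (geometric_carrier B) f"
  using chart by (rule pl_bij_continuous)

lemma cont_g: "continuous_on T g"
  unfolding g_def using pl_bij_inverse[OF chart] by (rule pl_bij_continuous)

lemma homeomorphism_f_g: "homeomorphism (geometric_carrier B) T f g"
  unfolding homeomorphism_def using cont_f cont_g f_in g_in f_g g_f by force

lemma convex_T: "convex T" and closed_T: "closed T" and compact_T: "compact T"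
  using simplex convex_simplex closed_simplex compact_simplex by blast+

lemma aff_dim_T: "aff_dim T = int d"
  using simplex aff_dim_simplex by blast

lemma mem_carrier:
  "x \<in> geometric_carrier B \<longleftrightarrow> (\<forall>v. 0 \<le> x $ v) \<and> (\<Sum>v\<in>UNIV. x $ v) = 1 \<and> support x \<in> B"
  using complex by (rule mem_geometric_carrier)

lemma face_simplex_subset_carrier: "\<sigma> \<in> B \<Longrightarrow> face_simplex \<sigma> \<subseteq> geometric_carrier B"
  unfolding geometric_carrier_def by blast

lemma subset_face: "\<sigma> \<in> B \<Longrightarrow> \<tau> \<subseteq> \<sigma> \<Longrightarrow> \<tau> \<in> B"
  using complex by (simp add: abstract_complex_def)

lemma openin_f_image:
  "openin (top_of_set (geometric_carrier B)) N \<Longrightarrow> openin (top_of_set T) (f ` N)"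
  by (rule homeomorphism_imp_open_map[OF homeomorphism_f_g])

lemma openin_star:
  "openin (top_of_set (geometric_carrier B)) {x \<in> geometric_carrier B. \<sigma> \<subseteq> support x}"
  by (rule openin_support_superset) (auto simp: mem_carrier)

lemma obtain_point_with_support:
  assumes "\<sigma> \<in> B" "\<sigma> \<noteq> {}"
  obtains x where "x \<in> geometric_carrier B" "support x = \<sigma>"
proof -
  have "face_simplex \<sigma> \<noteq> {}"
    using assms(2) by simp
  then obtain x where "x \<in> rel_interior (face_simplex \<sigma>)"
    using rel_interior_eq_empty[of "face_simplex \<sigma>"] convex_convex_hull by blast
  then show ?thesis
    using that[of x] assms(1) by (simp add: mem_rel_interior_face_simplex mem_carrier)
qed

text \<open>The chart embeds the relative interior of a face in the affine hull of \<open>T\<close>;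
  invariance of dimension does the rest.\<close>

lemma card_face_le:
  assumes "\<sigma> \<in> B"
  shows "card \<sigma> \<le> d + 1"
proof (cases "\<sigma> = {}")
  case False
  have sub: "rel_interior (face_simplex \<sigma>) \<subseteq> geometric_carrier B"
    using face_simplex_subset_carrier[OF assms] rel_interior_subset by blast
  have "aff_dim (affine hull (face_simplex \<sigma>)) \<le> aff_dim (affine hull T)"
  proof (rule invariance_of_dimension_affine_sets)
    show "openin (top_of_set (affine hull (face_simplex \<sigma>))) (rel_interior (face_simplex \<sigma>))"
      by (rule openin_rel_interior)
    show "continuous_on (rel_interior (face_simplex \<sigma>)) f"
      using cont_f sub continuous_on_subset by blast
    show "f \<in> rel_interior (face_simplex \<sigma>) \<rightarrow> affine hull T"
      using sub f_in hull_subset[of T affine] by blast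
    show "inj_on f (rel_interior (face_simplex \<sigma>))"
      using inj_f sub inj_on_subset by blast
    show "rel_interior (face_simplex \<sigma>) \<noteq> {}"
      using False rel_interior_eq_empty[of "face_simplex \<sigma>"] by simp
  qed auto
  then show ?thesis
    by (simp only: aff_dim_affine_hull aff_dim_face_simplex aff_dim_T)
qed simp

text \<open>Where the support is largest it cannot grow, so it is constant on a neighbourhood. That
  neighbourhood embeds in the affine hull of a single face, and invariance of dimension bounds the
  size of this face from below.\<close>

lemma exists_support_of_large_card:
  fixes h :: "'a::euclidean_space \<Rightarrow> real ^ 'v"
  assumes "affine A" "openin (top_of_set A) Q" "Q \<noteq> {}"
    and h: "continuous_on Q h" "inj_on h Q" "h ` Q \<subseteq> geometric_carrier B"
  obtains y where "y \<in> Q" "aff_dim A + 1 \<le> int (card (support (h y)))"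
proof -
  let ?K = "(\<lambda>y. card (support (h y))) ` Q"
  have "?K \<subseteq> {..card (UNIV :: 'v set)}"
    by (auto intro: card_mono)
  then have fin: "finite ?K"
    using finite_subset by blast
  then have "Max ?K \<in> ?K"
    using assms(3) by (intro Max_in) auto
  then obtain y where y: "y \<in> Q" "card (support (h y)) = Max ?K"
    by force
  have max: "card (support (h z)) \<le> card (support (h y))" if "z \<in> Q" for z
    using that fin y(2) by simp
  define \<omega> where "\<omega> = support (h y)"
  define Q' where "Q' = {z \<in> Q. \<omega> \<subseteq> support (h z)}"
  have nonneg: "0 \<le> h z $ v" and sum1: "(\<Sum>v\<in>UNIV. h z $ v) = 1" if "z \<in> Q" for z v
    using h(3) that mem_carrier by blast+
  have "support (h z) = \<omega>" if "z \<in> Q'" for z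
  proof -
    have "card (support (h z)) \<le> card \<omega>"
      using max that by (simp add: Q'_def \<omega>_def)
    then show ?thesis
      using that card_seteq[of "support (h z)" \<omega>] by (simp add: Q'_def)
  qed
  then have into: "h \<in> Q' \<rightarrow> affine hull (face_simplex \<omega>)"
    using sum1 unfolding mem_affine_hull_face_simplex Pi_iff Q'_def by blast
  have "openin (top_of_set Q) Q'"
    unfolding Q'_def using h(1) nonneg by (rule openin_support_superset)
  then have "openin (top_of_set A) Q'"
    using assms(2) openin_trans by blast
  moreover have "Q' \<subseteq> Q" "Q' \<noteq> {}"
    using y by (auto simp: Q'_def \<omega>_def)
  ultimately have "aff_dim A \<le> aff_dim (affine hull (face_simplex \<omega>))"
    using h into
    by (intro invariance_of_dimension_affine_sets[of A Q' _ h])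
       (auto intro: assms(1) continuous_on_subset inj_on_subset)
  then have "aff_dim A + 1 \<le> int (card \<omega>)"
    by (simp only: aff_dim_affine_hull aff_dim_face_simplex)
  then show ?thesis
    using that[of y] y(1) by (simp add: \<omega>_def)
qed

text \<open>Points near the relative interior of the face have a support that contains the face and
  hence equals it. Their images form an open set of \<open>T\<close>, so one of these supports has
  at least \<open>d + 1\<close> elements.\<close>

lemma card_maximal_face:
  assumes "\<sigma> \<in> B" "\<sigma> \<noteq> {}" "\<And>\<rho>. \<rho> \<in> B \<Longrightarrow> \<sigma> \<subseteq> \<rho> \<Longrightarrow> \<rho> = \<sigma>"
  shows "card \<sigma> = d + 1"
proof -
  let ?N = "{x \<in> geometric_carrier B. \<sigma> \<subseteq> support x}"
  let ?Q = "f ` ?N \<inter> rel_interior T"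
  obtain x where "x \<in> geometric_carrier B" "support x = \<sigma>"
    using obtain_point_with_support assms(1,2) by blast
  then have ne: "f ` ?N \<noteq> {}" by blast
  note Q = openin_Int_rel_interior[OF convex_T openin_f_image[OF openin_star] ne]
  have QT: "?Q \<subseteq> T" using rel_interior_subset by blast
  obtain y where y: "y \<in> ?Q" "aff_dim (affine hull T) + 1 \<le> int (card (support (g y)))"
    using exists_support_of_large_card[OF affine_affine_hull Q(2,1), of g]
      continuous_on_subset[OF cont_g QT] inj_on_subset[OF inj_g QT] QT g_in by blast
  have "g y \<in> ?N" using y(1) g_f by auto
  then have "support (g y) = \<sigma>"
    using assms(3) mem_carrier by blast
  then show ?thesis
    using y(2) card_face_le[OF assms(1)] by (simp add: aff_dim_T)
qed

lemma face_in_facet: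
  assumes "\<sigma> \<in> B"
  obtains \<rho> where "\<rho> \<in> B" "card \<rho> = d + 1" "\<sigma> \<subseteq> \<rho>"
proof -
  have "\<exists>\<sigma>'\<in>B. \<sigma> \<subseteq> \<sigma>' \<and> \<sigma>' \<noteq> {}"
  proof (cases "\<sigma> = {}")
    case True
    have "T \<noteq> {}" using aff_dim_T by auto
    then obtain x where "x \<in> geometric_carrier B" using g_in by blast
    then show ?thesis
      using True mem_carrier support_nonempty by blast
  qed (use assms in blast)
  then obtain \<sigma>' where s: "\<sigma>' \<in> B" "\<sigma> \<subseteq> \<sigma>'" "\<sigma>' \<noteq> {}" by blast
  have "finite B" using complex by (simp add: abstract_complex_def)
  then obtain \<rho> where r: "\<rho> \<in> B" "\<sigma>' \<subseteq> \<rho>" "\<And>\<omega>. \<omega> \<in> B \<Longrightarrow> \<rho> \<subseteq> \<omega> \<Longrightarrow> \<omega> = \<rho>"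
    using finite_has_maximal2[of B \<sigma>'] s(1) by metis
  then have "card \<rho> = d + 1"
    using s(3) by (intro card_maximal_face) auto
  then show ?thesis
    using that r s by blast
qed

text \<open>By invariance of domain, \<open>f \<circ> q\<close> has an image that is open in the
  affine hull of \<open>T\<close> and so avoids the frontier. Interior points of the ball can thus
  be recognised from the complex alone.\<close>

lemma locally_euclidean_imp_interior:
  fixes q :: "'a::euclidean_space \<Rightarrow> real ^ 'v"
  assumes "affine A" "aff_dim A = int d" "openin (top_of_set A) U"
    and q: "continuous_on U q" "inj_on q U" "q ` U \<subseteq> geometric_carrier B"
  shows "f ` q ` U \<subseteq> rel_interior T" "openin (top_of_set (geometric_carrier B)) (q ` U)"
proof -
  have "openin (top_of_set (affine hull T)) ((f \<circ> q) ` U)"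
  proof (rule invariance_of_domain_affine_sets[OF assms(3,1)])
    show "aff_dim (affine hull T) \<le> aff_dim A"
      using assms(2) aff_dim_T by simp
    show "continuous_on U (f \<circ> q)"
      using q cont_f continuous_on_subset by (blast intro: continuous_on_compose)
    show "f \<circ> q \<in> U \<rightarrow> affine hull T"
      using q(3) f_in hull_subset[of T affine] by fastforce
    show "inj_on (f \<circ> q) U"
      using q inj_f inj_on_subset by (blast intro: comp_inj_on)
  qed simp
  then have *: "openin (top_of_set (affine hull T)) (f ` q ` U)"
    by (simp add: image_comp)
  have fqT: "f ` q ` U \<subseteq> T"
    using q(3) f_in by blast
  then show "f ` q ` U \<subseteq> rel_interior T"
    using * by (rule rel_interior_maximal)
  have "openin (top_of_set T) (f ` q ` U)"
    using * fqT hull_subset[of T affine] openin_subset_trans by blast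
  then have "openin (top_of_set (geometric_carrier B)) (g ` f ` q ` U)"
    by (rule homeomorphism_imp_open_map[OF homeomorphism_symD[OF homeomorphism_f_g]])
  moreover have "g ` f ` q ` U = q ` U"
    using q(3) g_f by (force simp: image_image)
  ultimately show "openin (top_of_set (geometric_carrier B)) (q ` U)"
    by simp
qed

lemma facet_interior:
  assumes "x \<in> geometric_carrier B" "card (support x) = d + 1"
  shows "f x \<in> rel_interior T"
proof -
  let ?S = "face_simplex (support x)"
  have x: "x \<in> rel_interior ?S" "support x \<in> B"
    using assms(1) by (auto simp: mem_carrier mem_rel_interior_face_simplex)
  have "rel_interior ?S \<subseteq> geometric_carrier B"
    using face_simplex_subset_carrier[OF x(2)] rel_interior_subset by blast
  moreover have "aff_dim (affine hull ?S) = int d"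
    unfolding aff_dim_affine_hull aff_dim_face_simplex using assms(2) by simp
  ultimately have "f ` (\<lambda>x. x) ` rel_interior ?S \<subseteq> rel_interior T"
    using locally_euclidean_imp_interior(1)[OF affine_affine_hull _ openin_rel_interior, of ?S "\<lambda>x. x"]
    by simp
  then show ?thesis
    using x(1) by auto
qed

text \<open>Two facets sharing a ridge form a bipyramid; folding its lower half over the ridge
  exhibits the open star of the ridge as an open subset of the affine hull of the upper half.\<close>

lemma ridge_in_two_facets:
  assumes "insert a \<tau> \<in> B" "insert b \<tau> \<in> B" "a \<notin> \<tau>" "b \<notin> \<tau>" "a \<noteq> b" "card \<tau> = d"
  defines "N \<equiv> {x \<in> geometric_carrier B. \<tau> \<subseteq> support x \<and> (support x \<subseteq> insert a \<tau> \<or> support x \<subseteq> insert b \<tau>)}"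
  shows "f ` N \<subseteq> rel_interior T" "openin (top_of_set (geometric_carrier B)) N"
proof -
  \<comment> \<open>The entries of \<open>w\<close> add up to 0, so \<open>q\<close> preserves the
    coordinate sum. Where \<open>y $ a\<close> is negative, \<open>q\<close> sets it to 0 and gives
    its absolute value to \<open>b\<close>; elsewhere \<open>q\<close> does nothing.\<close>
  define w :: "real ^ 'v" where
    "w = (\<chi> v. if v = a \<or> v = b then 1 else if v \<in> \<tau> then - 2 / d else 0)"
  have w: "w $ a = 1" "w $ b = 1" "\<And>u. u \<in> \<tau> \<Longrightarrow> w $ u = - 2 / d"
    "\<And>v. v \<noteq> a \<Longrightarrow> v \<noteq> b \<Longrightarrow> v \<notin> \<tau> \<Longrightarrow> w $ v = 0"
    using assms by (auto simp: w_def)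
  have w_sum: "(\<Sum>v\<in>UNIV. w $ v) = 0"
  proof -
    have "(\<Sum>v\<in>UNIV. w $ v) = (\<Sum>v\<in>insert a (insert b \<tau>). w $ v)"
      using w(4) by (intro sum.mono_neutral_right) auto
    also have "\<dots> = 0"
      using assms w dim by simp
    finally show ?thesis .
  qed
  define q where "q y = y + max 0 (- y $ a) *\<^sub>R w" for y :: "real ^ 'v"
  let ?A = "affine hull (face_simplex (insert a \<tau>))"
  \<comment> \<open>Positivity is asked of \<open>q y\<close> and not of \<open>y\<close>, because
    the fold lowers the coordinates on \<open>\<tau>\<close>.\<close>
  define U where "U = {y \<in> ?A. \<forall>u\<in>\<tau>. 0 < q y $ u}"
  have q_cont: "continuous_on S q" for S
    unfolding q_def by (intro continuous_intros)
  have q_sum: "(\<Sum>v\<in>UNIV. q y $ v) = (\<Sum>v\<in>UNIV. y $ v)" for y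
    using w_sum by (simp add: q_def sum.distrib sum_distrib_left[symmetric])
  have memA: "y \<in> ?A \<longleftrightarrow> (\<Sum>v\<in>UNIV. y $ v) = 1 \<and> (\<forall>v. v \<noteq> a \<longrightarrow> v \<notin> \<tau> \<longrightarrow> y $ v = 0)" for y
    unfolding mem_affine_hull_face_simplex by (auto simp: support_def)
  have qa: "q y $ a = max 0 (y $ a)" for y
    using w by (simp add: q_def max_def)
  have qb: "q y $ b = max 0 (- y $ a)" if "y \<in> ?A" for y
    using that[unfolded memA] w assms by (auto simp: q_def)
  have qv: "q y $ v = 0" if "y \<in> ?A" "v \<noteq> a" "v \<noteq> b" "v \<notin> \<tau>" for y v
    using that[unfolded memA] w assms by (auto simp: q_def)
  have "U = ?A \<inter> q -` (\<Inter>u\<in>\<tau>. {x. 0 < x $ u})"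
    by (auto simp: U_def)
  moreover have "open (\<Inter>u\<in>\<tau>. {x :: real ^ 'v. 0 < x $ u})"
    by (intro open_INT ballI open_halfspace_component_gt_cart) simp
  ultimately have U: "openin (top_of_set ?A) U"
    using continuous_openin_preimage_gen[OF q_cont] by simp
  have inj: "inj_on q U"
  proof (rule inj_onI)
    fix y z assume "y \<in> U" "z \<in> U" and eq: "q y = q z"
    then have "y \<in> ?A" "z \<in> ?A" by (auto simp: U_def)
    then have "y $ a = z $ a"
      using qa[of y] qa[of z] qb[of y] qb[of z] eq by (auto simp: max_def split: if_splits)
    then show "y = z"
      using eq by (simp add: q_def)
  qed
  have "q ` U = N"
  proof (intro equalityI subsetI)
    fix x assume "x \<in> q ` U"
    then obtain y where y: "y \<in> ?A" "\<And>u. u \<in> \<tau> \<Longrightarrow> 0 < q y $ u" "x = q y"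
      by (auto simp: U_def)
    have nonneg: "0 \<le> x $ v" for v
      using qa[of y] qb[OF y(1)] qv[OF y(1)] y(2,3) by (cases "v = a \<or> v = b \<or> v \<in> \<tau>") (auto simp: less_imp_le)
    have \<tau>: "\<tau> \<subseteq> support x"
      using y(2,3) by (fastforce simp: support_def)
    have "x $ a = 0 \<or> x $ b = 0"
      using qa[of y] qb[OF y(1)] y(3) by (auto simp: max_def)
    then have supp: "support x \<subseteq> insert a \<tau> \<or> support x \<subseteq> insert b \<tau>"
    proof
      assume "x $ a = 0"
      then have "support x \<subseteq> insert b \<tau>"
        using qv[OF y(1)] unfolding y(3) support_def by fastforce
      then show ?thesis by simp
    next
      assume "x $ b = 0"
      then have "support x \<subseteq> insert a \<tau>"
        using qv[OF y(1)] unfolding y(3) support_def by fastforce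
      then show ?thesis by simp
    qed
    then have "support x \<in> B"
      using assms(1,2) subset_face by blast
    then show "x \<in> N"
      using nonneg \<tau> supp q_sum[of y] y(3) y(1)[unfolded memA] by (simp add: N_def mem_carrier)
  next
    fix x assume "x \<in> N"
    then have x: "\<And>v. 0 \<le> x $ v" "(\<Sum>v\<in>UNIV. x $ v) = 1" "\<And>u. u \<in> \<tau> \<Longrightarrow> x $ u \<noteq> 0"
      "support x \<subseteq> insert a \<tau> \<or> support x \<subseteq> insert b \<tau>"
      by (auto simp: N_def mem_carrier support_def)
    have ab: "x $ a = 0 \<or> x $ b = 0"
      using x(4) assms by (auto simp: support_def)
    have other: "x $ v = 0" if "v \<noteq> a" "v \<noteq> b" "v \<notin> \<tau>" for v
      using x(4) that by (auto simp: support_def)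
    define y where "y = x - (x $ b) *\<^sub>R w"
    have "y $ a = x $ a - x $ b"
      using w by (simp add: y_def)
    then have "max 0 (- y $ a) = x $ b"
      using ab x(1)[of a] x(1)[of b] by (auto simp: max_def)
    then have qy: "q y = x"
      by (simp add: q_def y_def)
    have "y \<in> ?A"
      unfolding memA
    proof (intro conjI allI impI)
      show "(\<Sum>v\<in>UNIV. y $ v) = 1"
        using q_sum[of y] qy x(2) by simp
      show "y $ v = 0" if "v \<noteq> a" "v \<notin> \<tau>" for v
        using that other w by (cases "v = b") (auto simp: y_def)
    qed
    moreover have "0 < q y $ u" if "u \<in> \<tau>" for u
      using x(1)[of u] x(3)[OF that] qy by simp
    ultimately show "x \<in> q ` U"
      using qy by (auto simp: U_def)
  qed
  moreover have "aff_dim ?A = int d"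
    using assms(3,6) by (simp only: aff_dim_affine_hull aff_dim_face_simplex) simp
  moreover have "N \<subseteq> geometric_carrier B"
    by (auto simp: N_def)
  ultimately show "f ` N \<subseteq> rel_interior T" "openin (top_of_set (geometric_carrier B)) N"
    using locally_euclidean_imp_interior[OF affine_affine_hull _ U q_cont inj] by auto
qed

text \<open>The two facets already contain a neighbourhood of a relative interior point
  \<open>x\<close> of the ridge, by \<open>ridge_in_two_facets\<close>. Moving from \<open>x\<close>
  slightly towards \<open>c\<close> leads into a third facet and out of that neighbourhood.\<close>

lemma ridge_in_at_most_two_facets:
  assumes "insert a \<tau> \<in> B" "insert b \<tau> \<in> B" "insert c \<tau> \<in> B" "a \<notin> \<tau>" "b \<notin> \<tau>" "c \<notin> \<tau>"
    "a \<noteq> b" "card \<tau> = d"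
  shows "c = a \<or> c = b"
proof (rule ccontr)
  assume c: "\<not> (c = a \<or> c = b)"
  define N where "N = {x \<in> geometric_carrier B. \<tau> \<subseteq> support x \<and> (support x \<subseteq> insert a \<tau> \<or> support x \<subseteq> insert b \<tau>)}"
  have "openin (top_of_set (geometric_carrier B)) N"
    unfolding N_def using assms by (intro ridge_in_two_facets(2)) auto
  then obtain V where V: "open V" "N = geometric_carrier B \<inter> V"
    by (auto simp: openin_open)
  have "\<tau> \<noteq> {}" using assms(8) dim by auto
  moreover have "\<tau> \<in> B" using assms(1) subset_face by blast
  ultimately obtain x where x: "x \<in> geometric_carrier B" "support x = \<tau>"
    using obtain_point_with_support by blast
  define p where "p t = (1 - t) *\<^sub>R x + t *\<^sub>R axis c 1" for t :: real
  have "continuous_on UNIV p"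
    unfolding p_def by (intro continuous_intros)
  then have "open (p -` V)"
    using open_vimage[OF V(1)] by blast
  moreover have "x \<in> V"
    using x V(2) by (auto simp: N_def)
  then have "0 \<in> p -` V"
    by (simp add: p_def)
  ultimately obtain e where e: "e > 0" "ball 0 e \<subseteq> p -` V"
    using open_contains_ball by metis
  define t where "t = min (e / 2) (1 / 2)"
  have t: "0 < t" "t < 1" "t < e"
    using e by (auto simp: t_def min_def)
  have pc: "p t $ c = t"
    using x(2) assms(6) by (auto simp: p_def support_def)
  have pv: "p t $ v = (1 - t) * x $ v" if "v \<noteq> c" for v
    using that by (simp add: p_def axis_def)
  have supp: "support (p t) = insert c \<tau>"
  proof (intro set_eqI)
    fix v
    show "v \<in> support (p t) \<longleftrightarrow> v \<in> insert c \<tau>"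
      using pc pv[of v] t x(2) by (cases "v = c") (auto simp: support_def)
  qed
  have "(\<Sum>v\<in>UNIV. p t $ v) = (1 - t) * (\<Sum>v\<in>UNIV. x $ v) + t * (\<Sum>v\<in>UNIV. axis c 1 $ v)"
    by (simp add: p_def sum.distrib sum_distrib_left)
  also have "(\<Sum>v\<in>UNIV. axis c (1::real) $ v) = 1"
    by (simp add: axis_def)
  finally have "(\<Sum>v\<in>UNIV. p t $ v) = 1"
    using x(1) by (simp add: mem_carrier)
  moreover have "0 \<le> p t $ v" for v
    using pc pv[of v] t x(1) by (cases "v = c") (auto simp: mem_carrier)
  ultimately have "p t \<in> geometric_carrier B"
    using supp assms(3) by (simp add: mem_carrier)
  moreover have "p t \<in> V"
    using e(2) t by (auto simp: subset_iff dist_norm)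
  ultimately have "p t \<in> N"
    using V(2) by blast
  then show False
    using supp c assms(6) by (auto simp: N_def)
qed

text \<open>If \<open>f x\<close> were interior, invariance of domain for the inverse chart would
  make a neighbourhood of \<open>x\<close> open in the affine hull of the only facet at this ridge.
  Then \<open>x\<close> would be in the relative interior of that facet, whose vertex set is larger
  than \<open>support x\<close>.\<close>

lemma boundary_ridge:
  assumes "x \<in> geometric_carrier B" "card (support x) = d"
    and uniq: "\<exists>!\<sigma>. \<sigma> \<in> B \<and> card \<sigma> = d + 1 \<and> support x \<subseteq> \<sigma>"
  shows "f x \<in> rel_frontier T"
proof (rule ccontr)
  assume "f x \<notin> rel_frontier T"
  then have fx: "f x \<in> rel_interior T"
    using f_in[OF assms(1)] closed_T by (simp add: rel_frontier_def)
  obtain \<sigma> where s: "\<sigma> \<in> B" "card \<sigma> = d + 1" "support x \<subseteq> \<sigma>"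
    "\<And>\<rho>. \<rho> \<in> B \<Longrightarrow> card \<rho> = d + 1 \<Longrightarrow> support x \<subseteq> \<rho> \<Longrightarrow> \<rho> = \<sigma>"
    using uniq by metis
  let ?N = "{z \<in> geometric_carrier B. support x \<subseteq> support z}"
  let ?A = "affine hull (face_simplex \<sigma>)"
  have N: "?N \<subseteq> face_simplex \<sigma>"
  proof
    fix z assume z: "z \<in> ?N"
    then have "support z \<in> B" by (simp add: mem_carrier)
    then obtain \<rho> where "\<rho> \<in> B" "card \<rho> = d + 1" "support z \<subseteq> \<rho>"
      using face_in_facet by blast
    moreover from this have "\<rho> = \<sigma>"
      using z s(4) by blast
    ultimately show "z \<in> face_simplex \<sigma>"
      using z by (simp add: mem_face_simplex mem_carrier)
  qed
  define Q where "Q = f ` ?N \<inter> rel_interior T"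
  have ne: "f ` ?N \<noteq> {}" using assms(1) by blast
  have Q: "openin (top_of_set (affine hull T)) Q"
    unfolding Q_def by (rule openin_Int_rel_interior[OF convex_T openin_f_image[OF openin_star] ne])
  have QT: "Q \<subseteq> T"
    unfolding Q_def using rel_interior_subset by blast
  have gQ: "g ` Q \<subseteq> ?N"
    unfolding Q_def using g_f by auto
  have "openin (top_of_set ?A) (g ` Q)"
  proof (rule invariance_of_domain_affine_sets[OF Q])
    have "aff_dim ?A = aff_dim T"
      unfolding aff_dim_affine_hull aff_dim_face_simplex aff_dim_T using s(2) by simp
    then show "aff_dim ?A \<le> aff_dim (affine hull T)"
      by simp
    show "continuous_on Q g"
      using cont_g QT continuous_on_subset by blast
    show "g \<in> Q \<rightarrow> ?A"
      using gQ N hull_subset[of "face_simplex \<sigma>" affine] by blast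
    show "inj_on g Q"
      using inj_g QT inj_on_subset by blast
  qed auto
  then have "g ` Q \<subseteq> rel_interior (face_simplex \<sigma>)"
    using subset_trans[OF gQ N] by (rule rel_interior_maximal[rotated])
  moreover have "x \<in> g ` Q"
    using assms(1) fx g_f by (force simp: Q_def)
  ultimately have "support x = \<sigma>"
    using mem_rel_interior_face_simplex by blast
  then show False
    using s(2) assms(2) by simp
qed

text \<open>Free ridges go to the frontier, and so do their closures. Conversely, if a point of a
  facet \<open>F\<close> of \<open>T\<close> were missed, so would be an open part of
  \<open>F\<close>. Some point there comes from a support with at least \<open>d\<close> elements: a
  facet, or a ridge in two facets. Points of either kind go to the interior.\<close>

theorem boundary_image: "f ` geometric_carrier (boundary_complex d B) = rel_frontier T"
proof (intro equalityI subsetI)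
  fix y assume "y \<in> f ` geometric_carrier (boundary_complex d B)"
  then obtain x where x: "x \<in> geometric_carrier (boundary_complex d B)" "y = f x" by blast
  then have "support x \<in> boundary_complex d B"
    using mem_geometric_carrier[OF abstract_complex_boundary[OF complex]] by blast
  then obtain \<tau> where t: "\<tau> \<in> B" "support x \<subseteq> \<tau>" "card \<tau> = d"
    "\<exists>!\<sigma>. \<sigma> \<in> B \<and> card \<sigma> = d + 1 \<and> \<tau> \<subseteq> \<sigma>"
    unfolding boundary_complex_def mem_Collect_eq by (elim bexE conjE) (rule that)
  have xt: "x \<in> face_simplex \<tau>"
    using x(1) t(2) unfolding mem_geometric_carrier[OF abstract_complex_boundary[OF complex]] mem_face_simplex
    by blast
  have cl: "face_simplex \<tau> = closure (rel_interior (face_simplex \<tau>))"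
    using convex_closure_rel_interior[of "face_simplex \<tau>"]
      closure_closed[OF polytope_imp_closed[OF polytope_face_simplex[of \<tau>]]] by simp
  have "f ` closure (rel_interior (face_simplex \<tau>)) \<subseteq> rel_frontier T"
  proof (rule image_closure_subset)
    show "continuous_on (closure (rel_interior (face_simplex \<tau>))) f"
      using cont_f face_simplex_subset_carrier[OF t(1)] cl continuous_on_subset by metis
    show "closed (rel_frontier T)"
      using closed_rel_frontier by blast
    show "f ` rel_interior (face_simplex \<tau>) \<subseteq> rel_frontier T"
    proof (rule image_subsetI)
      fix z assume "z \<in> rel_interior (face_simplex \<tau>)"
      then have "z \<in> geometric_carrier B" "support z = \<tau>"
        unfolding mem_rel_interior_face_simplex mem_carrier using t(1) by auto
      then show "f z \<in> rel_frontier T"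
        using boundary_ridge t(3,4) by metis
    qed
  qed
  then show "y \<in> rel_frontier T"
    using x(2) xt cl by auto
next
  fix y assume y: "y \<in> rel_frontier T"
  then have yT: "y \<in> T"
    using closed_T by (simp add: rel_frontier_def)
  show "y \<in> f ` geometric_carrier (boundary_complex d B)"
  proof (rule ccontr)
    assume no: "y \<notin> f ` geometric_carrier (boundary_complex d B)"
    have "g y \<notin> geometric_carrier (boundary_complex d B)"
      using no f_g[OF yT] by force
    obtain C where C: "finite C" "\<not> affine_dependent C" "int (card C) = int d + 1" "T = convex hull C"
      using simplex unfolding Polytope.simplex by blast
    obtain c where c: "c \<in> C" "y \<in> convex hull (C - {c})"
      using y rel_frontier_convex_hull_cases[OF C(2)] C(4) by auto
    define F where "F = convex hull (C - {c})"
    have FT: "F \<subseteq> rel_frontier T" "F \<subseteq> T"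
      using rel_frontier_convex_hull_cases[OF C(2)] C(4) c(1) closed_T by (auto simp: F_def rel_frontier_def)
    define W where "W = F \<inter> g -` (- geometric_carrier (boundary_complex d B))"
    have "openin (top_of_set F) W"
      unfolding W_def using cont_g FT(2) compact_geometric_carrier
      by (intro continuous_openin_preimage_gen) (auto intro: continuous_on_subset compact_imp_closed)
    moreover have "W \<noteq> {}"
      using c(2) \<open>g y \<notin> _\<close> by (auto simp: W_def F_def)
    moreover have "convex F"
      by (simp add: F_def)
    ultimately have Q: "W \<inter> rel_interior F \<noteq> {}" "openin (top_of_set (affine hull F)) (W \<inter> rel_interior F)"
      using openin_Int_rel_interior by blast+
    have QT: "W \<inter> rel_interior F \<subseteq> T"
      using FT by (auto simp: W_def)
    obtain z where z: "z \<in> W \<inter> rel_interior F" "aff_dim (affine hull F) + 1 \<le> int (card (support (g z)))"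
      using exists_support_of_large_card[OF affine_affine_hull Q(2,1), of g]
        continuous_on_subset[OF cont_g QT] inj_on_subset[OF inj_g QT] QT g_in by blast
    have zF: "z \<in> F" "g z \<notin> geometric_carrier (boundary_complex d B)"
      using z(1) by (auto simp: W_def)
    have zT: "z \<in> T" "z \<notin> rel_interior T"
      using zF FT by (auto simp: rel_frontier_def)
    have "\<not> affine_dependent (C - {c})"
      using C(2) affine_dependent_subset by blast
    then have "aff_dim F = int (card (C - {c})) - 1"
      unfolding F_def by (simp add: aff_dim_affine_independent aff_dim_convex_hull)
    then have card: "d \<le> card (support (g z))"
      using z(2) C c(1) by simp
    have gz: "g z \<in> geometric_carrier B" "f (g z) = z" "support (g z) \<in> B"
      using g_in f_g zT mem_carrier by auto
    have "card (support (g z)) \<noteq> d + 1"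
      using facet_interior gz zT by metis
    then have ridge: "card (support (g z)) = d"
      using card card_face_le[OF gz(3)] by linarith
    have "support (g z) \<notin> boundary_complex d B"
      using zF gz mem_geometric_carrier[OF abstract_complex_boundary[OF complex]] mem_carrier by blast
    then have "\<not> (\<exists>!\<sigma>. \<sigma> \<in> B \<and> card \<sigma> = d + 1 \<and> support (g z) \<subseteq> \<sigma>)"
      using gz ridge unfolding boundary_complex_def by blast
    moreover obtain \<sigma> where s: "\<sigma> \<in> B" "card \<sigma> = d + 1" "support (g z) \<subseteq> \<sigma>"
      using face_in_facet[OF gz(3)] by blast
    ultimately obtain \<rho> where r: "\<rho> \<in> B" "card \<rho> = d + 1" "support (g z) \<subseteq> \<rho>" "\<rho> \<noteq> \<sigma>"
      by blast
    have "\<exists>a. a \<notin> support (g z) \<and> \<omega> = insert a (support (g z))"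
      if "card \<omega> = d + 1" "support (g z) \<subseteq> \<omega>" for \<omega>
    proof -
      have "card (\<omega> - support (g z)) = 1"
        using that ridge card_Diff_subset[of "support (g z)" \<omega>] by simp
      then obtain a where "\<omega> - support (g z) = {a}"
        using card_1_singletonE by blast
      then show ?thesis
        using that(2) by (intro exI[of _ a]) auto
    qed
    then obtain a b where ab: "a \<notin> support (g z)" "\<sigma> = insert a (support (g z))"
      "b \<notin> support (g z)" "\<rho> = insert b (support (g z))"
      using s r by metis
    then have "a \<noteq> b" using r(4) by blast
    then have "f (g z) \<in> rel_interior T"
      using ridge_in_two_facets(1)[of a "support (g z)" b] ab s(1) r(1) ridge gz(1) by blast
    then show False
      using gz zT by simp
  qed
qed

end

section \<open>Vertices of low degree\<close>

lemma abstract_complex_deletion: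
  assumes "abstract_complex B"
  shows "abstract_complex {s \<in> B. v \<notin> s}"
  using assms unfolding abstract_complex_def mem_Collect_eq
  by (metis (no_types, lifting) finite_subset mem_Collect_eq subsetD subsetI)

text \<open>A facet \<open>insert v \<tau>\<close> glued to the rest of the complex along the single ridge \<open>\<tau>\<close> is pushed
  into the neighbouring facet \<open>insert w \<tau>\<close>: \<open>v\<close> moves to the barycenter of \<open>\<tau>\<close>, and the latter to
  the midpoint between itself and \<open>w\<close>.\<close>

lemma pl_bij_push_facet:
  fixes B :: "'v::finite set set"
  assumes B: "abstract_complex B" and faces: "insert v \<tau> \<in> B" "insert w \<tau> \<in> B"
    and "v \<notin> \<tau>" "w \<notin> \<tau>" "v \<noteq> w" "\<tau> \<noteq> {}"
    and star_v: "\<And>\<rho>. \<rho> \<in> B \<Longrightarrow> v \<in> \<rho> \<Longrightarrow> \<rho> \<subseteq> insert v \<tau>"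
    and star_t: "\<And>\<rho>. \<rho> \<in> B \<Longrightarrow> \<tau> \<subseteq> \<rho> \<Longrightarrow> \<rho> \<subseteq> insert v \<tau> \<or> \<rho> \<subseteq> insert w \<tau>"
  shows "\<exists>p. pl_bij (geometric_carrier B) (geometric_carrier {s \<in> B. v \<notin> s}) p"
proof -
  let ?B' = "{s \<in> B. v \<notin> s}"
  define k where "k = real (card \<tau>)"
  have k: "k > 0" using \<open>\<tau> \<noteq> {}\<close> by (simp add: k_def card_gt_0_iff)
  define m where "m x = Min ((\<lambda>u. x $ u) ` \<tau>)" for x :: "real ^ 'v"
  \<comment> \<open>Both \<open>a\<close> and \<open>b\<close> have coordinate sum 0. The term with
    \<open>a\<close> takes half of the weight \<open>k * m x\<close> that \<open>x\<close> has at
    the barycenter of \<open>\<tau>\<close> and moves it to \<open>w\<close>; the term with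
    \<open>b\<close> moves the weight of \<open>v\<close> to that barycenter.\<close>
  define a :: "real ^ 'v" where "a = (\<chi> u. if u = w then k / 2 else if u \<in> \<tau> then - 1 / 2 else 0)"
  define b :: "real ^ 'v" where "b = (\<chi> u. if u = v then - 1 else if u \<in> \<tau> then 1 / k else 0)"
  define p where "p x = x + m x *\<^sub>R a + (x $ v) *\<^sub>R b" for x
  \<comment> \<open>The inverse of \<open>p\<close>. At \<open>y = p x\<close>, the number
    \<open>k * m y - y $ w\<close> equals \<open>x $ v - x $ w\<close>, and at most one of
    \<open>x $ v\<close> and \<open>x $ w\<close> is nonzero. So \<open>\<alpha>\<close> and
    \<open>\<beta>\<close> recover these two coordinates, and \<open>s\<close> recovers
    \<open>m x\<close>.\<close>
  define \<alpha> where "\<alpha> y = max 0 (k * m y - y $ w)" for y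
  define \<beta> where "\<beta> y = max 0 (y $ w - k * m y)" for y
  define s where "s y = 2 * (y $ w - \<beta> y) / k" for y
  define q where "q y = y - s y *\<^sub>R a - \<alpha> y *\<^sub>R b" for y
  have a: "a $ w = k / 2" "\<And>u. u \<in> \<tau> \<Longrightarrow> a $ u = - 1 / 2" "\<And>u. u \<noteq> w \<Longrightarrow> u \<notin> \<tau> \<Longrightarrow> a $ u = 0"
    using assms by (auto simp: a_def)
  have b: "b $ v = - 1" "\<And>u. u \<in> \<tau> \<Longrightarrow> b $ u = 1 / k" "\<And>u. u \<noteq> v \<Longrightarrow> u \<notin> \<tau> \<Longrightarrow> b $ u = 0"
    using assms by (auto simp: b_def)
  have sum_a: "(\<Sum>u\<in>UNIV. a $ u) = 0"
  proof -
    have "(\<Sum>u\<in>UNIV. a $ u) = (\<Sum>u\<in>insert w \<tau>. a $ u)"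
      using a(3) by (intro sum.mono_neutral_right) auto
    then show ?thesis using a \<open>w \<notin> \<tau>\<close> by (simp add: k_def)
  qed
  have sum_b: "(\<Sum>u\<in>UNIV. b $ u) = 0"
  proof -
    have "(\<Sum>u\<in>UNIV. b $ u) = (\<Sum>u\<in>insert v \<tau>. b $ u)"
      using b(3) by (intro sum.mono_neutral_right) auto
    then show ?thesis using b \<open>v \<notin> \<tau>\<close> \<open>\<tau> \<noteq> {}\<close> by (simp add: k_def)
  qed
  have m_le: "m x \<le> x $ u" if "u \<in> \<tau>" for x u
    using that by (simp add: m_def)
  have m_in: "\<exists>u\<in>\<tau>. m x = x $ u" for x
  proof -
    have "m x \<in> (\<lambda>u. x $ u) ` \<tau>"
      unfolding m_def using \<open>\<tau> \<noteq> {}\<close> by (intro Min_in) auto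
    then show ?thesis by blast
  qed
  have m_shift: "m y = m x + c" if "\<And>u. u \<in> \<tau> \<Longrightarrow> y $ u = x $ u + c" for x y c
  proof -
    have "(\<lambda>u. y $ u) ` \<tau> = (\<lambda>u. x $ u + c) ` \<tau>"
      using that by (intro image_cong) auto
    then show ?thesis
      using Min_add_commute[of \<tau> "\<lambda>u. x $ u" c] \<open>\<tau> \<noteq> {}\<close> by (simp add: m_def)
  qed
  note carrier = mem_geometric_carrier[OF B] mem_geometric_carrier[OF abstract_complex_deletion[OF B]]
  have sub: "\<sigma> \<in> B" if "\<rho> \<in> B" "\<sigma> \<subseteq> \<rho>" for \<sigma> \<rho>
    using B that by (simp add: abstract_complex_def)
  have m_pos: "\<tau> \<subseteq> support x" if "m x > 0" for x
    using m_le[of _ x] that by (fastforce simp: support_def)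

  have p_coord: "p x $ v = 0" "p x $ w = x $ w + k * m x / 2"
    "\<And>u. u \<in> \<tau> \<Longrightarrow> p x $ u = x $ u + (x $ v / k - m x / 2)"
    "\<And>u. u \<noteq> v \<Longrightarrow> u \<noteq> w \<Longrightarrow> u \<notin> \<tau> \<Longrightarrow> p x $ u = x $ u" for x
    using a b assms by (auto simp: p_def)
  have q_coord: "q y $ v = y $ v + \<alpha> y" "q y $ w = \<beta> y"
    "\<And>u. u \<in> \<tau> \<Longrightarrow> q y $ u = y $ u + (s y / 2 - \<alpha> y / k)"
    "\<And>u. u \<noteq> v \<Longrightarrow> u \<noteq> w \<Longrightarrow> u \<notin> \<tau> \<Longrightarrow> q y $ u = y $ u" for y
  proof -
    have "s y * a $ w = y $ w - \<beta> y"
      using k by (simp add: a(1) s_def)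
    then show "q y $ w = \<beta> y"
      using b(3)[of w] assms by (simp add: q_def)
  qed (use a b assms in \<open>auto simp: q_def\<close>)
  have p_sum: "(\<Sum>u\<in>UNIV. p x $ u) = (\<Sum>u\<in>UNIV. x $ u)" for x
    using sum_a sum_b by (simp add: p_def sum.distrib sum_distrib_left[symmetric])
  have q_sum: "(\<Sum>u\<in>UNIV. q x $ u) = (\<Sum>u\<in>UNIV. x $ u)" for x
    using sum_a sum_b by (simp add: q_def sum_subtractf sum_distrib_left[symmetric])

  have p_into: "p x \<in> geometric_carrier ?B'" if x: "x \<in> geometric_carrier B" for x
  proof -
    have x': "\<And>u. 0 \<le> x $ u" "(\<Sum>u\<in>UNIV. x $ u) = 1" "support x \<in> B"
      using x carrier by auto
    have m0: "m x \<ge> 0" using m_in[of x] x' by auto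
    have nonneg: "0 \<le> p x $ u" for u
    proof -
      consider "u = v" | "u = w" | "u \<in> \<tau>" | "u \<noteq> v" "u \<noteq> w" "u \<notin> \<tau>" by blast
      then show ?thesis
      proof cases
        case 3
        have "0 \<le> x $ v / k" using x'(1)[of v] k by simp
        then show ?thesis using p_coord(3)[OF 3, of x] m_le[OF 3, of x] m0 by linarith
      qed (use p_coord x'(1) m0 k in auto)
    qed
    have "support (p x) \<in> ?B'"
    \<comment> \<open>Either neither correction acts and \<open>p\<close> fixes \<open>x\<close>, or
      \<open>x\<close> is in one of the two facets at \<open>\<tau>\<close>, and all of its weight
      goes to \<open>insert w \<tau>\<close>.\<close>
    proof (cases "x $ v = 0 \<and> m x = 0")
      case True
      then have "p x = x" by (simp add: p_def)
      then show ?thesis using x'(3) True by (simp add: support_def)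
    next
      case False
      have "support x \<subseteq> insert v \<tau> \<or> support x \<subseteq> insert w \<tau>"
      proof (cases "x $ v = 0")
        case True
        then show ?thesis using False m0 m_pos star_t x'(3) by (metis less_le)
      next
        case v: False
        then show ?thesis using star_v[OF x'(3)] by (simp add: support_def)
      qed
      then have supp: "x $ u = 0" if "u \<noteq> v" "u \<noteq> w" "u \<notin> \<tau>" for u
        using that by (auto simp: support_def)
      have "support (p x) \<subseteq> insert w \<tau>"
      proof
        fix u assume "u \<in> support (p x)"
        then show "u \<in> insert w \<tau>"
          using p_coord(1)[of x] p_coord(4)[of u x] supp[of u] by (auto simp: support_def)
      qed
      moreover have "v \<notin> support (p x)"
        using p_coord(1) by (simp add: support_def)
      ultimately show ?thesis using sub faces(2) by blast
    qed
    then show ?thesis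
      using nonneg p_sum x'(2) carrier by simp
  qed
  have q_p: "q (p x) = x" if x: "x \<in> geometric_carrier B" for x
  proof -
    have x': "\<And>u. 0 \<le> x $ u" "support x \<in> B"
      using x carrier by auto
    have "x $ v = 0 \<or> x $ w = 0"
      using star_v[OF x'(2)] assms by (auto simp: support_def)
    moreover have "m (p x) = m x + (x $ v / k - m x / 2)"
      using p_coord(3) by (rule m_shift)
    then have "k * m (p x) - p x $ w = x $ v - x $ w"
      using p_coord(2)[of x] k by (simp add: field_simps)
    ultimately have "\<alpha> (p x) = x $ v" "\<beta> (p x) = x $ w"
      using x'(1)[of v] x'(1)[of w] by (auto simp: \<alpha>_def \<beta>_def max_def)
    moreover from this have "s (p x) = m x"
      using p_coord(2)[of x] k by (simp add: s_def)
    ultimately show ?thesis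
      by (simp add: q_def p_def)
  qed
  have q_into: "q y \<in> geometric_carrier B" and p_q: "p (q y) = y" if y: "y \<in> geometric_carrier ?B'" for y
  proof -
    have y': "\<And>u. 0 \<le> y $ u" "(\<Sum>u\<in>UNIV. y $ u) = 1" "support y \<in> B" "y $ v = 0"
      using y carrier by (auto simp: support_def)
    have m0: "m y \<ge> 0" using m_in[of y] y' by auto
    have s: "s y \<ge> 0" "m y + (s y / 2 - \<alpha> y / k) = s y" "\<alpha> y = 0 \<or> \<beta> y = 0" "\<alpha> y \<ge> 0" "\<beta> y \<ge> 0"
      using k m0 y'(1)[of w] by (auto simp: s_def \<alpha>_def \<beta>_def max_def field_simps)
    have mq: "m (q y) = s y"
      using m_shift[OF q_coord(3)] s(2) by simp
    have nonneg: "0 \<le> q y $ u" for u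
    proof -
      consider "u = v" | "u = w" | "u \<in> \<tau>" | "u \<noteq> v" "u \<noteq> w" "u \<notin> \<tau>" by blast
      then show ?thesis
      proof cases
        case 3
        then show ?thesis using m_le[OF 3, of "q y"] mq s(1) by linarith
      qed (use q_coord y' s in auto)
    qed
    have "support (q y) \<in> B"
    proof (cases "m y = 0")
      case True
      then have "\<alpha> y = 0" "s y = 0"
        using y'(1)[of w] by (auto simp: \<alpha>_def \<beta>_def s_def)
      then have "q y = y" by (simp add: q_def)
      then show ?thesis using y' by simp
    next
      case False
      then have "\<tau> \<subseteq> support y" using m0 m_pos by simp
      then have "support y \<subseteq> insert w \<tau>"
        using star_t[OF y'(3)] y'(4) by (auto simp: support_def)
      then have "q y $ u = 0" if "u \<noteq> v" "u \<noteq> w" "u \<notin> \<tau>" for u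
        using that q_coord(4)[of u y] by (auto simp: support_def)
      moreover have "q y $ v = 0 \<or> q y $ w = 0"
        using s(3) y'(4) q_coord(1,2)[of y] by auto
      ultimately have "support (q y) \<subseteq> insert v \<tau> \<or> support (q y) \<subseteq> insert w \<tau>"
        unfolding support_def by fast
      then show ?thesis using sub faces by blast
    qed
    then show "q y \<in> geometric_carrier B"
      using nonneg q_sum y'(2) carrier by simp
    show "p (q y) = y"
      using mq q_coord(1)[of y] y'(4) by (simp add: p_def q_def)
  qed
  have "bij_betw p (geometric_carrier B) (geometric_carrier ?B')"
    by (rule bij_betw_byWitness[of _ q]) (use p_into q_into p_q q_p in auto)
  moreover have "pw_affine (geometric_carrier B) p"
  proof (rule pw_affineI)
    \<comment> \<open>\<open>p\<close> is affine as long as the minimum \<open>m\<close> is attained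
      at a fixed vertex \<open>u0\<close>; the regions where this happens are polyhedra.\<close>
    let ?H = "\<lambda>u0. \<Inter>u\<in>\<tau>. {x :: real ^ 'v. (axis u0 1 - axis u 1) \<bullet> x \<le> 0}"
    let ?P = "(\<lambda>(\<sigma>, u0). face_simplex \<sigma> \<inter> ?H u0) ` (B \<times> \<tau>)"
    have H: "x \<in> ?H u0 \<longleftrightarrow> (\<forall>u\<in>\<tau>. x $ u0 \<le> x $ u)" for x u0
      by (simp add: inner_diff_left inner_axis')
    show "finite ?P" using B by (simp add: abstract_complex_def)
    show "\<Union>?P = geometric_carrier B"
    proof (intro equalityI subsetI)
      fix x assume "x \<in> geometric_carrier B"
      then obtain \<sigma> where "\<sigma> \<in> B" "x \<in> face_simplex \<sigma>"
        unfolding geometric_carrier_def by blast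
      moreover obtain u0 where "u0 \<in> \<tau>" "x \<in> ?H u0"
        using m_in[of x] m_le[of _ x] H by metis
      ultimately show "x \<in> \<Union>?P" by blast
    qed (auto simp: geometric_carrier_def)
    fix P assume "P \<in> ?P"
    then obtain \<sigma> u0 where P: "\<sigma> \<in> B" "u0 \<in> \<tau>" "P = face_simplex \<sigma> \<inter> ?H u0" by auto
    have "polyhedron (?H u0)"
      by (intro polyhedron_Inter) (auto simp: polyhedron_halfspace_le)
    then show "polytope P"
      unfolding P(3) using polytope_face_simplex by (rule polytope_Int_polyhedron[rotated])
    show "affine_map_on P p"
    proof (rule affine_map_onI)
      show "linear (\<lambda>x. x + (x $ u0) *\<^sub>R a + (x $ v) *\<^sub>R b)"
        by (auto simp: linear_iff algebra_simps)
      fix x assume "x \<in> P"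
      then have "\<forall>u\<in>\<tau>. x $ u0 \<le> x $ u" using H P(3) by blast
      then have "m x = x $ u0"
        using m_le[OF P(2), of x] m_in[of x] by force
      then show "p x = x + (x $ u0) *\<^sub>R a + (x $ v) *\<^sub>R b + 0"
        by (simp add: p_def)
    qed
  qed
  ultimately show ?thesis
    unfolding pl_bij_def by blast
qed

section \<open>The facet at a vertex of degree \<open>d\<close> and its neighbour\<close>

context ball_chart
begin

lemma obtain_insert:
  fixes \<tau> \<rho> :: "'v set"
  assumes "card \<tau> = d" "card \<rho> = d + 1" "\<tau> \<subseteq> \<rho>"
  obtains a where "a \<notin> \<tau>" "\<rho> = insert a \<tau>"
proof -
  have "card (\<rho> - \<tau>) = 1"
    using assms card_Diff_subset[OF finite[of \<tau>] assms(3)] by simp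
  then obtain a where "\<rho> - \<tau> = {a}"
    using card_1_singletonE by blast
  then show ?thesis
    using assms(3) by (intro that[of a]) auto
qed

text \<open>A facet through \<open>v\<close> has \<open>d\<close> further vertices and so accounts
  for all edges at \<open>v\<close>. Every vertex of a face at \<open>v\<close> is \<open>v\<close>
  or the other end of such an edge.\<close>

lemma star_of_low_degree_vertex:
  assumes "v \<in> vertices B" "vertex_degree B v = d"
  obtains \<tau> where "v \<notin> \<tau>" "card \<tau> = d" "insert v \<tau> \<in> B" "\<And>\<rho>. \<rho> \<in> B \<Longrightarrow> v \<in> \<rho> \<Longrightarrow> \<rho> \<subseteq> insert v \<tau>"
proof -
  obtain \<rho>0 where "\<rho>0 \<in> B" "v \<in> \<rho>0"
    using assms(1) by (auto simp: vertices_def)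
  then obtain \<sigma> where s: "\<sigma> \<in> B" "card \<sigma> = d + 1" "v \<in> \<sigma>"
    using face_in_facet by blast
  let ?E = "{e \<in> B. card e = 2 \<and> v \<in> e}"
  let ?F = "(\<lambda>u. {v, u}) ` (\<sigma> - {v})"
  have "inj_on (\<lambda>u. {v, u}) (\<sigma> - {v})"
    by (auto simp: inj_on_def doubleton_eq_iff)
  then have "card ?F = d"
    using s by (simp add: card_image)
  moreover have "card ?E = d"
    using assms(2) by (simp add: vertex_degree_def)
  moreover have sub: "?F \<subseteq> ?E"
    using s subset_face[OF s(1)] by auto
  ultimately have eq: "?F = ?E"
    by (intro card_subset_eq) auto
  have "\<rho> \<subseteq> \<sigma>" if r: "\<rho> \<in> B" "v \<in> \<rho>" for \<rho>
  proof
    fix u assume u: "u \<in> \<rho>"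
    show "u \<in> \<sigma>"
    proof (cases "u = v")
      case False
      then have "{v, u} \<in> ?E"
        using u r subset_face[OF r(1), of "{v, u}"] by simp
      then have "{v, u} \<in> ?F" using eq by simp
      then show ?thesis by (auto simp: doubleton_eq_iff)
    qed (use s in simp)
  qed
  moreover have "insert v (\<sigma> - {v}) = \<sigma>" using s by blast
  ultimately show ?thesis
    using s by (intro that[of "\<sigma> - {v}"]) auto
qed

text \<open>Otherwise the facet would disconnect the interior of the ball.\<close>

lemma facet_with_boundary_in_boundary:
  assumes \<sigma>: "\<sigma> \<in> B" "card \<sigma> = d + 1" and bd: "\<And>s. s \<subset> \<sigma> \<Longrightarrow> s \<in> boundary_complex d B"
  shows "vertices B \<subseteq> \<sigma>"
proof (rule ccontr)
  assume "\<not> vertices B \<subseteq> \<sigma>"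
  then obtain u \<rho>0 where "\<rho>0 \<in> B" "u \<in> \<rho>0" "u \<notin> \<sigma>"
    unfolding vertices_def by blast
  then obtain \<rho> where r: "\<rho> \<in> B" "card \<rho> = d + 1" "u \<in> \<rho>" "\<rho> \<noteq> \<sigma>"
    using face_in_facet[of \<rho>0] by blast
  \<comment> \<open>No face properly contains \<open>\<sigma>\<close>, so the rest is still a
    complex. The images of \<open>\<sigma>\<close> and of the rest are closed and share only points
    of proper faces of \<open>\<sigma>\<close>, which go to the frontier; both reach the interior of
    \<open>T\<close>, which is connected.\<close>
  define B' where "B' = {s \<in> B. s \<noteq> \<sigma>}"
  have B': "abstract_complex B'"
    unfolding abstract_complex_def
  proof (intro conjI ballI allI impI)
    show "finite B'" "\<And>s. s \<in> B' \<Longrightarrow> finite s"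
      using complex by (auto simp: B'_def abstract_complex_def)
    show "t \<in> B'" if "s \<in> B'" "t \<subseteq> s" for s t
    proof -
      have "t \<noteq> \<sigma>"
        using that card_face_le[of s] \<sigma>(2) card_seteq[of s \<sigma>] by (auto simp: B'_def)
      then show ?thesis
        using that subset_face[of s t] by (simp add: B'_def)
    qed
  qed
  note carrier' = mem_geometric_carrier[OF B']
  have front: "f x \<notin> rel_interior T" if x: "x \<in> geometric_carrier B" "support x \<subset> \<sigma>" for x
  proof -
    have "x \<in> geometric_carrier (boundary_complex d B)"
      using x(1) bd[OF x(2)]
      by (simp add: mem_carrier mem_geometric_carrier[OF abstract_complex_boundary[OF complex]])
    then show ?thesis
      using boundary_image by (force simp: rel_frontier_def)
  qed
  let ?A1 = "f ` face_simplex \<sigma>" and ?A2 = "f ` geometric_carrier B'"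
  have s1: "face_simplex \<sigma> \<subseteq> geometric_carrier B"
    using face_simplex_subset_carrier \<sigma>(1) by blast
  have s2: "geometric_carrier B' \<subseteq> geometric_carrier B"
    unfolding geometric_carrier_def B'_def by blast
  have "closed ?A1" "closed ?A2"
    using compact_continuous_image[OF continuous_on_subset[OF cont_f s1]]
      compact_continuous_image[OF continuous_on_subset[OF cont_f s2]]
      polytope_imp_compact[OF polytope_face_simplex, of \<sigma>] compact_geometric_carrier[of B']
      compact_imp_closed by blast+
  moreover have "connected (rel_interior T)"
    using convex_T convex_rel_interior convex_connected by blast
  moreover have "rel_interior T \<subseteq> ?A1 \<union> ?A2"
  proof
    fix y assume "y \<in> rel_interior T"
    then have y: "y \<in> T" using rel_interior_subset by blast
    have gy: "g y \<in> geometric_carrier B" using g_in[OF y] .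
    show "y \<in> ?A1 \<union> ?A2"
    proof (cases "support (g y) = \<sigma>")
      case True
      then have "g y \<in> face_simplex \<sigma>"
        using gy unfolding mem_face_simplex mem_carrier by simp
      then show ?thesis using f_g[OF y] by force
    next
      case False
      then have "g y \<in> geometric_carrier B'"
        using gy unfolding carrier' mem_carrier by (simp add: B'_def)
      then show ?thesis using f_g[OF y] by force
    qed
  qed
  moreover have "?A1 \<inter> ?A2 \<inter> rel_interior T = {}"
  proof -
    have False if x: "x \<in> face_simplex \<sigma>" and z: "z \<in> geometric_carrier B'"
      and eq: "f x = f z" and fz: "f z \<in> rel_interior T" for x z
    proof -
      have "x = z"
        using inj_onD[OF inj_f eq] s1 s2 x z by blast
      moreover have "support z \<noteq> \<sigma>"
        using z unfolding carrier' by (simp add: B'_def)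
      ultimately have "support x \<subset> \<sigma>"
        using x unfolding mem_face_simplex by blast
      moreover have "x \<in> geometric_carrier B" using s1 x by blast
      ultimately show False using front[of x] eq fz by metis
    qed
    then show ?thesis by auto
  qed
  ultimately have "?A1 \<inter> rel_interior T = {} \<or> ?A2 \<inter> rel_interior T = {}"
    by (intro connected_closedD) auto
  moreover have "?A1 \<inter> rel_interior T \<noteq> {}"
  proof -
    have "\<sigma> \<noteq> {}" using \<sigma>(2) by auto
    then obtain x where x: "x \<in> geometric_carrier B" "support x = \<sigma>"
      using obtain_point_with_support[OF \<sigma>(1)] by blast
    then have "x \<in> face_simplex \<sigma>"
      unfolding mem_face_simplex mem_carrier by blast
    then show ?thesis using facet_interior[OF x(1)] x(2) \<sigma>(2) by auto
  qed
  moreover have "?A2 \<inter> rel_interior T \<noteq> {}"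
  proof -
    have "\<rho> \<noteq> {}" using r(3) by blast
    then obtain x where x: "x \<in> geometric_carrier B" "support x = \<rho>"
      using obtain_point_with_support[OF r(1)] by blast
    then have "x \<in> geometric_carrier B'"
      using r(1,4) unfolding carrier' mem_carrier by (simp add: B'_def)
    then show ?thesis using facet_interior[OF x(1)] x(2) r(2) by auto
  qed
  ultimately show False by blast
qed

lemma boundary_complexI:
  assumes "\<tau> \<in> B" "card \<tau> = d" "s \<subseteq> \<tau>" "\<sigma> \<in> B" "card \<sigma> = d + 1" "\<tau> \<subseteq> \<sigma>"
    "\<And>\<rho>. \<rho> \<in> B \<Longrightarrow> card \<rho> = d + 1 \<Longrightarrow> \<tau> \<subseteq> \<rho> \<Longrightarrow> \<rho> = \<sigma>"
  shows "s \<in> boundary_complex d B"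
proof -
  have "\<exists>!\<sigma>. \<sigma> \<in> B \<and> card \<sigma> = d + 1 \<and> \<tau> \<subseteq> \<sigma>"
  proof (rule ex1I[of _ \<sigma>])
    show "\<sigma> \<in> B \<and> card \<sigma> = d + 1 \<and> \<tau> \<subseteq> \<sigma>"
      using assms(4-6) by (intro conjI)
    show "\<rho> = \<sigma>" if "\<rho> \<in> B \<and> card \<rho> = d + 1 \<and> \<tau> \<subseteq> \<rho>" for \<rho>
      using that by (elim conjE) (rule assms(7))
  qed
  then show ?thesis
    unfolding boundary_complex_def mem_Collect_eq using assms(1-3) by (intro bexI[of _ \<tau>] conjI)
qed

text \<open>The other ridges of the facet contain \<open>v\<close> and so lie in no second facet. If
  \<open>\<tau>\<close> did not either, the whole boundary of the facet would belong to the boundary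
  of the ball; all vertices would then be in the facet, which has only \<open>d + 1\<close>.\<close>

lemma second_facet_at_opposite_ridge:
  assumes v: "v \<notin> \<tau>" "card \<tau> = d" "insert v \<tau> \<in> B"
    and star: "\<And>\<rho>. \<rho> \<in> B \<Longrightarrow> v \<in> \<rho> \<Longrightarrow> \<rho> \<subseteq> insert v \<tau>"
    and verts: "d + 2 \<le> card (vertices B)"
  obtains w where "w \<notin> \<tau>" "w \<noteq> v" "insert w \<tau> \<in> B"
proof -
  let ?\<sigma> = "insert v \<tau>"
  have card: "card ?\<sigma> = d + 1" using v by simp
  have "\<exists>\<rho>. \<rho> \<in> B \<and> card \<rho> = d + 1 \<and> \<tau> \<subseteq> \<rho> \<and> \<rho> \<noteq> ?\<sigma>"
  proof (rule ccontr)
    assume none: "\<nexists>\<rho>. \<rho> \<in> B \<and> card \<rho> = d + 1 \<and> \<tau> \<subseteq> \<rho> \<and> \<rho> \<noteq> ?\<sigma>"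
    have "s \<in> boundary_complex d B" if "s \<subset> ?\<sigma>" for s
    proof -
      obtain c where c: "c \<in> ?\<sigma>" "c \<notin> s" using \<open>s \<subset> ?\<sigma>\<close> by blast
      let ?\<eta> = "?\<sigma> - {c}"
      have "\<rho> = ?\<sigma>" if r: "\<rho> \<in> B" "card \<rho> = d + 1" "?\<eta> \<subseteq> \<rho>" for \<rho>
      proof (cases "v \<in> \<rho>")
        case True
        then show ?thesis
          using card_subset_eq[OF finite star[OF r(1) True]] r(2) card by simp
      next
        case False
        then have "c = v" using r(3) by blast
        then have "?\<eta> = \<tau>" using v(1) by blast
        then show ?thesis using none r by blast
      qed
      moreover have "?\<eta> \<in> B" by (rule subset_face[OF v(3) Diff_subset])
      moreover have "card ?\<eta> = d" using c card by simp
      ultimately show ?thesis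
        using \<open>s \<subset> ?\<sigma>\<close> c v(3) card by (intro boundary_complexI[of ?\<eta> s ?\<sigma>]) auto
    qed
    then have "vertices B \<subseteq> ?\<sigma>"
      using facet_with_boundary_in_boundary v(3) card by blast
    then have "card (vertices B) \<le> card ?\<sigma>"
      by (intro card_mono) auto
    then show False
      using verts card by simp
  qed
  then obtain \<rho> where "\<rho> \<in> B" "card \<rho> = d + 1" "\<tau> \<subseteq> \<rho>" "\<rho> \<noteq> ?\<sigma>" by blast
  then show ?thesis
    using obtain_insert[OF v(2)] that by metis
qed

end

section \<open>Cones over complexes, and the sphere in case (a)\<close>

definition cone_complex :: "'v \<Rightarrow> 'v set set \<Rightarrow> 'v set set" where
  "cone_complex v X = {s. s - {v} \<in> X}"

lemma abstract_complex_cone: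
  assumes "abstract_complex X"
  shows "abstract_complex (cone_complex v X)"
  unfolding abstract_complex_def
proof (intro conjI ballI allI impI)
  have "cone_complex v X \<subseteq> X \<union> insert v ` X"
  proof
    fix s assume "s \<in> cone_complex v X"
    then have "s - {v} \<in> X" by (simp add: cone_complex_def)
    moreover have "s = s - {v} \<or> s = insert v (s - {v})" by blast
    ultimately show "s \<in> X \<union> insert v ` X" by (metis UnCI image_eqI)
  qed
  moreover have "finite X" using assms by (simp add: abstract_complex_def)
  ultimately show "finite (cone_complex v X)"
    using finite_subset by blast
  show "finite \<sigma>" if "\<sigma> \<in> cone_complex v X" for \<sigma>
    using that assms unfolding cone_complex_def abstract_complex_def
    by (metis finite_Diff_insert finite.emptyI finite_Diff2 finite_insert mem_Collect_eq)
  show "\<tau> \<in> cone_complex v X" if "\<sigma> \<in> cone_complex v X" "\<tau> \<subseteq> \<sigma>" for \<sigma> \<tau>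
  proof -
    have "\<tau> - {v} \<subseteq> \<sigma> - {v}" using that(2) by blast
    then show ?thesis
      using that(1) assms unfolding cone_complex_def abstract_complex_def by simp
  qed
qed

text \<open>The coordinate at \<open>v\<close> is the weight \<open>1 - t\<close> of the apex, and
  the other coordinates divided by \<open>t\<close> give the point of the base. A nonempty base is
  what puts the apex itself into \<open>cone_over\<close>.\<close>

lemma geometric_carrier_cone_complex:
  fixes X :: "'v::finite set set"
  assumes X: "abstract_complex X" and v: "\<And>s. s \<in> X \<Longrightarrow> v \<notin> s" and ne: "geometric_carrier X \<noteq> {}"
  shows "geometric_carrier (cone_complex v X) = cone_over (axis v 1) (geometric_carrier X)"
proof (intro equalityI subsetI)
  note carrier = mem_geometric_carrier[OF abstract_complex_cone[OF X]] mem_geometric_carrier[OF X]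
  fix x assume "x \<in> geometric_carrier (cone_complex v X)"
  then have x: "\<And>u. 0 \<le> x $ u" "(\<Sum>u\<in>UNIV. x $ u) = 1" "support x - {v} \<in> X"
    unfolding carrier by (auto simp: cone_complex_def)
  define t where "t = 1 - x $ v"
  have sum: "(\<Sum>u\<in>UNIV - {v}. x $ u) = t"
    using x(2) by (simp add: t_def sum_diff1)
  then have t0: "0 \<le> t" using x(1) by (metis sum_nonneg)
  have t1: "t \<le> 1" using x(1) by (simp add: t_def)
  show "x \<in> cone_over (axis v 1) (geometric_carrier X)"
  proof (cases "t = 0")
    case True
    have "x $ u = 0" if "u \<noteq> v" for u
      using sum True x(1) that by (simp add: sum_nonneg_eq_0_iff)
    then have "x = axis v 1"
      using True by (auto simp: vec_eq_iff axis_def t_def)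
    moreover obtain y where "y \<in> geometric_carrier X" using ne by blast
    ultimately show ?thesis
      using cone_overI[of 0 y "geometric_carrier X" "axis v 1"] by simp
  next
    case False
    then have t: "t > 0" using t0 by simp
    define y where "y = (1 / t) *\<^sub>R (x - (x $ v) *\<^sub>R axis v 1)"
    have yv: "y $ u = (if u = v then 0 else x $ u / t)" for u
      by (simp add: y_def axis_def)
    have "(\<Sum>u\<in>UNIV. y $ u) = (\<Sum>u\<in>UNIV - {v}. x $ u / t)"
      unfolding yv by (intro sum.mono_neutral_cong_right) auto
    also have "\<dots> = 1"
      using sum t by (simp add: sum_divide_distrib[symmetric])
    finally have "(\<Sum>u\<in>UNIV. y $ u) = 1" .
    moreover have "support y = support x - {v}"
      using t by (auto simp: support_def yv)
    moreover have "0 \<le> y $ u" for u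
      using x(1) t by (simp add: yv)
    ultimately have "y \<in> geometric_carrier X"
      using x(3) unfolding carrier by simp
    moreover have "x = (1 - t) *\<^sub>R axis v 1 + t *\<^sub>R y"
      using t by (simp add: y_def t_def)
    ultimately show ?thesis
      using cone_overI t0 t1 by metis
  qed
next
  note carrier = mem_geometric_carrier[OF abstract_complex_cone[OF X]] mem_geometric_carrier[OF X]
  fix x assume "x \<in> cone_over (axis v 1) (geometric_carrier X)"
  then obtain t y where *: "0 \<le> t" "t \<le> 1" "y \<in> geometric_carrier X" "x = (1 - t) *\<^sub>R axis v 1 + t *\<^sub>R y"
    by (rule cone_overE)
  then have y: "\<And>u. 0 \<le> y $ u" "(\<Sum>u\<in>UNIV. y $ u) = 1" "support y \<in> X"
    unfolding carrier by auto
  have xv: "x $ u = (if u = v then 1 - t else 0) + t * y $ u" for u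
    unfolding * by (simp add: axis_def)
  have "(\<Sum>u\<in>UNIV. x $ u) = 1"
    unfolding xv using y(2) by (simp add: sum.distrib sum_distrib_left[symmetric])
  moreover have "0 \<le> x $ u" for u
    unfolding xv using * y(1) by simp
  moreover have "support x - {v} \<subseteq> support y"
    by (auto simp: support_def xv)
  then have "support x - {v} \<in> X"
    using y(3) X by (simp add: abstract_complex_def)
  ultimately show "x \<in> geometric_carrier (cone_complex v X)"
    unfolding carrier by (simp add: cone_complex_def)
qed

context ball_chart
begin

text \<open>A convex compact set with empty relative frontier is affine and bounded, hence at most a
  point, whereas \<open>d\<close> is positive.\<close>

lemma boundary_carrier_nonempty: "geometric_carrier (boundary_complex d B) \<noteq> {}"
proof
  assume "geometric_carrier (boundary_complex d B) = {}"
  then have "rel_frontier T = {}" using boundary_image by simp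
  then have "affine T"
    using rel_frontier_eq_empty[of T] by (simp add: affine_hull_eq)
  then have "T = {} \<or> (\<exists>a. T = {a})"
    using compact_imp_bounded[OF compact_T] affine_bounded_eq_trivial by blast
  then have "aff_dim T \<le> 0" by auto
  then show False using aff_dim_T dim by simp
qed

text \<open>The carrier of the cone complex is literally a cone, so the identity serves as its
  chart. The base has \<open>v\<close>-coordinate 0, and the point with parameter \<open>r\<close>
  on a ray from the apex through the base has \<open>v\<close>-coordinate \<open>1 - r\<close>; so
  the ray meets the base only at \<open>r = 1\<close>.\<close>

lemma sphere_of_boundary_cone:
  assumes "d < CARD('v)" "v \<notin> vertices B"
  shows "combinatorial_sphere d (B \<union> cone_complex v (boundary_complex d B))"
proof -
  let ?E = "boundary_complex d B"
  have E: "abstract_complex ?E" by (rule abstract_complex_boundary[OF complex])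
  have vB: "v \<notin> s" if "s \<in> B" for s
    using assms(2) that by (auto simp: vertices_def)
  then have vE: "v \<notin> s" if "s \<in> ?E" for s
    using boundary_complex_subset[OF complex] that by blast
  have Int: "B \<inter> cone_complex v ?E = ?E"
    using boundary_complex_subset[OF complex, of d] vB vE by (force simp: cone_complex_def)
  have car: "geometric_carrier (cone_complex v ?E) = cone_over (axis v 1) (geometric_carrier ?E)"
    using geometric_carrier_cone_complex[OF E vE boundary_carrier_nonempty] .
  show ?thesis
  proof (rule combinatorial_sphere_Un_cone[OF complex abstract_complex_cone[OF E] dim assms(1) simplex chart])
    show "f ` geometric_carrier (B \<inter> cone_complex v ?E) = rel_frontier T"
      using boundary_image Int by simp
    show "pl_bij (geometric_carrier (cone_complex v ?E)) (cone_over (axis v 1) (geometric_carrier ?E)) (\<lambda>x. x)"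
      using polytopal_geometric_carrier[of "cone_complex v ?E"] car by (simp add: pl_bij_def bij_betw_def)
    show "(\<lambda>x. x) ` geometric_carrier (B \<inter> cone_complex v ?E) = geometric_carrier ?E"
      using Int by simp
    have "y $ v = 0" if "y \<in> geometric_carrier ?E" for y
      using that vE unfolding mem_geometric_carrier[OF E] support_def by blast
    then have zero: "y \<in> geometric_carrier ?E \<Longrightarrow> y $ v = 0" for y .
    show "visible_from (axis v 1) (geometric_carrier ?E)"
      unfolding visible_from_def
    proof (intro conjI ballI allI impI)
      show "axis v 1 \<notin> geometric_carrier ?E"
        using zero[of "axis v 1"] by auto
      fix y r assume "y \<in> geometric_carrier ?E" "axis v 1 + r *\<^sub>R (y - axis v 1) \<in> geometric_carrier ?E"
      then show "r = 1" using zero[of y] zero[of "axis v 1 + r *\<^sub>R (y - axis v 1)"] by simp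
    qed
  qed
qed

lemma sphere_of_low_degree_vertex:
  assumes v: "v \<in> vertices B" "vertex_degree B v = d" and n: "d + 2 \<le> card (vertices B)"
  shows "\<exists>S. combinatorial_sphere d S \<and> B \<subseteq> S \<and> vertices S = vertices B"
proof -
  obtain \<tau> where t: "v \<notin> \<tau>" "card \<tau> = d" "insert v \<tau> \<in> B"
    and star_v: "\<And>\<rho>. \<rho> \<in> B \<Longrightarrow> v \<in> \<rho> \<Longrightarrow> \<rho> \<subseteq> insert v \<tau>"
    using star_of_low_degree_vertex[OF v] by metis
  obtain w where w: "w \<notin> \<tau>" "w \<noteq> v" "insert w \<tau> \<in> B"
    using second_facet_at_opposite_ridge[OF t star_v n] by metis
  have tne: "\<tau> \<noteq> {}" using t(2) dim by auto
  have facet_t: "\<rho> = insert v \<tau> \<or> \<rho> = insert w \<tau>" if r: "\<rho> \<in> B" "card \<rho> = d + 1" "\<tau> \<subseteq> \<rho>" for \<rho>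
  proof -
    obtain a where a: "a \<notin> \<tau>" "\<rho> = insert a \<tau>"
      using obtain_insert[OF t(2) r(2,3)] by blast
    then have "a = v \<or> a = w"
      using ridge_in_at_most_two_facets[of v \<tau> w a] t w r(1) by blast
    then show ?thesis using a by blast
  qed
  have star_t: "\<rho> \<subseteq> insert v \<tau> \<or> \<rho> \<subseteq> insert w \<tau>" if r: "\<rho> \<in> B" "\<tau> \<subseteq> \<rho>" for \<rho>
  proof -
    obtain \<sigma> where "\<sigma> \<in> B" "card \<sigma> = d + 1" "\<rho> \<subseteq> \<sigma>"
      using face_in_facet[OF r(1)] by blast
    then show ?thesis using facet_t r(2) by (metis subset_trans)
  qed
  let ?B' = "{s \<in> B. v \<notin> s}"
  obtain p where p: "pl_bij (geometric_carrier B) (geometric_carrier ?B') p"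
    using pl_bij_push_facet[OF complex t(3) w(3) t(1) w(1) w(2)[symmetric] tne star_v star_t] by blast
  \<comment> \<open>Deleting \<open>v\<close> leaves a ball with the same model simplex: its chart
    undoes the push and then applies \<open>f\<close>.\<close>
  interpret B': ball_chart ?B' d T "f \<circ> inv_into (geometric_carrier B) p"
    using abstract_complex_deletion[OF complex] simplex dim pl_bij_compose[OF pl_bij_inverse[OF p] chart]
    by unfold_locales
  let ?S = "?B' \<union> cone_complex v (boundary_complex d ?B')"
  have "card (vertices B) \<le> CARD('v)"
    by (rule card_mono) auto
  then have "combinatorial_sphere d ?S"
    using n by (intro B'.sphere_of_boundary_cone) (auto simp: vertices_def)
  \<comment> \<open>With the facet at \<open>v\<close> gone, \<open>insert w \<tau>\<close> is the
    only facet at \<open>\<tau>\<close>. So the cone contains \<open>insert v \<tau>\<close>, and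
    with it all faces of \<open>B\<close> at \<open>v\<close>.\<close>
  moreover have tb: "\<tau> \<in> boundary_complex d ?B'"
  proof (rule B'.boundary_complexI[of \<tau> \<tau> "insert w \<tau>"])
    show "\<tau> \<in> {s \<in> B. v \<notin> s}" using t subset_face[OF t(3), of \<tau>] by blast
    show "insert w \<tau> \<in> {s \<in> B. v \<notin> s}" "card (insert w \<tau>) = d + 1" using w t by auto
    show "\<rho> = insert w \<tau>" if "\<rho> \<in> {s \<in> B. v \<notin> s}" "card \<rho> = d + 1" "\<tau> \<subseteq> \<rho>" for \<rho>
      using that facet_t by blast
  qed (use t in auto)
  have BS: "B \<subseteq> ?S"
  proof
    fix s assume s: "s \<in> B"
    show "s \<in> ?S"
    proof (cases "v \<in> s")
      case True
      then have "s - {v} \<subseteq> \<tau>" using star_v[OF s] by blast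
      then have "s - {v} \<in> boundary_complex d ?B'"
        using tb abstract_complex_boundary[OF B'.complex, of d] by (simp add: abstract_complex_def)
      then show ?thesis by (simp add: cone_complex_def)
    qed (use s in simp)
  qed
  moreover have "vertices ?S = vertices B"
  proof
    show "vertices B \<subseteq> vertices ?S" using BS by (auto simp: vertices_def)
    have "u \<in> vertices B" if "u \<in> s" "s - {v} \<in> boundary_complex d ?B'" for u s
    proof (cases "u = v")
      case False
      have "s - {v} \<in> B"
        using that(2) boundary_complex_subset[OF B'.complex] by blast
      then show ?thesis using that(1) False unfolding vertices_def by blast
    qed (use v in simp)
    then show "vertices ?S \<subseteq> vertices B"
      by (auto simp: vertices_def cone_complex_def)
  qed
  ultimately show ?thesis by blast
qed

end

section \<open>Chords of a disc\<close>

lemma cis_inj_period: "cis a = cis b \<Longrightarrow> \<bar>a - b\<bar> < 2 * pi \<Longrightarrow> a = b"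
  using exp_complex_eqI[of "\<i> * of_real a" "\<i> * of_real b"] by (simp add: cis_conv_exp)

lemma unit_circle_param:
  assumes "norm z = 1"
  obtains t where "\<alpha> \<le> t" "t < \<alpha> + 2 * pi" "z = cis t"
proof
  let ?t = "\<alpha> + Arg2pi (z / cis \<alpha>)"
  show "\<alpha> \<le> ?t" "?t < \<alpha> + 2 * pi"
    using Arg2pi[of "z / cis \<alpha>"] by auto
  have "norm (z / cis \<alpha>) = 1"
    using assms by (simp add: norm_divide)
  then have "cis (Arg2pi (z / cis \<alpha>)) = z / cis \<alpha>"
    using complex_norm_eq_1_exp by (simp add: cis_conv_exp)
  then show "z = cis ?t"
    by (simp add: cis_mult[symmetric])
qed

lemma arc_cis_linepath:
  assumes "a \<noteq> b" "\<bar>b - a\<bar> < 2 * pi"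
  shows "arc (cis \<circ> linepath a b)"
proof -
  have "inj_on cis (closed_segment a b)"
  proof (rule inj_onI)
    fix x y assume "x \<in> closed_segment a b" "y \<in> closed_segment a b" "cis x = cis y"
    moreover from this have "\<bar>x - y\<bar> < 2 * pi"
      using assms(2) by (auto simp: closed_segment_eq_real_ivl split: if_splits)
    ultimately show "x = y"
      using cis_inj_period by blast
  qed
  moreover have "continuous_on S cis" for S
    unfolding cis_conv_exp by (intro continuous_intros)
  moreover have "arc (linepath a b)"
    using assms(1) by simp
  ultimately show ?thesis
    unfolding arc_def path_def using comp_inj_on[of "linepath a b" "{0..1}" cis]
      continuous_on_compose[of "{0..1}" "linepath a b" cis]
    by (simp add: linepath_image_01)
qed

text \<open>The first chord separates the disc into two regions, each of which has only one of the two
  boundary arcs in its closure.\<close>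

lemma interlaced_chords_meet:
  assumes p: "arc p" "pathstart p = cis \<alpha>" "pathfinish p = cis \<beta>" "p ` {0<..<1} \<subseteq> ball 0 1"
    and q: "arc q" "pathstart q = cis \<kappa>" "pathfinish q = cis l" "q ` {0<..<1} \<subseteq> ball 0 1"
    and order: "\<alpha> < \<kappa>" "\<kappa> < \<beta>" "\<beta> < l" "l < \<alpha> + 2 * pi"
  shows "path_image p \<inter> path_image q \<noteq> {}"
proof
  assume disj: "path_image p \<inter> path_image q = {}"
  let ?a = "cis \<alpha>" and ?b = "cis \<beta>"
  define c1 where "c1 = cis \<circ> linepath \<alpha> \<beta>"
  \<comment> \<open>Starting a full turn later, this arc also leads from \<open>?a\<close> to
    \<open>?b\<close>, but along the other side of the circle.\<close>
  define c2 where "c2 = cis \<circ> linepath (\<alpha> + 2 * pi) \<beta>"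
  have period: "cis (\<alpha> + 2 * pi) = cis \<alpha>"
    by (simp add: cis_mult[symmetric])
  have arcs: "simple_path c1" "simple_path c2"
    unfolding c1_def c2_def using order by (auto intro!: arc_imp_simple_path arc_cis_linepath)
  have ends: "pathstart c1 = ?a" "pathfinish c1 = ?b" "pathstart c2 = ?a" "pathfinish c2 = ?b"
    using period by (auto simp: c1_def c2_def pathstart_def pathfinish_def linepath_def)
  have img: "path_image c1 = cis ` {\<alpha>..\<beta>}" "path_image c2 = cis ` {\<beta>..\<alpha> + 2 * pi}"
    using order by (auto simp: c1_def c2_def path_image_compose closed_segment_eq_real_ivl)
  have Un: "path_image c1 \<union> path_image c2 = sphere 0 1"
  proof (intro equalityI subsetI)
    fix z :: complex assume "z \<in> sphere 0 1"
    then obtain t where "\<alpha> \<le> t" "t < \<alpha> + 2 * pi" "z = cis t"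
      using unit_circle_param[of z \<alpha>] by auto
    then show "z \<in> path_image c1 \<union> path_image c2"
      unfolding img by (cases "t \<le> \<beta>") auto
  qed (auto simp: img)
  have path_img: "path_image r = {pathstart r, pathfinish r} \<union> r ` {0<..<1}" for r :: "real \<Rightarrow> complex"
  proof -
    have "{0..1} = {0, 1} \<union> {0<..<1::real}" by auto
    then show ?thesis
      unfolding path_image_def pathstart_def pathfinish_def by (metis image_Un image_empty image_insert)
  qed
  have c12: "path_image c1 \<inter> path_image c2 = {?a, ?b}"
  proof (intro equalityI subsetI)
    fix z assume "z \<in> path_image c1 \<inter> path_image c2"
    then obtain s t where st: "s \<in> {\<alpha>..\<beta>}" "t \<in> {\<beta>..\<alpha> + 2 * pi}" "z = cis s" "cis s = cis t"
      unfolding img by auto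
    show "z \<in> {?a, ?b}"
    proof (cases "s = \<alpha>")
      case False
      then have "s = t" using st by (intro cis_inj_period) auto
      then have "s = \<beta>" using st by auto
      then show ?thesis using st by simp
    qed (use st in simp)
  next
    fix z assume "z \<in> {?a, ?b}"
    then show "z \<in> path_image c1 \<inter> path_image c2"
      using ends pathstart_in_path_image pathfinish_in_path_image by (metis IntI insertE singletonD)
  qed
  have sphere_p: "z = ?a \<or> z = ?b" if "z \<in> path_image p" "z \<in> sphere 0 1" for z
    using that p(4) unfolding path_img[of p] p(2,3) by (auto simp: subset_iff)
  have c1p: "path_image c1 \<inter> path_image p = {?a, ?b}" and c2p: "path_image c2 \<inter> path_image p = {?a, ?b}"
  proof -
    have ends_p: "?a \<in> path_image p" "?b \<in> path_image p"
      unfolding path_img[of p] p(2,3) by auto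
    have *: "C \<inter> path_image p = {?a, ?b}" if "C \<subseteq> sphere 0 1" "?a \<in> C" "?b \<in> C" for C
    proof (intro equalityI subsetI)
      fix z assume "z \<in> C \<inter> path_image p"
      then show "z \<in> {?a, ?b}" using that(1) sphere_p[of z] by blast
    qed (use that ends_p in auto)
    show "path_image c1 \<inter> path_image p = {?a, ?b}" "path_image c2 \<inter> path_image p = {?a, ?b}"
      using c12 Un by (intro *; blast)+
  qed
  have inside: "inside (path_image c1 \<union> path_image c2) = ball 0 1"
    unfolding Un using inside_frontier_eq_interior[of "cball (0::complex) 1"] by simp
  have "p (1/2) \<in> path_image p \<inter> inside (path_image c1 \<union> path_image c2)"
    unfolding inside path_img[of p] using p(4) by (intro IntI UnI2 subsetD[OF p(4)] imageI) auto
  then have ne: "path_image p \<inter> inside (path_image c1 \<union> path_image c2) \<noteq> {}"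
    by blast
  have ab: "?a \<noteq> ?b"
    using cis_inj_period[of \<alpha> \<beta>] order by auto
  let ?I1 = "inside (path_image c1 \<union> path_image p)" and ?I2 = "inside (path_image c2 \<union> path_image p)"
  \<comment> \<open>The two circular arcs and \<open>p\<close> form a theta curve whose outer circle
    bounds the disc, so \<open>p\<close> splits the disc into two regions.\<close>
  have I: "?I1 \<inter> ?I2 = {}" "?I1 \<union> ?I2 \<union> (path_image p - {?a, ?b}) = ball 0 1"
    using split_inside_simple_closed_curve[OF arcs(1) ends(1,2) arcs(2) ends(3,4)
        arc_imp_simple_path[OF p(1)] p(2,3) ab c12 c1p c2p ne] unfolding inside by metis+
  have closed: "closed (path_image c1 \<union> path_image p)" "closed (path_image c2 \<union> path_image p)"
    using simple_path_imp_path[OF arcs(1)] simple_path_imp_path[OF arcs(2)] arc_imp_path[OF p(1)]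
    by (simp_all add: closed_Un closed_path_image)
  define J where "J = q ` {0<..<1}"
  have contq: "continuous_on {0..1} q"
    using q(1) by (simp add: arc_def path_def)
  then have "connected J"
    unfolding J_def by (intro connected_continuous_image) (auto intro: continuous_on_subset)
  moreover have "J \<subseteq> ?I1 \<union> ?I2"
    using q(4) disj I(2) path_img[of q] unfolding J_def by blast
  ultimately have "J \<subseteq> ?I1 \<or> J \<subseteq> ?I2"
    using connectedD[of J ?I1 ?I2] open_inside[OF closed(1)] open_inside[OF closed(2)] I(1) by blast
  moreover have "q ` {0..1} \<subseteq> closure J"
  proof -
    have "q ` closure {0<..<1} \<subseteq> closure J"
      by (rule image_closure_subset) (use contq closure_subset[of J] in \<open>auto simp: J_def\<close>)
    then show ?thesis by simp
  qed
  then have J: "cis \<kappa> \<in> closure J" "cis l \<in> closure J"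
    using q(2,3) imageI[of 0 "{0..1}" q] imageI[of 1 "{0..1}" q]
    by (auto simp: pathstart_def pathfinish_def)
  have ends_q: "cis \<kappa> \<notin> path_image p" "cis l \<notin> path_image p"
    using disj path_img[of q] q(2,3) by auto
  \<comment> \<open>The connected set \<open>J\<close> lies in one region, and its closure contains
    both ends of \<open>q\<close>. But \<open>cis l\<close> is outside the closure of the first
    region, and \<open>cis \<kappa>\<close> outside the closure of the second.\<close>
  have "cis \<kappa> \<notin> ?I2" "cis l \<notin> ?I1"
    using I(2) by (metis Un_iff dist_0_norm mem_ball norm_cis less_irrefl)+
  moreover have "cis l \<notin> path_image c1"
  proof
    assume "cis l \<in> path_image c1"
    then obtain s where "s \<in> {\<alpha>..\<beta>}" "cis l = cis s" unfolding img by auto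
    moreover from this have "l = s" using order by (intro cis_inj_period) auto
    ultimately show False using order by auto
  qed
  moreover have "cis \<kappa> \<notin> path_image c2"
  proof
    assume "cis \<kappa> \<in> path_image c2"
    then obtain s where "s \<in> {\<beta>..\<alpha> + 2 * pi}" "cis \<kappa> = cis s" unfolding img by auto
    moreover from this have "\<kappa> = s" using order by (intro cis_inj_period) auto
    ultimately show False using order by auto
  qed
  ultimately show False
    using J ends_q closure_inside_subset[OF closed(1)] closure_inside_subset[OF closed(2)]
      closure_mono[of J ?I1] closure_mono[of J ?I2] by blast
qed

section \<open>Triangulated circles and the cyclic order of their vertices\<close>

locale circle_complex =
  fixes E :: "'v::finite set set" and G :: "real ^ 'v \<Rightarrow> complex"
  assumes complex: "abstract_complex E" and card_le_2: "\<And>s. s \<in> E \<Longrightarrow> card s \<le> 2"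
    and continuous: "continuous_on (geometric_carrier E) G"
    and bij: "bij_betw G (geometric_carrier E) (sphere 0 1)"
begin

lemma carrier: "x \<in> geometric_carrier E \<longleftrightarrow> (\<forall>v. 0 \<le> x $ v) \<and> (\<Sum>v\<in>UNIV. x $ v) = 1 \<and> support x \<in> E"
  using complex by (rule mem_geometric_carrier)

definition H :: "complex \<Rightarrow> real ^ 'v" where
  "H = inv_into (geometric_carrier E) G"

lemma continuous_H: "continuous_on (sphere 0 1) H"
proof -
  have "continuous_on (G ` geometric_carrier E) H"
    by (rule continuous_on_inv[OF continuous compact_geometric_carrier])
       (use bij in \<open>auto simp: H_def bij_betw_inv_into_left\<close>)
  then show ?thesis using bij by (simp add: bij_betw_def)
qed

lemma support_axis: "support (axis v 1) = {v}"
  by (auto simp: support_def axis_def)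

lemma eq_axis:
  assumes "x \<in> geometric_carrier E" "support x \<subseteq> {u}"
  shows "x = axis u 1"
proof -
  have "x $ w = 0" if "w \<noteq> u" for w
    using assms(2) that by (auto simp: support_def)
  moreover have "x $ u = 1"
    using assms sum_support_subset[of x "{u}"] by (simp add: carrier)
  ultimately show ?thesis by (simp add: vec_eq_iff axis_def)
qed

lemma axis_in_carrier: "u \<in> vertices E \<Longrightarrow> axis u 1 \<in> geometric_carrier E"
proof -
  assume "u \<in> vertices E"
  then obtain s where "s \<in> E" "u \<in> s" by (auto simp: vertices_def)
  then have "{u} \<in> E" using complex by (simp add: abstract_complex_def)
  then show ?thesis
    by (auto simp: carrier support_axis) (auto simp: axis_def)
qed

text \<open>Vertices are sorted by the angle of their image, starting at \<open>v\<close>. Between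
  consecutive angles the circle passes through no vertex, so supports have two elements and, since
  they can only grow locally, are constant: this is one edge. By continuity it contains the vertices
  at both ends of the interval.\<close>

lemma cyclic_order:
  assumes "v \<in> vertices E"
  obtains m c a where "3 \<le> m" "inj_on c {..<m}" "c 0 = v" "vertices E = c ` {..<m}"
    "\<And>i. i < m \<Longrightarrow> {c i, c (Suc i mod m)} \<in> E"
    "\<And>e. e \<in> E \<Longrightarrow> card e = 2 \<Longrightarrow> \<exists>i<m. e = {c i, c (Suc i mod m)}"
    "\<And>i j. i < j \<Longrightarrow> j < m \<Longrightarrow> a i < (a j :: real)"
    "\<And>i. i < m \<Longrightarrow> G (axis (c i) 1) = cis (a i) \<and> a i < a 0 + 2 * pi"
proof -
  let ?V = "vertices E"
  have norm_G: "norm (G x) = 1" if "x \<in> geometric_carrier E" for x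
    using that bij by (auto dest: bij_betwE)
  obtain \<alpha> where \<alpha>: "G (axis v 1) = cis \<alpha>"
    using norm_G[OF axis_in_carrier[OF assms]] unit_circle_param[of _ 0] by metis
  have "\<exists>t. \<alpha> \<le> t \<and> t < \<alpha> + 2 * pi \<and> G (axis u 1) = cis t" if "u \<in> ?V" for u
    using norm_G[OF axis_in_carrier[OF that]] unit_circle_param[of _ \<alpha>] by metis
  then obtain \<theta> where \<theta>: "\<And>u. u \<in> ?V \<Longrightarrow> \<alpha> \<le> \<theta> u" "\<And>u. u \<in> ?V \<Longrightarrow> \<theta> u < \<alpha> + 2 * pi"
    "\<And>u. u \<in> ?V \<Longrightarrow> G (axis u 1) = cis (\<theta> u)"
    by metis
  have \<theta>v: "\<theta> v = \<alpha>"
    using \<theta>[OF assms] \<alpha> by (intro cis_inj_period) auto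
  have inj_\<theta>: "inj_on \<theta> ?V"
  proof (rule inj_onI)
    fix u w assume uw: "u \<in> ?V" "w \<in> ?V" "\<theta> u = \<theta> w"
    then have "G (axis u 1) = G (axis w 1)" using \<theta>(3) by simp
    then have "axis u (1::real) = axis w 1"
      using bij axis_in_carrier uw by (auto simp: bij_betw_def dest: inj_onD)
    then show "u = w" by (simp add: axis_eq_axis)
  qed
  define xs where "xs = sorted_list_of_set (\<theta> ` ?V)"
  define m where "m = length xs"
  \<comment> \<open>The entry at \<open>m\<close> is the angle of the first vertex after a full
    turn, so that the last interval closes the circle. No vertex has this angle, which is why
    vertices are indexed modulo \<open>m\<close>.\<close>
  define a where "a i = (if i < m then xs ! i else \<alpha> + 2 * pi)" for i
  define c where "c i = inv_into ?V \<theta> (a i)" for i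
  have set_xs: "set xs = \<theta> ` ?V"
    by (simp add: xs_def)
  have m_card: "m = card ?V"
    using inj_\<theta> by (simp add: m_def xs_def card_image)
  have a_in: "a i \<in> \<theta> ` ?V" if "i < m" for i
    using that set_xs nth_mem[of i xs] by (simp add: a_def m_def)
  have a_bounds: "\<alpha> \<le> a i" "a i < \<alpha> + 2 * pi" if "i < m" for i
    using a_in[OF that] \<theta> by auto
  have a_mono: "a i < a j" if "i < j" "j \<le> m" for i j
  proof (cases "j = m")
    case True
    then show ?thesis using that a_bounds(2)[of i] by (simp add: a_def)
  next
    case False
    then have "xs ! i < xs ! j"
      using that by (intro sorted_wrt_nth_less[of "(<)"]) (auto simp: xs_def m_def)
    then show ?thesis using that False by (simp add: a_def)
  qed
  have a_index: "\<exists>i<m. t = a i" if "t \<in> \<theta> ` ?V" for t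
    using that unfolding set_xs[symmetric] in_set_conv_nth by (auto simp: a_def m_def)
  have c_in: "c i \<in> ?V" and \<theta>c: "\<theta> (c i) = a i" if "i < m" for i
    using inv_into_into[OF a_in[OF that]] f_inv_into_f[OF a_in[OF that]] by (auto simp: c_def)
  have m0: "0 < m"
    using assms by (auto simp: m_card card_gt_0_iff)
  have a0: "a 0 = \<alpha>"
  proof -
    obtain i where "i < m" "\<alpha> = a i" using a_index[of \<alpha>] assms \<theta>v by force
    then show ?thesis
      using a_bounds(1)[OF m0] a_mono[of 0 i] by (cases "i = 0") auto
  qed
  have am: "a m = \<alpha> + 2 * pi" by (simp add: a_def)
  have c0: "c 0 = v"
    using a0 \<theta>v inv_into_f_f[OF inj_\<theta> assms] by (simp add: c_def)
  have inj_c: "inj_on c {..<m}"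
  proof (rule inj_onI)
    fix i j assume "i \<in> {..<m}" "j \<in> {..<m}" "c i = c j"
    then have "a i = a j" using \<theta>c by (metis lessThan_iff)
    then show "i = j"
      using a_mono[of i j] a_mono[of j i] \<open>i \<in> _\<close> \<open>j \<in> _\<close> by (cases i j rule: linorder_cases) auto
  qed
  have c_img: "?V = c ` {..<m}"
  proof (intro equalityI subsetI)
    fix u assume u: "u \<in> ?V"
    then obtain i where "i < m" "\<theta> u = a i" using a_index by blast
    then have "c i = u" using inv_into_f_f[OF inj_\<theta> u] by (simp add: c_def)
    then show "u \<in> c ` {..<m}" using \<open>i < m\<close> by blast
  qed (use c_in in auto)
  define \<gamma> where "\<gamma> t = H (cis t)" for t
  have \<gamma>_cont: "continuous_on S \<gamma>" for S
    unfolding \<gamma>_def cis_conv_exp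
    by (rule continuous_on_compose2[OF continuous_H]) (auto intro!: continuous_intros)
  have \<gamma>_in: "\<gamma> t \<in> geometric_carrier E" and G\<gamma>: "G (\<gamma> t) = cis t" for t
    using bij bij_betwE[OF bij_betw_inv_into[OF bij]]
    by (auto simp: \<gamma>_def H_def bij_betw_inv_into_right)
  have \<gamma>G: "\<gamma> t = x" if "x \<in> geometric_carrier E" "G x = cis t" for x t
    using that \<gamma>_in G\<gamma> bij by (metis bij_betw_def inj_onD)
  have \<gamma>_vertex: "\<gamma> (a i) = axis (c (i mod m)) 1" if "i \<le> m" for i
  proof (cases "i = m")
    case True
    have "cis (a m) = cis \<alpha>" unfolding am by (simp add: cis_mult[symmetric])
    then show ?thesis
      using True \<gamma>G[of "axis v 1" "a m"] \<alpha> axis_in_carrier[OF assms] c0 by simp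
  next
    case False
    then have "i < m" using that by simp
    then show ?thesis
      using \<gamma>G[OF axis_in_carrier[OF c_in]] \<theta>(3)[OF c_in] \<theta>c by simp
  qed
  have edge: "card (support (\<gamma> t)) = 2" if t: "i < m" "a i < t" "t < a (Suc i)" for i t
  proof (rule ccontr)
    assume "card (support (\<gamma> t)) \<noteq> 2"
    moreover have "card (support (\<gamma> t)) \<le> 2"
      using \<gamma>_in[of t] card_le_2 by (simp add: carrier)
    moreover have "support (\<gamma> t) \<noteq> {}"
      using \<gamma>_in[of t] support_nonempty by (auto simp: carrier)
    ultimately have "card (support (\<gamma> t)) = 1"
      by (simp add: card_gt_0_iff le_less less_2_cases_iff)
    then obtain u where u: "support (\<gamma> t) = {u}"
      by (rule card_1_singletonE)
    then have uV: "u \<in> ?V" using \<gamma>_in[of t] by (auto simp: carrier vertices_def)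
    have "\<gamma> t = axis u 1" using eq_axis \<gamma>_in u by simp
    then have "cis t = cis (\<theta> u)" using G\<gamma>[of t] \<theta>(3)[OF uV] by simp
    moreover have "\<alpha> \<le> t" "t < \<alpha> + 2 * pi"
      using t a_bounds(1)[OF t(1)] a_mono[of "Suc i" m] am by (cases "Suc i = m"; simp)+
    ultimately have "t = \<theta> u"
      using \<theta>(1,2)[OF uV] by (intro cis_inj_period) auto
    then obtain j where j: "j < m" "t = a j" using a_index uV by blast
    have "\<not> j \<le> i" using j t a_mono[of j i] by (cases "j = i") auto
    moreover have "\<not> Suc i \<le> j" using j t a_mono[of "Suc i" j] by (cases "j = Suc i") auto
    ultimately show False by simp
  qed
  define e where "e i = support (\<gamma> ((a i + a (Suc i)) / 2))" for i
  have const: "support (\<gamma> t) = e i" if i: "i < m" and t: "a i < t" "t < a (Suc i)" for i t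
    unfolding e_def
  proof (rule connected_local_const[of "{a i<..<a (Suc i)}"])
    let ?I = "{a i<..<a (Suc i)}"
    show "t \<in> ?I" "(a i + a (Suc i)) / 2 \<in> ?I"
      using t by auto
    show "\<forall>s\<in>?I. \<forall>\<^sub>F r in at s within ?I. support (\<gamma> s) = support (\<gamma> r)"
    proof
      fix s assume s: "s \<in> ?I"
      have "openin (top_of_set ?I) {r \<in> ?I. support (\<gamma> s) \<subseteq> support (\<gamma> r)}"
        using \<gamma>_cont \<gamma>_in by (intro openin_support_superset) (auto simp: carrier)
      then obtain U where U: "open U" "{r \<in> ?I. support (\<gamma> s) \<subseteq> support (\<gamma> r)} = ?I \<inter> U"
        by (auto simp: openin_open)
      have "support (\<gamma> s) = support (\<gamma> r)" if "r \<in> U" "r \<in> ?I" for r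
      proof (rule card_subset_eq)
        show "support (\<gamma> s) \<subseteq> support (\<gamma> r)" using U that by blast
        show "card (support (\<gamma> s)) = card (support (\<gamma> r))"
          using edge[OF i] s that by simp
      qed simp
      moreover have "s \<in> U" using U s by blast
      ultimately show "\<forall>\<^sub>F r in at s within ?I. support (\<gamma> s) = support (\<gamma> r)"
        using U(1) unfolding eventually_at_topological by blast
    qed
  qed auto
  have e_card: "card (e i) = 2" and e_in: "e i \<in> E" if "i < m" for i
    using edge[OF that, of "(a i + a (Suc i)) / 2"] a_mono[of i "Suc i"] that \<gamma>_in
    by (auto simp: e_def carrier)
  have closure: "support (\<gamma> t) \<subseteq> e i" if i: "i < m" and t: "a i \<le> t" "t \<le> a (Suc i)" for i t
  proof -
    have lt: "a i < a (Suc i)" using i a_mono by simp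
    have "\<gamma> t $ u = 0" if u: "u \<notin> e i" for u
    proof (rule continuous_constant_on_closure[of "{a i<..<a (Suc i)}" "\<lambda>t. \<gamma> t $ u"])
      show "continuous_on (closure {a i<..<a (Suc i)}) (\<lambda>t. \<gamma> t $ u)"
        by (intro continuous_on_component \<gamma>_cont)
      show "\<gamma> s $ u = 0" if "s \<in> {a i<..<a (Suc i)}" for s
        using const[OF i, of s] that u by (auto simp: support_def)
      show "t \<in> closure {a i<..<a (Suc i)}" using t lt by simp
    qed
    then show ?thesis by (auto simp: support_def)
  qed
  have ends: "c i \<in> e i" "c (Suc i mod m) \<in> e i" if "i < m" for i
    using closure[OF that, of "a i"] closure[OF that, of "a (Suc i)"] \<gamma>_vertex[of i] \<gamma>_vertex[of "Suc i"]
      a_mono[of i "Suc i"] that by (auto simp: support_axis)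
  have m2: "2 \<le> m"
  proof -
    have "e 0 \<subseteq> ?V" using e_in[OF m0] by (auto simp: vertices_def)
    then have "card (e 0) \<le> card ?V" by (intro card_mono) auto
    then show ?thesis using e_card[OF m0] m_card by simp
  qed
  have e_eq: "e i = {c i, c (Suc i mod m)}" if "i < m" for i
  proof -
    have "i \<noteq> Suc i mod m"
      using that m2 by (cases "Suc i = m") auto
    then have "c i \<noteq> c (Suc i mod m)"
      using inj_c that m0 by (auto dest: inj_onD)
    then have "card {c i, c (Suc i mod m)} = card (e i)"
      using e_card[OF that] by simp
    then show ?thesis
      using ends[OF that] card_subset_eq[of "e i" "{c i, c (Suc i mod m)}"] by simp
  qed
  \<comment> \<open>With two vertices, both arcs of the circle would run through the same edge; the
    intermediate value theorem finds the midpoint of the edge on each of them, against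
    injectivity.\<close>
  have "m \<noteq> 2"
  proof
    assume m: "m = 2"
    have cc: "c 0 \<noteq> c 1" using inj_c m by (auto dest: inj_onD)
    have ord: "a 0 < a 1" "a 1 < a 2" using a_mono[of 0 1] a_mono[of 1 2] m by auto
    have ivt: "\<exists>t. a 0 \<le> t \<and> t \<le> a 1 \<and> \<gamma> t $ c 1 = 1/2" "\<exists>t. a 1 \<le> t \<and> t \<le> a 2 \<and> \<gamma> t $ c 1 = 1/2"
      using IVT'[of "\<lambda>t. \<gamma> t $ c 1" "a 0" "1/2" "a 1"] IVT2'[of "\<lambda>t. \<gamma> t $ c 1" "a 2" "1/2" "a 1"]
        \<gamma>_vertex[of 0] \<gamma>_vertex[of 1] \<gamma>_vertex[of 2] ord m cc continuous_on_component[OF \<gamma>_cont]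
      by (auto simp: axis_def)
    then obtain s t where st: "a 0 \<le> s" "s \<le> a 1" "\<gamma> s $ c 1 = 1/2" "a 1 \<le> t" "t \<le> a 2" "\<gamma> t $ c 1 = 1/2"
      by blast
    have half: "\<gamma> r $ u = (if u = c 0 \<or> u = c 1 then 1/2 else 0)"
      if "\<gamma> r $ c 1 = 1/2" "support (\<gamma> r) \<subseteq> {c 0, c 1}" for r u
    proof -
      have "\<gamma> r $ c 0 + \<gamma> r $ c 1 = 1"
        using sum_support_subset[OF that(2)] \<gamma>_in[of r] cc by (simp add: carrier)
      then show ?thesis using that by (auto simp: support_def)
    qed
    have supp: "support (\<gamma> s) \<subseteq> {c 0, c 1}" "support (\<gamma> t) \<subseteq> {c 0, c 1}"
      using closure[of 0 s] closure[of 1 t] e_eq[of 0] e_eq[of 1] m st by (auto simp: numeral_2_eq_2)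
    have "\<gamma> s = \<gamma> t"
      unfolding vec_eq_iff using half[OF st(3) supp(1)] half[OF st(6) supp(2)] by simp
    then have cis: "cis s = cis t" using G\<gamma> by metis
    have "s \<noteq> a 1" "t \<noteq> a 1"
      using st \<gamma>_vertex[of 1] m by (auto simp: axis_def)
    moreover have "t < s + 2 * pi"
    proof (rule ccontr)
      assume "\<not> t < s + 2 * pi"
      then have "s = a 0" using st a0 am m by simp
      then show False using st(3) \<gamma>_vertex[of 0] cc by (auto simp: axis_def)
    qed
    ultimately show False
      using st cis_inj_period[OF cis] by auto
  qed
  show ?thesis
  proof (rule that[of m c a])
    show "3 \<le> m" using m2 \<open>m \<noteq> 2\<close> by simp
    show "{c i, c (Suc i mod m)} \<in> E" if "i < m" for i
      using e_eq[OF that] e_in[OF that] by simp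
    show "\<exists>i<m. f = {c i, c (Suc i mod m)}" if f: "f \<in> E" "card f = 2" for f
    proof -
      have "f \<noteq> {}" using f(2) by auto
      then have "rel_interior (face_simplex f) \<noteq> {}"
        unfolding rel_interior_eq_empty[OF convex_convex_hull] by simp
      then obtain x where "x \<in> rel_interior (face_simplex f)"
        by blast
      then have x: "x \<in> geometric_carrier E" "support x = f"
        using f(1) by (auto simp: mem_rel_interior_face_simplex carrier)
      obtain t where t: "\<alpha> \<le> t" "t < \<alpha> + 2 * pi" "G x = cis t"
        using unit_circle_param[OF norm_G[OF x(1)]] by metis
      have \<gamma>t: "\<gamma> t = x" using \<gamma>G x(1) t(3) by blast
      have "\<exists>k<m. (\<forall>i\<le>k. \<not> t < a i) \<and> t < a (Suc k)"
        using t a0 am by (intro ex_least_nat_less) auto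
      then obtain i where i: "i < m" "a i \<le> t" "t < a (Suc i)" by force
      have "t \<noteq> a i"
        using \<gamma>t \<gamma>_vertex[of i] i(1) x(2) f(2) by (auto simp: support_axis)
      then have "f = e i"
        using const[of i t] i \<gamma>t x(2) by simp
      then show ?thesis using e_eq[OF i(1)] i(1) by blast
    qed
    show "G (axis (c i) 1) = cis (a i) \<and> a i < a 0 + 2 * pi" if "i < m" for i
      using \<theta>(3)[OF c_in[OF that]] \<theta>c[OF that] a_bounds(2)[OF that] a0 by simp
  qed (use inj_c c0 c_img a_mono in auto)
qed

end

text \<open>By invariance of domain, the image of the relative interior is open in the affine hull
  of \<open>T\<close>, and the relative interior of \<open>T\<close> is the largest such
  subset.\<close>

lemma homeomorphism_rel_interior_subset:
  fixes S :: "'a::euclidean_space set" and T :: "'b::euclidean_space set"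
  assumes hom: "homeomorphism S T f g" and "aff_dim S = aff_dim T"
  shows "f ` rel_interior S \<subseteq> rel_interior T"
proof (rule rel_interior_maximal)
  have cont: "continuous_on S f" and inv: "\<And>x. x \<in> S \<Longrightarrow> f x \<in> T \<and> g (f x) = x"
    using hom unfolding homeomorphism_def by blast+
  note sub = subsetD[OF rel_interior_subset[of S]]
  show "f ` rel_interior S \<subseteq> T"
    using inv sub by blast
  show "openin (top_of_set (affine hull T)) (f ` rel_interior S)"
  proof (rule invariance_of_domain_affine_sets[OF openin_rel_interior])
    show "continuous_on (rel_interior S) f"
      using cont rel_interior_subset by (rule continuous_on_subset)
    show "f \<in> rel_interior S \<rightarrow> affine hull T"
      using inv sub by (auto intro: hull_inc)
    show "inj_on f (rel_interior S)"
      using inv sub by (auto intro: inj_on_inverseI[of _ g])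
  qed (use assms(2) in auto)
qed

lemma homeomorphism_rel_frontier:
  fixes S :: "'a::euclidean_space set" and T :: "'b::euclidean_space set"
  assumes hom: "homeomorphism S T f g" and "aff_dim S = aff_dim T" "closed S" "closed T"
  shows "f ` rel_frontier S = rel_frontier T"
proof -
  have "f ` rel_interior S \<subseteq> rel_interior T" "g ` rel_interior T \<subseteq> rel_interior S"
    using homeomorphism_rel_interior_subset[OF hom] assms(2)
      homeomorphism_rel_interior_subset[OF homeomorphism_symD[OF hom]] by auto
  moreover have fg: "f ` S = T" "\<And>x. x \<in> S \<Longrightarrow> g (f x) = x" "\<And>y. y \<in> T \<Longrightarrow> f (g y) = y"
    using hom unfolding homeomorphism_def by blast+
  moreover have "y \<in> f ` rel_interior S" if "y \<in> rel_interior T" for y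
    using that fg(3)[of y] calculation(2) rel_interior_subset[of T] by (metis image_subset_iff image_eqI subsetD)
  ultimately have "f ` rel_interior S = rel_interior T"
    by blast
  moreover have "f ` (S - rel_interior S) = f ` S - f ` rel_interior S"
    using fg(2) rel_interior_subset[of S]
    by (intro inj_on_image_set_diff[of f S]) (auto intro: inj_on_inverseI)
  ultimately show ?thesis
    using assms(3,4) fg(1) by (simp add: rel_frontier_def)
qed

section \<open>The boundary circle of a disc and its chords\<close>

locale disc_chart = ball_chart B 2 T f for B :: "'v::finite set set" and T f
begin

abbreviation "E \<equiv> boundary_complex 2 B"

lemma E_complex: "abstract_complex E"
  using abstract_complex_boundary[OF complex] .

lemma E_subset: "E \<subseteq> B"
  using boundary_complex_subset[OF complex] .

lemma E_card: "s \<in> E \<Longrightarrow> card s \<le> 2"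
  unfolding boundary_complex_def mem_Collect_eq by (metis card_mono finite)

text \<open>This moves \<open>B\<close> to the plane, where \<open>interlaced_chords_meet\<close>
  applies. A homeomorphism from \<open>T\<close> to the disc respects relative frontiers, so the
  boundary complex lands on the circle.\<close>

lemma obtain_disc_map:
  obtains G where "continuous_on (geometric_carrier B) G"
    "bij_betw G (geometric_carrier B) (cball (0::complex) 1)"
    "G ` geometric_carrier E = sphere 0 1"
proof -
  have dims: "aff_dim T = aff_dim (cball (0::complex) 1)"
    by (simp add: aff_dim_T aff_dim_cball)
  then have "T homeomorphic cball (0::complex) 1"
    using convex_T compact_T by (intro homeomorphic_convex_compact_sets) auto
  then obtain h k where hk: "homeomorphism T (cball (0::complex) 1) h k"
    unfolding homeomorphic_def by blast
  have "rel_frontier (cball (0::complex) 1) = sphere 0 1"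
    by (simp add: rel_frontier_cball)
  then have fr: "h ` rel_frontier T = sphere 0 1"
    using homeomorphism_rel_frontier[OF hk dims closed_T] by simp
  show ?thesis
  proof (rule that[of "h \<circ> f"])
    have "homeomorphism (geometric_carrier B) (cball 0 1) (h \<circ> f) (g \<circ> k)"
      using homeomorphism_compose[OF homeomorphism_f_g hk] .
    then show "continuous_on (geometric_carrier B) (h \<circ> f)"
      "bij_betw (h \<circ> f) (geometric_carrier B) (cball 0 1)"
      unfolding homeomorphism_def bij_betw_def
      using inj_on_inverseI[of "geometric_carrier B" "g \<circ> k" "h \<circ> f"] by blast+
    show "(h \<circ> f) ` geometric_carrier E = sphere 0 1"
      using boundary_image fr by (metis image_comp)
  qed
qed

lemma circle_complex_boundary:
  assumes "continuous_on (geometric_carrier B) G"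
    "bij_betw G (geometric_carrier B) (cball (0::complex) 1)"
    "G ` geometric_carrier E = sphere 0 1"
  shows "circle_complex E G"
proof
  have sub: "geometric_carrier E \<subseteq> geometric_carrier B"
    using E_subset unfolding geometric_carrier_def by blast
  show "continuous_on (geometric_carrier E) G"
    using assms(1) sub continuous_on_subset by blast
  show "bij_betw G (geometric_carrier E) (sphere 0 1)"
    using assms(2,3) sub unfolding bij_betw_def by (blast intro: inj_on_subset)
qed (use E_complex E_card in auto)

lemma boundary_vertex_exists: "vertices E \<noteq> {}"
proof -
  obtain x where "x \<in> geometric_carrier E"
    using boundary_carrier_nonempty by blast
  then have "support x \<in> E" "support x \<noteq> {}"
    using support_nonempty by (auto simp: mem_geometric_carrier[OF E_complex])
  then show ?thesis by (auto simp: vertices_def)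
qed

text \<open>Any inner vertex of the boundary path that is cut off by a shortest chord will do.\<close>

lemma chordless_boundary_vertex:
  obtains v where "v \<in> vertices E" "\<And>u. u \<in> vertices E \<Longrightarrow> {v, u} \<in> B \<Longrightarrow> {v, u} \<in> E"
proof -
  obtain G where G: "continuous_on (geometric_carrier B) G"
    "bij_betw G (geometric_carrier B) (cball (0::complex) 1)" "G ` geometric_carrier E = sphere 0 1"
    by (rule obtain_disc_map)
  interpret circle_complex E G by (rule circle_complex_boundary[OF G])
  obtain v0 where "v0 \<in> vertices E" using boundary_vertex_exists by blast
  then obtain m c a where cyc: "3 \<le> m" "inj_on c {..<m}" "c 0 = v0" "vertices E = c ` {..<m}"
    "\<And>i. i < m \<Longrightarrow> {c i, c (Suc i mod m)} \<in> E"
    "\<And>i j. i < j \<Longrightarrow> j < m \<Longrightarrow> a i < (a j :: real)"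
    "\<And>i. i < m \<Longrightarrow> G (axis (c i) 1) = cis (a i) \<and> a i < a 0 + 2 * pi"
    using cyclic_order by metis
  define chord where "chord i j \<longleftrightarrow> i < m \<and> j < m \<and> {c i, c j} \<in> B \<and> {c i, c j} \<notin> E" for i j
  have subE: "geometric_carrier E \<subseteq> geometric_carrier B"
    using E_subset unfolding geometric_carrier_def by blast
  have sym: "chord i j \<longleftrightarrow> chord j i" for i j
    unfolding chord_def by (metis insert_commute)
  have c_ne: "c i \<noteq> c j" if "i < m" "j < m" "i \<noteq> j" for i j
    using cyc(2) that by (auto dest: inj_onD)
  have no_loop: "\<not> chord i i" for i
    using axis_in_carrier[of "c i"] cyc(4) by (auto simp: chord_def carrier support_axis)
  have neighbours: "\<not> chord i (Suc i)" if "Suc i < m" for i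
    using cyc(5)[of i] that by (simp add: chord_def)
  have chord_path: "arc (G \<circ> linepath (axis (c i) 1) (axis (c j) 1))"
    "(G \<circ> linepath (axis (c i) 1) (axis (c j) 1)) ` {0<..<1} \<subseteq> ball 0 1"
    "path_image (linepath (axis (c i) 1) (axis (c j) 1)) = face_simplex {c i, c j}"
    "face_simplex {c i, c j} \<subseteq> geometric_carrier B"
    if ij: "chord i j" for i j
  proof -
    let ?l = "linepath (axis (c i) 1) (axis (c j) (1::real))"
    have ne: "c i \<noteq> c j"
      using c_ne[of i j] no_loop[of i] ij by (auto simp: chord_def)
    show sub: "face_simplex {c i, c j} \<subseteq> geometric_carrier B"
      by (rule face_simplex_subset_carrier) (use ij in \<open>simp add: chord_def\<close>)
    show img: "path_image ?l = face_simplex {c i, c j}"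
      by (simp add: segment_convex_hull)
    have "arc ?l" using ne by (simp add: axis_eq_axis)
    then show "arc (G \<circ> ?l)"
      using G(1,2) sub img unfolding arc_def
      by (auto intro!: path_continuous_image comp_inj_on
            intro: continuous_on_subset inj_on_subset simp: bij_betw_def path_image_def)
    show "(G \<circ> ?l) ` {0<..<1} \<subseteq> ball 0 1"
    proof (rule image_subsetI)
      fix t :: real assume t: "t \<in> {0<..<1}"
      have supp: "support (?l t) = {c i, c j}"
        using t ne by (auto simp: support_def linepath_def axis_def)
      have "?l t \<in> path_image ?l"
        unfolding path_image_def using t by (intro imageI) auto
      then have lB: "?l t \<in> geometric_carrier B" using img sub by blast
      have "?l t \<notin> geometric_carrier E"
        using supp ij by (simp add: carrier chord_def)
      then have "G (?l t) \<notin> sphere 0 1"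
        using G(3) lB subE inj_on_image_mem_iff[of G "geometric_carrier B" "?l t" "geometric_carrier E"]
          bij_betw_imp_inj_on[OF G(2)] by simp
      moreover have "G (?l t) \<in> cball 0 1"
        using G(2) lB by (auto dest: bij_betwE)
      ultimately show "(G \<circ> ?l) t \<in> ball 0 1" by auto
    qed
  qed
  \<comment> \<open>Interlaced chords would have a common image point in the disc, hence a common
    point in the carrier; but two edges without a common vertex are disjoint.\<close>
  have noncrossing: False if ord: "i < k" "k < j" "j < l" and ch: "chord i j" "chord k l" for i k j l
  proof -
    have lm: "i < m" "k < m" "j < m" "l < m" using ch by (auto simp: chord_def)
    let ?p = "linepath (axis (c i) 1) (axis (c j) (1::real))"
    let ?q = "linepath (axis (c k) 1) (axis (c l) (1::real))"
    have "a l < a i + 2 * pi"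
      using cyc(7)[OF lm(4)] cyc(6)[of 0 i] lm by (cases "i = 0") auto
    then have "path_image (G \<circ> ?p) \<inter> path_image (G \<circ> ?q) \<noteq> {}"
      using chord_path[OF ch(1)] chord_path[OF ch(2)] cyc(6,7) lm ord
      by (intro interlaced_chords_meet[of _ "a i" "a j" _ "a k" "a l"])
         (auto simp: pathstart_compose pathfinish_compose)
    then obtain x y where xy: "x \<in> face_simplex {c i, c j}" "y \<in> face_simplex {c k, c l}" "G x = G y"
      unfolding path_image_compose chord_path(3)[OF ch(1)] chord_path(3)[OF ch(2)] by blast
    then have "x = y"
      using chord_path(4)[OF ch(1)] chord_path(4)[OF ch(2)] G(2)
      by (auto simp: bij_betw_def dest: inj_onD)
    then have "support x \<subseteq> {c i, c j} \<inter> {c k, c l}" "support x \<noteq> {}"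
      using xy support_nonempty unfolding mem_face_simplex by auto
    then show False
      using c_ne lm ord by auto
  qed
  show ?thesis
  proof (cases "\<exists>i j. i < j \<and> chord i j")
    case False
    then have "\<not> chord i j" for i j
      using sym no_loop by (metis linorder_cases)
    then show ?thesis
      using that[of "c 0"] cyc(1,4) by (auto simp: chord_def)
  next
    case True
    then obtain i j where ij: "i < j" "chord i j"
      "\<And>i' j'. i' < j' \<Longrightarrow> chord i' j' \<Longrightarrow> j - i \<le> j' - i'"
      using ex_has_least_nat[of "\<lambda>p. fst p < snd p \<and> chord (fst p) (snd p)" _ "\<lambda>p. snd p - fst p"]
      by auto (metis fst_conv snd_conv)
    have jm: "j < m" using ij(2) by (simp add: chord_def)
    have "Suc i \<noteq> j" using neighbours[of i] ij(2) jm by auto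
    then have k: "Suc i < j" using ij(1) by simp
    have no_chord: "\<not> chord (Suc i) l" for l
    proof
      assume l: "chord (Suc i) l"
      \<comment> \<open>Ending before \<open>i\<close> or after \<open>j\<close>, the new chord
        would cross the chosen one; ending after \<open>Suc i\<close> and up to \<open>j\<close>, it
        would be shorter; and \<open>i\<close> is a neighbour on the boundary.\<close>
      consider "l < i" | "l = i" | "l = Suc i" | "Suc i < l" "l \<le> j" | "j < l" by linarith
      then show False
      proof cases
        case 1
        then show False using noncrossing[of l i "Suc i" j] sym l ij(2) k by blast
      next
        case 2
        then show False using neighbours[of i] l sym k jm by auto
      next
        case 3
        then show False using l no_loop by simp
      next
        case 4
        then show False using ij(3)[OF 4(1) l] ij(1) by linarith
      next
        case 5
        then show False using noncrossing[of i "Suc i" j l] l ij(2) k by simp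
      qed
    qed
    show ?thesis
    proof (rule that[of "c (Suc i)"])
      show "c (Suc i) \<in> vertices E" using cyc(4) k jm by simp
      show "{c (Suc i), u} \<in> E" if "u \<in> vertices E" "{c (Suc i), u} \<in> B" for u
        using that no_chord cyc(4) k jm by (auto simp: chord_def)
    qed
  qed
qed

end

section \<open>Discs\<close>

text \<open>On the segment from \<open>c\<close> to a point of \<open>S\<close>, everything before
  the end is in the relative interior. So a ray in the affine hull meets the frontier at most once,
  and it does meet it because \<open>S\<close> is bounded. A nonempty frontier excludes a single
  point, whose cone would be empty.\<close>

lemma cone_over_rel_frontier:
  fixes S :: "'a::euclidean_space set"
  assumes "convex S" "compact S" and c: "c \<in> rel_interior S" and ne: "rel_frontier S \<noteq> {}"
  shows "cone_over c (rel_frontier S) = S" "visible_from c (rel_frontier S)"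
proof -
  have fr: "rel_frontier S \<subseteq> S" "\<And>y. y \<in> rel_frontier S \<Longrightarrow> y \<notin> rel_interior S"
    using assms(2) compact_imp_closed[of S] by (auto simp: rel_frontier_def)
  have shrink: "c + r *\<^sub>R (y - c) \<in> rel_interior S" if "y \<in> S" "0 \<le> r" "r < 1" for y r
  proof -
    have "y - (1 - r) *\<^sub>R (y - c) \<in> rel_interior S"
      using rel_interior_convex_shrink[OF assms(1) c that(1), of "1 - r"] that by simp
    moreover have "y - (1 - r) *\<^sub>R (y - c) = c + r *\<^sub>R (y - c)"
      by (simp add: algebra_simps)
    ultimately show ?thesis by simp
  qed
  show "visible_from c (rel_frontier S)"
    unfolding visible_from_def
  proof (intro conjI ballI allI impI)
    show "c \<notin> rel_frontier S" using c fr by blast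
    fix y r assume y: "y \<in> rel_frontier S" and r: "(0::real) < r" "c + r *\<^sub>R (y - c) \<in> rel_frontier S"
    show "r = 1"
    proof (rule ccontr)
      assume "r \<noteq> 1"
      then consider "r < 1" | "1 < r" by linarith
      then show False
      proof cases
        case 1
        then show False using shrink[of y r] y r fr by auto
      next
        case 2
        have "c + (1 / r) *\<^sub>R ((c + r *\<^sub>R (y - c)) - c) = y"
          using r(1) by simp
        moreover have "1 / r < 1" "0 \<le> 1 / r" using 2 by auto
        ultimately show False using shrink[of "c + r *\<^sub>R (y - c)" "1 / r"] y r fr by auto
      qed
    qed
  qed
  show "cone_over c (rel_frontier S) = S"
  proof (intro equalityI subsetI)
    fix x assume "x \<in> cone_over c (rel_frontier S)"
    then obtain t y where "0 \<le> t" "t \<le> 1" "y \<in> rel_frontier S" "x = (1 - t) *\<^sub>R c + t *\<^sub>R y"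
      by (rule cone_overE)
    moreover have "c \<in> S" using c rel_interior_subset by blast
    ultimately show "x \<in> S"
      using fr(1) assms(1) by (auto intro!: convexD)
  next
    fix x assume x: "x \<in> S"
    show "x \<in> cone_over c (rel_frontier S)"
    proof (cases "x = c")
      case True
      obtain y where "y \<in> rel_frontier S" using ne by blast
      then show ?thesis using True cone_overI[of 0 y _ c] by simp
    next
      case False
      have "c + (x - c) \<in> affine hull S"
        using x by (simp add: hull_inc)
      then obtain r where r: "0 < r" "c + r *\<^sub>R (x - c) \<in> rel_frontier S"
        using ray_to_rel_frontier[OF compact_imp_bounded[OF assms(2)] c, of "x - c"] False by auto
      have "1 \<le> r"
        using shrink[OF x, of r] r fr(2) by force
      then have "(1 - 1 / r) *\<^sub>R c + (1 / r) *\<^sub>R (c + r *\<^sub>R (x - c)) \<in> cone_over c (rel_frontier S)"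
        using r by (intro cone_overI) auto
      moreover have "(1 - 1 / r) *\<^sub>R c + (1 / r) *\<^sub>R (c + r *\<^sub>R (x - c)) = x"
        using r(1) by (simp add: algebra_simps)
      ultimately show ?thesis by simp
    qed
  qed
qed

text \<open>The fan from \<open>c 0\<close> over the path \<open>c 1, \<dots>, c (m - 1)\<close> is mapped linearly onto a planar
  triangle with \<open>c 0\<close> at the apex and the path on the opposite side.\<close>

locale fan =
  fixes c :: "nat \<Rightarrow> 'v::finite" and m :: nat
  assumes m: "3 \<le> m" and inj_c: "inj_on c {..<m}"
begin

definition fan_complex :: "'v set set" where
  "fan_complex = {s. \<exists>i\<ge>1. Suc i < m \<and> s \<subseteq> {c 0, c i, c (Suc i)}}"

definition polygon :: "'v set set" where
  "polygon = {s. \<exists>i<m. s \<subseteq> {c i, c (Suc i mod m)}}"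

text \<open>\<open>c 0\<close> has no term and goes to the origin, while \<open>c i\<close> goes to
  height \<open>i\<close> on the line of real part 1. The triangles of the fan become the sectors
  between the slopes \<open>i\<close> and \<open>i + 1\<close>.\<close>

definition flat :: "real ^ 'v \<Rightarrow> complex" where
  "flat x = (\<Sum>i\<in>{1..<m}. (x $ c i) *\<^sub>R Complex 1 (real i))"

definition triangle :: "complex set" where
  "triangle = convex hull {0, Complex 1 1, Complex 1 (real m - 1)}"

lemma c_eq_iff: "i < m \<Longrightarrow> j < m \<Longrightarrow> c i = c j \<longleftrightarrow> i = j"
  using inj_c by (auto dest: inj_onD)

lemma abstract_complex_fan: "abstract_complex fan_complex"
  unfolding abstract_complex_def fan_complex_def by (auto intro: subset_trans)

lemma abstract_complex_polygon: "abstract_complex polygon"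
  unfolding abstract_complex_def polygon_def by (auto intro: subset_trans)

lemma linear_flat: "linear flat"
  unfolding flat_def by (intro linear_compose_sum) (auto simp: linear_iff algebra_simps)

lemma flat_axis:
  assumes "j < m"
  shows "flat (axis (c j) 1) = (if j = 0 then 0 else Complex 1 (real j))"
proof -
  have "flat (axis (c j) 1) = (\<Sum>i\<in>{1..<m}. if i = j then Complex 1 (real i) else 0)"
    unfolding flat_def using assms by (intro sum.cong) (auto simp: axis_def c_eq_iff)
  then show ?thesis using assms by auto
qed

text \<open>Coordinates adapted to \<open>flat\<close>: \<open>p\<close> is the real part of the
  image and \<open>r\<close> its height above the line of slope \<open>i\<close> through the
  origin.\<close>

definition point :: "nat \<Rightarrow> real \<Rightarrow> real \<Rightarrow> real ^ 'v" where
  "point i p r = (1 - p) *\<^sub>R axis (c 0) 1 + (p - r) *\<^sub>R axis (c i) 1 + r *\<^sub>R axis (c (Suc i)) 1"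

lemma flat_point:
  assumes "1 \<le> i" "Suc i < m"
  shows "flat (point i p r) = Complex p (real i * p + r)"
proof -
  have "flat (point i p r) = (p - r) *\<^sub>R Complex 1 (real i) + r *\<^sub>R Complex 1 (real (Suc i))"
    unfolding point_def using assms m
    by (simp add: linear_add[OF linear_flat] linear_scale[OF linear_flat] flat_axis)
  then show ?thesis
    by (simp add: complex_eq_iff algebra_simps)
qed

lemma mem_fan_carrier:
  "x \<in> geometric_carrier fan_complex \<longleftrightarrow>
    (\<exists>i\<ge>1. Suc i < m \<and> (\<exists>p r. 0 \<le> r \<and> r \<le> p \<and> p \<le> 1 \<and> x = point i p r))"
proof
  assume "x \<in> geometric_carrier fan_complex"
  then have x: "\<And>v. 0 \<le> x $ v" "(\<Sum>v\<in>UNIV. x $ v) = 1" and "support x \<in> fan_complex"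
    by (simp_all add: mem_geometric_carrier[OF abstract_complex_fan])
  then obtain i where i: "1 \<le> i" "Suc i < m" "support x \<subseteq> {c 0, c i, c (Suc i)}"
    by (auto simp: fan_complex_def)
  have distinct: "c 0 \<noteq> c i" "c 0 \<noteq> c (Suc i)" "c i \<noteq> c (Suc i)"
    using i m by (auto simp: c_eq_iff)
  have sum: "x $ c 0 + x $ c i + x $ c (Suc i) = 1"
    using sum_support_subset[OF i(3)] x(2) distinct by (simp add: add.assoc)
  have "x = point i (x $ c i + x $ c (Suc i)) (x $ c (Suc i))"
  proof -
    have "1 - (x $ c i + x $ c (Suc i)) = x $ c 0"
      using sum by linarith
    then show ?thesis
      using sum_axis_eq_self[OF i(3)] distinct by (simp add: point_def add.assoc)
  qed
  moreover have "x $ c i + x $ c (Suc i) \<le> 1" "x $ c (Suc i) \<le> x $ c i + x $ c (Suc i)"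
    using sum x(1)[of "c 0"] x(1)[of "c i"] by auto
  ultimately show "\<exists>i\<ge>1. Suc i < m \<and> (\<exists>p r. 0 \<le> r \<and> r \<le> p \<and> p \<le> 1 \<and> x = point i p r)"
    using i x(1) by blast
next
  assume "\<exists>i\<ge>1. Suc i < m \<and> (\<exists>p r. 0 \<le> r \<and> r \<le> p \<and> p \<le> 1 \<and> x = point i p r)"
  then obtain i p r where i: "1 \<le> i" "Suc i < m" and pr: "0 \<le> r" "r \<le> p" "p \<le> 1" and x: "x = point i p r"
    by blast
  have axis_nth: "axis u (1::real) $ v = (if v = u then 1 else 0)" for u v :: 'v
    by (simp add: axis_def)
  have "\<And>v. 0 \<le> x $ v"
    using pr by (simp add: x point_def axis_nth)
  moreover have "(\<Sum>v\<in>UNIV. x $ v) = 1"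
    by (simp add: x point_def axis_nth sum.distrib sum_distrib_left[symmetric])
  moreover have "support x \<subseteq> {c 0, c i, c (Suc i)}"
    by (auto simp: support_def x point_def axis_nth split: if_splits)
  moreover from this have "support x \<in> fan_complex"
    using i by (auto simp: fan_complex_def)
  ultimately show "x \<in> geometric_carrier fan_complex"
    by (simp add: mem_geometric_carrier[OF abstract_complex_fan])
qed

text \<open>For positive \<open>p\<close> this finds the sector of the slope \<open>q / p\<close>;
  the form without division includes the apex. The offset 2 in the search is the upper slope of the
  first sector.\<close>

lemma bracket:
  assumes "p \<le> q" "q \<le> (real m - 1) * p"
  obtains i where "1 \<le> i" "Suc i < m" "real i * p \<le> q" "q \<le> real (Suc i) * p"
proof -
  let ?P = "\<lambda>k. q \<le> real (Suc (Suc k)) * p"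
  define k where "k = (LEAST k. ?P k)"
  have "?P (m - 3)"
    using assms(2) m by (simp add: of_nat_diff)
  then have k: "?P k" "k \<le> m - 3"
    unfolding k_def by (rule LeastI, rule Least_le)
  have "real (Suc k) * p \<le> q"
  proof (cases k)
    case 0
    then show ?thesis using assms(1) by simp
  next
    case (Suc j)
    then have "\<not> ?P j"
      using not_less_Least[of j ?P] by (simp add: k_def)
    then show ?thesis using Suc by simp
  qed
  then show ?thesis
    using that[of "Suc k"] k m by auto
qed

text \<open>Each inequality belongs to one side. The last two force a nonnegative real part, because
  \<open>m - 1\<close> exceeds 1.\<close>

lemma mem_triangle:
  "z \<in> triangle \<longleftrightarrow> Re z \<le> 1 \<and> Re z \<le> Im z \<and> Im z \<le> (real m - 1) * Re z"
proof
  assume "z \<in> triangle"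
  then obtain u v w where uvw: "0 \<le> u" "0 \<le> v" "0 \<le> w" "u + v + w = 1"
    "z = u *\<^sub>R 0 + v *\<^sub>R Complex 1 1 + w *\<^sub>R Complex 1 (real m - 1)"
    unfolding triangle_def convex_hull_3 by blast
  have z: "Re z = v + w" "Im z = v + w * (real m - 1)"
    using uvw(5) by auto
  have "0 \<le> v * (real m - 2)" "0 \<le> w * (real m - 2)"
    using uvw m by auto
  then show "Re z \<le> 1 \<and> Re z \<le> Im z \<and> Im z \<le> (real m - 1) * Re z"
    using uvw(1,4) unfolding z by (auto simp: algebra_simps)
next
  assume z: "Re z \<le> 1 \<and> Re z \<le> Im z \<and> Im z \<le> (real m - 1) * Re z"
  define w where "w = (Im z - Re z) / (real m - 2)"
  have m2: "real m - 2 > 0" using m by simp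
  have w: "0 \<le> w" "w \<le> Re z" "w * (real m - 2) = Im z - Re z"
    using z m2 by (auto simp: w_def field_simps)
  have "z = (1 - Re z) *\<^sub>R 0 + (Re z - w) *\<^sub>R Complex 1 1 + w *\<^sub>R Complex 1 (real m - 1)"
    using w(3) by (auto simp: complex_eq_iff algebra_simps)
  then show "z \<in> triangle"
    unfolding triangle_def convex_hull_3 mem_Collect_eq
    using z w by (intro exI[of _ "1 - Re z"] exI[of _ "Re z - w"] exI[of _ w] conjI) auto
qed

text \<open>The image determines \<open>p\<close>, and for positive \<open>p\<close> the slope
  determines the triangle and \<open>r\<close>, except on a common spoke: there \<open>r = p\<close>
  in one triangle and \<open>r = 0\<close> in the next describe the same point.\<close>

lemma pl_bij_flat: "pl_bij (geometric_carrier fan_complex) triangle flat"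
proof -
  have aff: "affine_map_on P flat" for P
    using linear_flat by (rule affine_map_onI[of _ _ _ 0]) simp
  have "pw_affine (geometric_carrier fan_complex) flat"
    by (rule pw_affineE[OF polytopal_geometric_carrier[of fan_complex]], rule pw_affineI)
       (use aff in auto)
  moreover have "inj_on flat (geometric_carrier fan_complex)"
  proof (rule inj_onI)
    fix x y assume "x \<in> geometric_carrier fan_complex" "y \<in> geometric_carrier fan_complex" and eq: "flat x = flat y"
    then obtain i p r j p' r' where
      i: "1 \<le> i" "Suc i < m" and pr: "0 \<le> r" "r \<le> p" "x = point i p r" and
      j: "1 \<le> j" "Suc j < m" and pr': "0 \<le> r'" "r' \<le> p'" "y = point j p' r'"
      unfolding mem_fan_carrier by blast
    have pp: "p' = p" and im: "real i * p + r = real j * p + r'"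
      using eq pr(3) pr'(3) flat_point[OF i] flat_point[OF j] by auto
    have glue: "point k p s = point l p s'"
      if "k < l" "real k * p + s = real l * p + s'" "0 \<le> s'" "s \<le> p" "0 \<le> s" for k l s s'
    proof (cases "p = 0")
      case True
      then have "s = 0" "s' = 0" using that by auto
      then show ?thesis using True by (simp add: point_def)
    next
      case False
      then have p: "p > 0" using that by simp
      have "real (Suc k) * p \<le> real l * p"
        using that(1) p by (intro mult_right_mono) auto
      then have "s = p" "s' = 0" "real (Suc k) * p = real l * p"
        using that by (auto simp: algebra_simps)
      then have "l = Suc k" using p by simp
      then show ?thesis
        using \<open>s = p\<close> \<open>s' = 0\<close> by (simp add: point_def)
    qed
    show "x = y"
    proof (cases i j rule: linorder_cases)
      case less
      then show ?thesis using glue[of i j r r'] im pr pr' pp by simp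
    next
      case equal
      then show ?thesis using im pr pr' pp by simp
    next
      case greater
      then show ?thesis using glue[of j i r' r] im pr pr' pp by simp
    qed
  qed
  moreover have "flat ` geometric_carrier fan_complex = triangle"
  proof (intro equalityI subsetI)
    fix z assume "z \<in> flat ` geometric_carrier fan_complex"
    then obtain i p r where i: "1 \<le> i" "Suc i < m" and pr: "0 \<le> r" "r \<le> p" "p \<le> 1" and
      z: "z = Complex p (real i * p + r)"
      using mem_fan_carrier flat_point by fastforce
    have "p \<le> real i * p" "real (Suc i) * p \<le> (real m - 1) * p"
      using mult_right_mono[of 1 "real i" p] mult_right_mono[of "real (Suc i)" "real m - 1" p] i pr by auto
    then show "z \<in> triangle"
      using pr unfolding mem_triangle z by (auto simp: algebra_simps)
  next
    fix z assume "z \<in> triangle"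
    then have z: "Re z \<le> 1" "Re z \<le> Im z" "Im z \<le> (real m - 1) * Re z"
      unfolding mem_triangle by auto
    obtain i where i: "1 \<le> i" "Suc i < m" "real i * Re z \<le> Im z" "Im z \<le> real (Suc i) * Re z"
      using bracket[OF z(2,3)] .
    let ?r = "Im z - real i * Re z"
    have "point i (Re z) ?r \<in> geometric_carrier fan_complex"
      unfolding mem_fan_carrier using i z
      by (intro exI[of _ i] conjI exI[of _ "Re z"] exI[of _ ?r]) (auto simp: algebra_simps)
    moreover have "flat (point i (Re z) ?r) = z"
      using flat_point[OF i(1,2)] by (simp add: complex_eq_iff)
    ultimately show "z \<in> flat ` geometric_carrier fan_complex"
      by (metis imageI)
  qed
  ultimately show ?thesis
    by (simp add: pl_bij_def bij_betw_def)
qed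

lemma vertical_segment:
  "a \<le> b \<Longrightarrow> closed_segment (Complex 1 a) (Complex 1 b) = {z. Re z = 1 \<and> a \<le> Im z \<and> Im z \<le> b}"
  by (auto simp: closed_segment_same_Re closed_segment_eq_real_ivl)

lemma flat_face:
  "flat ` face_simplex {c i, c j} = closed_segment (flat (axis (c i) 1)) (flat (axis (c j) 1))"
  using convex_hull_linear_image[OF linear_flat, of "(\<lambda>v. axis v 1) ` {c i, c j}"]
  by (simp add: segment_convex_hull)

text \<open>The first and the last edge of the cycle become the sides at the apex, and the other
  edges tile the vertical side.\<close>

lemma flat_polygon: "flat ` geometric_carrier polygon = frontier triangle"
proof -
  have car: "geometric_carrier polygon = (\<Union>i<m. face_simplex {c i, c (Suc i mod m)})"
  proof (intro set_eqI)
    fix x :: "real ^ 'v"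
    have "x \<in> geometric_carrier polygon \<longleftrightarrow>
        (\<forall>v. 0 \<le> x $ v) \<and> (\<Sum>v\<in>UNIV. x $ v) = 1 \<and> (\<exists>i<m. support x \<subseteq> {c i, c (Suc i mod m)})"
      unfolding mem_geometric_carrier[OF abstract_complex_polygon] by (simp add: polygon_def)
    also have "\<dots> \<longleftrightarrow> x \<in> (\<Union>i<m. face_simplex {c i, c (Suc i mod m)})"
      unfolding UN_iff mem_face_simplex lessThan_iff bex_simps by auto
    finally show "x \<in> geometric_carrier polygon \<longleftrightarrow> x \<in> (\<Union>i<m. face_simplex {c i, c (Suc i mod m)})" .
  qed
  define seg where "seg i = flat ` face_simplex {c i, c (Suc i mod m)}" for i
  have seg_0: "seg 0 = closed_segment 0 (Complex 1 1)"
    using flat_face[of 0 1] m flat_axis[of 0] flat_axis[of 1] by (simp add: seg_def)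
  have seg_last: "seg (m - 1) = closed_segment (Complex 1 (real m - 1)) 0"
    using flat_face[of "m - 1" 0] m flat_axis[of 0] flat_axis[of "m - 1"] by (simp add: seg_def of_nat_diff)
  have seg_mid: "seg i = {z. Re z = 1 \<and> real i \<le> Im z \<and> Im z \<le> real (Suc i)}" if "1 \<le> i" "Suc i < m" for i
    using flat_face[of i "Suc i"] that flat_axis[of i] flat_axis[of "Suc i"]
      vertical_segment[of "real i" "real (Suc i)"] by (simp add: seg_def)
  have mid: "(\<Union>i\<in>{1..<m - 1}. seg i) = closed_segment (Complex 1 1) (Complex 1 (real m - 1))"
  proof -
    have "(\<Union>i\<in>{1..<m - 1}. seg i) = {z. Re z = 1 \<and> 1 \<le> Im z \<and> Im z \<le> real m - 1}"
    proof (intro equalityI subsetI)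
      fix z assume "z \<in> (\<Union>i\<in>{1..<m - 1}. seg i)"
      then obtain i where i: "1 \<le> i" "Suc i < m" "z \<in> seg i" by auto
      then have "real (Suc i) \<le> real m - 1" by simp
      then show "z \<in> {z. Re z = 1 \<and> 1 \<le> Im z \<and> Im z \<le> real m - 1}"
        using i seg_mid[OF i(1,2)] by auto
    next
      fix z assume z: "z \<in> {z. Re z = 1 \<and> 1 \<le> Im z \<and> Im z \<le> real m - 1}"
      then obtain i where i: "1 \<le> i" "Suc i < m" "real i \<le> Im z" "Im z \<le> real (Suc i)"
        using bracket[of 1 "Im z"] by auto
      then have "z \<in> seg i" using seg_mid[OF i(1,2)] z by simp
      then show "z \<in> (\<Union>i\<in>{1..<m - 1}. seg i)" using i by auto
    qed
    then show ?thesis using vertical_segment[of 1 "real m - 1"] m by simp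
  qed
  have "{..<m} = {0} \<union> {1..<m - 1} \<union> {m - 1}"
    using m by auto
  then have "flat ` geometric_carrier polygon = seg 0 \<union> (\<Union>i\<in>{1..<m - 1}. seg i) \<union> seg (m - 1)"
    unfolding car seg_def image_UN by auto
  also have "\<dots> = frontier triangle"
    unfolding seg_0 mid seg_last triangle_def by (rule frontier_of_triangle[symmetric]) simp
  finally show ?thesis .
qed

lemma rel_frontier_triangle: "rel_frontier triangle = frontier triangle"
proof -
  let ?U = "{z. Re z < 1} \<inter> {z. Re z < Im z} \<inter> {z. Im z < (real m - 1) * Re z}"
  have "open ?U"
    by (intro open_Int open_Collect_less continuous_intros)
  moreover have "?U \<subseteq> triangle"
    by (auto simp: mem_triangle)
  \<comment> \<open>The slope 3/2 is strictly between 1 and \<open>m - 1\<close>, which is at least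
    2.\<close>
  moreover have "Complex (1/2) (3/4) \<in> ?U"
    using m by simp
  ultimately have "interior triangle \<noteq> {}"
    using interior_maximal by blast
  then show ?thesis
    by (rule rel_frontier_nonempty_interior)
qed

end

section \<open>Closing a disc by a fan\<close>

context disc_chart
begin

lemma sphere_of_disc:
  assumes n: "4 \<le> card (vertices B)"
  shows "\<exists>S. combinatorial_sphere 2 S \<and> B \<subseteq> S \<and> vertices S = vertices B"
proof -
  obtain v where v: "v \<in> vertices E" "\<And>u. u \<in> vertices E \<Longrightarrow> {v, u} \<in> B \<Longrightarrow> {v, u} \<in> E"
    using chordless_boundary_vertex by blast
  obtain G where G: "continuous_on (geometric_carrier B) G"
    "bij_betw G (geometric_carrier B) (cball (0::complex) 1)" "G ` geometric_carrier E = sphere 0 1"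
    by (rule obtain_disc_map)
  interpret circ: circle_complex E G by (rule circle_complex_boundary[OF G])
  obtain m c where cyc: "3 \<le> m" "inj_on c {..<m}" "c 0 = v" "vertices E = c ` {..<m}"
    "\<And>i. i < m \<Longrightarrow> {c i, c (Suc i mod m)} \<in> E"
    "\<And>e. e \<in> E \<Longrightarrow> card e = 2 \<Longrightarrow> \<exists>i<m. e = {c i, c (Suc i mod m)}"
    using circ.cyclic_order[OF v(1)] by metis
  interpret fan c m by unfold_locales (use cyc in auto)
  have subE: "s \<in> E" if "t \<in> E" "s \<subseteq> t" for s t
    using that E_complex by (simp add: abstract_complex_def)
  have E_eq: "E = polygon"
  proof (intro equalityI subsetI)
    fix s assume s: "s \<in> E"
    show "s \<in> polygon"
    proof (cases "card s = 2")
      case True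
      then show ?thesis using cyc(6)[OF s] by (auto simp: polygon_def)
    next
      case False
      have sV: "s \<subseteq> c ` {..<m}" using s cyc(4) by (auto simp: vertices_def)
      have "card s \<le> Suc 0" using False E_card[OF s] by simp
      then have single: "x = y" if "x \<in> s" "y \<in> s" for x y
        using that card_le_Suc0_iff_eq[of s] by simp
      have "\<exists>i<m. s \<subseteq> {c i}"
      proof (cases "s = {}")
        case True
        then show ?thesis using m by (intro exI[of _ 0]) simp
      next
        case False
        then obtain u where "u \<in> s" by blast
        moreover from this obtain i where "i < m" "u = c i" using sV by blast
        ultimately show ?thesis using single by blast
      qed
      then show ?thesis unfolding polygon_def by blast
    qed
  next
    fix s assume "s \<in> polygon"
    then show "s \<in> E" using cyc(5) subE by (auto simp: polygon_def)
  qed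
  \<comment> \<open>Since \<open>v\<close> is on no chord, the only spokes in \<open>B\<close> are
    the two boundary edges at \<open>v\<close>, that is, the first and the last one.\<close>
  have spoke: "j = 1 \<or> j = m - 1" if "0 < j" "j < m" "{c 0, c j} \<in> B" for j
  proof -
    have "{c 0, c j} \<in> E"
      using v(2)[of "c j"] that cyc(3,4) by auto
    moreover have "card {c 0, c j} = 2"
      using that c_eq_iff[of 0 j] by simp
    ultimately obtain i where i: "i < m" "{c 0, c j} = {c i, c (Suc i mod m)}"
      using cyc(6) by metis
    have "Suc i mod m < m" using m by simp
    then have "0 = i \<and> j = Suc i mod m \<or> 0 = Suc i mod m \<and> j = i"
      using i that c_eq_iff by (auto simp: doubleton_eq_iff)
    then show ?thesis
    proof (elim disjE conjE)
      assume "0 = i" "j = Suc i mod m"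
      then show ?thesis using m by simp
    next
      assume "0 = Suc i mod m" "j = i"
      then show ?thesis using i(1) by (cases "Suc i = m") auto
    qed
  qed
  have Int: "B \<inter> fan_complex = E"
  proof (intro equalityI subsetI)
    fix s assume "s \<in> E"
    then obtain i where i: "i < m" "s \<subseteq> {c i, c (Suc i mod m)}"
      unfolding E_eq polygon_def by blast
    have "s \<in> fan_complex"
    proof -
      consider "i = 0" | "1 \<le> i" "Suc i < m" | "Suc i = m" using i(1) by linarith
      then show ?thesis
      proof cases
        case 1
        then have "s \<subseteq> {c 0, c 1, c (Suc 1)}" using i(2) m by auto
        then show ?thesis unfolding fan_complex_def using m by (intro CollectI exI[of _ 1]) simp
      next
        case 2
        then have "s \<subseteq> {c 0, c i, c (Suc i)}" using i(2) by auto
        then show ?thesis unfolding fan_complex_def using 2 by blast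
      next
        case 3
        then have "s \<subseteq> {c 0, c (i - 1), c (Suc (i - 1))}" using i(2) m by auto
        then show ?thesis unfolding fan_complex_def using 3 m by (intro CollectI exI[of _ "i - 1"]) simp
      qed
    qed
    then show "s \<in> B \<inter> fan_complex" using \<open>s \<in> E\<close> E_subset by blast
  next
    fix s assume "s \<in> B \<inter> fan_complex"
    then obtain i where s: "s \<in> B" and i: "1 \<le> i" "Suc i < m" "s \<subseteq> {c 0, c i, c (Suc i)}"
      unfolding fan_complex_def by blast
    have two: "t \<in> E" if t: "t \<in> B" "t \<subseteq> {c 0, c j}" "0 < j" "j < m" for t j
    proof (cases "t = {c 0, c j}")
      case True
      then show ?thesis using v(2)[of "c j"] t cyc(3,4) by auto
    next
      case False
      then have "t \<subseteq> {c 0} \<or> t \<subseteq> {c j}" using t(2) by blast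
      then show ?thesis
        using subE[OF cyc(5)[of 0], of t] subE[OF cyc(5)[of j], of t] t(4) m by auto
    qed
    show "s \<in> E"
    proof (cases "s = {c 0, c i, c (Suc i)}")
      case False
      then consider "s \<subseteq> {c i, c (Suc i)}" | "s \<subseteq> {c 0, c (Suc i)}" | "s \<subseteq> {c 0, c i}"
        using i(3) by blast
      then show ?thesis
      proof cases
        case 1
        then show ?thesis using cyc(5)[of i] i subE by auto
      next
        case 2
        then show ?thesis using two[OF s] i by blast
      next
        case 3
        then show ?thesis using two[OF s] i by auto
      qed
    next
      case True
      \<comment> \<open>Both spokes of a fan triangle in \<open>B\<close> are in \<open>B\<close>,
        so they are the first and the last spoke, and the boundary is the boundary of this triangle.
        Then \<open>B\<close> would have only its three vertices.\<close>
      have "{c 0, c i} \<in> B" "{c 0, c (Suc i)} \<in> B"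
        using s True by (auto intro: subset_face)
      then have "i = 1" "m = 3"
        using spoke[of i] spoke[of "Suc i"] i by auto
      then have s3: "s = {c 0, c 1, c 2}" using True by (simp add: numeral_2_eq_2)
      have card: "card s = 2 + 1"
        using c_eq_iff[of 0 1] c_eq_iff[of 0 2] c_eq_iff[of 1 2] \<open>m = 3\<close> by (simp add: s3)
      have edges: "{c 0, c 1} \<in> E" "{c 1, c 2} \<in> E" "{c 2, c 0} \<in> E"
      proof -
        have lt: "0 < m" "1 < m" "2 < m" and mods: "Suc 0 mod m = 1" "Suc 1 mod m = 2" "Suc 2 mod m = 0"
          using \<open>m = 3\<close> by simp_all
        show "{c 0, c 1} \<in> E" "{c 1, c 2} \<in> E" "{c 2, c 0} \<in> E"
          using cyc(5)[OF lt(1)] cyc(5)[OF lt(2)] cyc(5)[OF lt(3)] unfolding mods .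
      qed
      have "t \<in> E" if "t \<subset> s" for t
      proof -
        have "t \<subseteq> {c 0, c 1} \<or> t \<subseteq> {c 1, c 2} \<or> t \<subseteq> {c 2, c 0}"
          using that unfolding s3 by blast
        then show ?thesis using edges subE by blast
      qed
      then have "vertices B \<subseteq> s"
        using facet_with_boundary_in_boundary[OF s card] by blast
      then have "card (vertices B) \<le> card s" by (intro card_mono) auto
      then show ?thesis using n card by simp
    qed
  qed
  have tri: "convex triangle" "compact triangle"
    by (auto simp: triangle_def finite_imp_compact_convex_hull)
  have fr: "flat ` geometric_carrier E = rel_frontier triangle"
    unfolding E_eq flat_polygon rel_frontier_triangle ..
  then have fr_ne: "rel_frontier triangle \<noteq> {}"
    using boundary_carrier_nonempty by blast
  have "triangle \<noteq> {}" by (simp add: triangle_def)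
  \<comment> \<open>The triangle is viewed as a cone from a point inside it, so that the base of the
    cone is the whole frontier and matches the boundary of \<open>B\<close>.\<close>
  then obtain z where z: "z \<in> rel_interior triangle"
    using rel_interior_eq_empty[OF tri(1)] by blast
  have le: "card (vertices B) \<le> CARD('v)"
    by (rule card_mono) auto
  have "combinatorial_sphere 2 (B \<union> fan_complex)"
  proof (rule combinatorial_sphere_Un_cone[OF complex abstract_complex_fan])
    show "pl_bij (geometric_carrier fan_complex) (cone_over z (rel_frontier triangle)) flat"
      using pl_bij_flat cone_over_rel_frontier(1)[OF tri z fr_ne] by simp
    show "visible_from z (rel_frontier triangle)"
      using cone_over_rel_frontier(2)[OF tri z fr_ne] .
    show "f ` geometric_carrier (B \<inter> fan_complex) = rel_frontier T"
      unfolding Int by (rule boundary_image)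
    show "flat ` geometric_carrier (B \<inter> fan_complex) = rel_frontier triangle"
      unfolding Int by (rule fr)
  qed (use n le simplex chart in auto)
  moreover have "vertices (B \<union> fan_complex) = vertices B"
  proof -
    have "\<Union>fan_complex \<subseteq> vertices E"
      unfolding cyc(4) fan_complex_def by auto
    also have "\<dots> \<subseteq> vertices B"
      using E_subset by (auto simp: vertices_def)
    finally show ?thesis by (auto simp: vertices_def)
  qed
  ultimately show ?thesis by blast
qed

end

theorem theorem8:
  fixes B :: "'v::finite set set" and d n :: nat
  assumes "d \<ge> 1"
    and "combinatorial_ball d B" and "card (vertices B) = n"
    and "n \<ge> d + 2"
    and "(\<exists>v\<in>vertices B. vertex_degree B v = d) \<or> d = 2"
  shows "\<exists>S. combinatorial_sphere d S \<and> card (vertices S) = n \<and> B \<subseteq> S \<and> vertices S = vertices B"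
proof -
  obtain T :: "(real ^ 'v) set" and f where T: "int d simplex T" "pl_bij (geometric_carrier B) T f"
    and B: "abstract_complex B"
    using assms(2) unfolding combinatorial_ball_def pl_homeomorphic_iff_pl_bij by blast
  have chart: "ball_chart B d T f"
    using T B assms(1) by unfold_locales
  have "\<exists>S. combinatorial_sphere d S \<and> B \<subseteq> S \<and> vertices S = vertices B"
    using assms(5)
  proof
    assume "\<exists>v\<in>vertices B. vertex_degree B v = d"
    then show ?thesis
      using ball_chart.sphere_of_low_degree_vertex[OF chart] assms(3,4) by blast
  next
    assume "d = 2"
    then have "disc_chart B T f"
      using chart by (simp add: disc_chart_def)
    then show ?thesis
      using disc_chart.sphere_of_disc[of B T f] assms(3,4) \<open>d = 2\<close> by simp
  qed
  then show ?thesis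
    using assms(3) by auto
qed

end
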